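(* Let $n\ge 1$ and let $\lambda\in X_+$ be a dominant weight of $SL_{n+1}(\mathbb{C})$. Let $\mathbb{B}_1(\lambda)$ be the (undirected) graph with vertex set $\mathcal{B}(\lambda)$ in which $b$ and $b'$ are joined by an edge if and only if $b=w(b')$ for some $w\in W$, or one of them is obtained from the other by applying the crystal operator $f_n$. Then the connected components of $\mathbb{B}_1(\lambda)$ (that is, the closures of the $W$-orbits under $f_n$) are the atoms of an atomic decomposition of $\mathcal{B}(\lambda)$.
   Context: $X$ is the weight lattice of $SL_{n+1}(\mathbb{C})$, $\Phi\subset X$ its root system (type $A_n$) with simple roots $\alpha_1,\dots,\alpha_n$ in the usual order along the Dynkin diagram, positive roots $\Phi_+$, coroots $\beta^\vee$ for $\beta\in\Phi$; $X_+\subset X$ is the set of dominant weights and $W\cong S_{n+1}$ is the Weyl group with simple reflections $s_1,\dots,s_n$. For $\lambda\in X_+$, $\mathcal{B}(\lambda)$ is the crystal (Kashiwara) of the irreducible representation of highest weight $\lambda$, with weight map $\mathrm{wt}:\mathcal{B}(\lambda)\to X$ and crystal operators $e_i,f_i:\mathcal{B}(\lambda)\to\mathcal{B}(\lambda)\sqcup\{0\}$, $\mathrm{wt}(f_i(b))=\mathrm{wt}(b)-\alpha_i$. The Weyl group acts on $\mathcal{B}(\lambda)$ by letting $s_i$ reverse each $\alpha_i$-string: $s_i(b)=f_i^{k}(b)$ if $k=\langle \mathrm{wt}(b),\alpha_i^\vee\rangle\ge0$ and $s_i(b)=e_i^{-k}(b)$ if $k<0$. Bruhat order on $X$: the partial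 order generated by the relations $\nu<\mu$ whenever $\mu-\nu=k\beta$ with $\beta\in\Phi_+$, $k\in\mathbb{Z}$, and either $\langle\mu,\beta^\vee\rangle\ge k>0$ or $\langle\mu,\beta^\vee\rangle<k<0$. For $\mu\in X_+$, the set $\{\nu\in X\mid\nu\le\mu\}$ is the set of weights in $\mu+\mathbb{Z}\Phi$ lying in the convex hull of $W\cdot\mu$. An atomic decomposition of $\mathcal{B}(\lambda)$ is a partition $\mathcal{B}(\lambda)=\bigsqcup_i\mathcal{A}_i$ such that for each $i$: (1) $\mathrm{wt}(b)\ne\mathrm{wt}(b')$ for all $b\neq b'$ in $\mathcal{A}_i$; (2) there is $\mu\in X_+$ with $\{\mathrm{wt}(b)\mid b\in\mathcal{A}_i\}=\{\nu\in X\mid\nu\le\mu\}$. The sets $\mathcal{A}_i$ are called atoms. *)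

theory Defs
  imports "HOL-Library.Disjoint_Sets"
begin

text \<open>
  A weight is given by its coordinates in the basis of fundamental weights, so
  \<open>\<mu> i\<close> is the pairing of \<open>\<mu>\<close> with the \<open>i\<close>-th simple coroot
  for \<open>1 \<le> i \<le> n\<close>; all other values are \<open>0\<close>, so that equality of weights is
  equality of functions.
\<close>

type_synonym weight = "nat \<Rightarrow> int"

definition weights :: "nat \<Rightarrow> weight set" where
  "weights n = {\<mu>. \<forall>i. i \<notin> {1..n} \<longrightarrow> \<mu> i = 0}"

definition dominant_weights :: "nat \<Rightarrow> weight set" where
  "dominant_weights n = {\<mu> \<in> weights n. \<forall>i\<in>{1..n}. 0 \<le> \<mu> i}"

text \<open>The coordinates of a simple root are the entries of the Cartan matrix.\<close>

definition simple_root :: "nat \<Rightarrow> nat \<Rightarrow> weight" where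
  "simple_root n i = (\<lambda>k. if k \<notin> {1..n} then 0
     else if k = i then 2 else if k = i + 1 \<or> i = k + 1 then -1 else 0)"

text \<open>
  The positive roots are the sums \<open>\<alpha>\<^sub>i + \<dots> + \<alpha>\<^sub>j\<close> with \<open>1 \<le> i \<le> j \<le> n\<close>, and
  the coroot of such a root is the sum of the simple coroots with the same indices.
\<close>

definition positive_root :: "nat \<Rightarrow> nat \<Rightarrow> nat \<Rightarrow> weight" where
  "positive_root n i j = (\<lambda>k. \<Sum>l=i..j. simple_root n l k)"

definition coroot_pairing :: "weight \<Rightarrow> nat \<Rightarrow> nat \<Rightarrow> int" where
  "coroot_pairing \<mu> i j = (\<Sum>l=i..j. \<mu> l)"

definition bruhat_step :: "nat \<Rightarrow> weight \<Rightarrow> weight \<Rightarrow> bool" where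
  "bruhat_step n \<nu> \<mu> \<longleftrightarrow> \<nu> \<in> weights n \<and> \<mu> \<in> weights n \<and>
     (\<exists>i j k. 1 \<le> i \<and> i \<le> j \<and> j \<le> n \<and>
        (\<forall>l. \<mu> l - \<nu> l = k * positive_root n i j l) \<and>
        (coroot_pairing \<mu> i j \<ge> k \<and> k > 0 \<or> coroot_pairing \<mu> i j < k \<and> k < 0))"

definition bruhat_le :: "nat \<Rightarrow> weight \<Rightarrow> weight \<Rightarrow> bool" where
  "bruhat_le n = (bruhat_step n)\<^sup>*\<^sup>*"

text \<open>The value \<open>None\<close> of a crystal operator plays the role of the symbol \<open>0\<close>.\<close>

record 'b crystal =
  elements :: "'b set"
  wt :: "'b \<Rightarrow> weight"
  eop :: "nat \<Rightarrow> 'b \<Rightarrow> 'b option"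
  fop :: "nat \<Rightarrow> 'b \<Rightarrow> 'b option"

definition op_power :: "('b \<Rightarrow> 'b option) \<Rightarrow> nat \<Rightarrow> 'b \<Rightarrow> 'b option" where
  "op_power g k b = ((\<lambda>x. Option.bind x g) ^^ k) (Some b)"

text \<open>
  In the crystal of an integrable representation the powers occurring here are never \<open>None\<close>.
\<close>

definition simple_reflection :: "'b crystal \<Rightarrow> nat \<Rightarrow> 'b \<Rightarrow> 'b" where
  "simple_reflection C i b =
     (let k = wt C b i in
        if 0 \<le> k then the (op_power (fop C i) (nat k) b)
        else the (op_power (eop C i) (nat (- k)) b))"

text \<open>
  The Weyl group is generated by the simple reflections, so the elements \<open>w(b)\<close> are the
  results of applying finite sequences of simple reflections to \<open>b\<close>.
\<close>

definition weyl_related :: "nat \<Rightarrow> 'b crystal \<Rightarrow> 'b \<Rightarrow> 'b \<Rightarrow> bool" where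
  "weyl_related n C b b' \<longleftrightarrow>
     (\<exists>js. set js \<subseteq> {1..n} \<and> b = foldr (simple_reflection C) js b')"

definition B1_edges :: "nat \<Rightarrow> 'b crystal \<Rightarrow> ('b \<times> 'b) set" where
  "B1_edges n C = {(b, b'). b \<in> elements C \<and> b' \<in> elements C \<and>
     (weyl_related n C b b' \<or> fop C n b = Some b' \<or> fop C n b' = Some b)}"

definition B1_components :: "nat \<Rightarrow> 'b crystal \<Rightarrow> 'b set set" where
  "B1_components n C = elements C // ((B1_edges n C)\<^sup>* \<inter> elements C \<times> elements C)"

definition atomic_decomposition :: "nat \<Rightarrow> 'b crystal \<Rightarrow> 'b set set \<Rightarrow> bool" where
  "atomic_decomposition n C P \<longleftrightarrow> partition_on (elements C) P \<and>
     (\<forall>A\<in>P. inj_on (wt C) A \<and>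
        (\<exists>\<mu>\<in>dominant_weights n. wt C ` A = {\<nu> \<in> weights n. bruhat_le n \<nu> \<mu>}))"

text \<open>
  The crystal of the vector representation has elements \<open>1, \<dots>, n + 1\<close>, with
  \<open>f\<^sub>i\<close> sending \<open>i\<close> to \<open>i + 1\<close>. A list stands for the tensor product of its letters.
  The operators follow Kashiwara's convention: \<open>f\<^sub>i(b \<otimes> c) = f\<^sub>i b \<otimes> c\<close> if
  \<open>\<phi>\<^sub>i(b) > \<epsilon>\<^sub>i(c)\<close> and \<open>b \<otimes> f\<^sub>i c\<close> otherwise, while \<open>e\<^sub>i(b \<otimes> c) = e\<^sub>i b \<otimes> c\<close> if
  \<open>\<phi>\<^sub>i(b) \<ge> \<epsilon>\<^sub>i(c)\<close> and \<open>b \<otimes> e\<^sub>i c\<close> otherwise; moreover \<open>\<epsilon>\<^sub>i(b \<otimes> c)\<close> is the maximum of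
  \<open>\<epsilon>\<^sub>i(b)\<close> and \<open>\<epsilon>\<^sub>i(c) - (\<phi>\<^sub>i(b) - \<epsilon>\<^sub>i(b))\<close>.
\<close>

definition letter_eps :: "nat \<Rightarrow> nat \<Rightarrow> int" where
  "letter_eps i a = (if a = i + 1 then 1 else 0)"

definition letter_phi :: "nat \<Rightarrow> nat \<Rightarrow> int" where
  "letter_phi i a = (if a = i then 1 else 0)"

definition letter_e :: "nat \<Rightarrow> nat \<Rightarrow> nat option" where
  "letter_e i a = (if a = i + 1 then Some i else None)"

definition letter_f :: "nat \<Rightarrow> nat \<Rightarrow> nat option" where
  "letter_f i a = (if a = i then Some (i + 1) else None)"

primrec word_eps :: "nat \<Rightarrow> nat list \<Rightarrow> int" where
  "word_eps i [] = 0"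
| "word_eps i (a # w) =
     max (letter_eps i a) (word_eps i w - (letter_phi i a - letter_eps i a))"

primrec word_e :: "nat \<Rightarrow> nat list \<Rightarrow> nat list option" where
  "word_e i [] = None"
| "word_e i (a # w) =
     (if letter_phi i a \<ge> word_eps i w
      then map_option (\<lambda>a'. a' # w) (letter_e i a)
      else map_option (\<lambda>w'. a # w') (word_e i w))"

primrec word_f :: "nat \<Rightarrow> nat list \<Rightarrow> nat list option" where
  "word_f i [] = None"
| "word_f i (a # w) =
     (if letter_phi i a > word_eps i w
      then map_option (\<lambda>a'. a' # w) (letter_f i a)
      else map_option (\<lambda>w'. a # w') (word_f i w))"

definition word_wt :: "nat \<Rightarrow> nat list \<Rightarrow> weight" where
  "word_wt n w = (\<lambda>i. if i \<in> {1..n} then \<Sum>a\<leftarrow>w. letter_phi i a - letter_eps i a else 0)"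

text \<open>
  The word \<open>1\<^sup>p\<^sup>1 2\<^sup>p\<^sup>2 \<dots> n\<^sup>p\<^sup>n\<close>, where \<open>(p1, \<dots>, pn)\<close> is the partition with
  \<open>pi - p(i+1) = lam i\<close> and \<open>p(n+1) = 0\<close>. It has weight \<open>lam\<close> and is annihilated by all \<open>e\<^sub>i\<close>.
\<close>

definition highest_word :: "nat \<Rightarrow> weight \<Rightarrow> nat list" where
  "highest_word n lam = concat (map (\<lambda>i. replicate (nat (\<Sum>l=i..n. lam l)) i) [1..<n + 1])"

text \<open>
  The crystal of the irreducible representation of highest weight \<open>lam\<close> is the connected
  component, in the tensor power of the vector crystal, of a highest weight element of
  weight \<open>lam\<close>.
\<close>

definition hw_crystal :: "nat \<Rightarrow> weight \<Rightarrow> nat list crystal" where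
  "hw_crystal n lam =
     \<lparr>elements = {b. (\<lambda>c d. \<exists>i\<in>{1..n}. word_e i c = Some d \<or> word_f i c = Some d)\<^sup>*\<^sup>*
                       (highest_word n lam) b},
      wt = word_wt n, eop = word_e, fop = word_f\<rparr>"

end

theory Submission
  imports Defs "HOL-Combinatorics.Transposition"
begin

text \<open>
  Conjugating \<open>f\<^sub>n\<close> by the Weyl group gives operators \<open>f\<^sub>i\<^sub>j\<close> for all ordered pairs of letters, and
  the components are the closures under these and under \<open>W\<close>. Call \<open>f\<^sub>i\<^sub>j\<close> a descent at \<open>b\<close> if \<open>b\<close> has
  at least two more letters \<open>i\<close> than \<open>j\<close>. Descents decrease the sum of the squared contents,
  and whether they are defined depends only on the content. If they are confluent modulo
  \<open>W\<close>, then two elements of a component with the same content descend along the same path to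
  the same element; as the \<open>f\<^sub>i\<^sub>j\<close> are injective, the two elements agree.

  Confluence only needs peaks \<open>f\<^sub>i\<^sub>j, f\<^sub>i\<^sub>k\<close> and \<open>f\<^sub>i\<^sub>k, f\<^sub>j\<^sub>k\<close>, because disjoint pairs are joined through a
  pair that shares a letter with both. These peaks live on three letters, where in coordinates of
  Gelfand--Tsetlin type \<open>f\<^sub>2\<^sub>3\<close> moves the bottom entry, \<open>f\<^sub>1\<^sub>2\<close> moves one entry of the middle row
  independently of the bottom entry, and \<open>f\<^sub>1\<^sub>3\<close> is their composition.

  The set of contents of a component is then closed downwards, and it has a largest element by
  an upward confluence argument: three letters suffice unless the raising pairs \<open>i, j\<close> and \<open>k, l\<close>
  are disjoint with contents \<open>c\<^sub>i \<ge> c\<^sub>j > c\<^sub>k \<ge> c\<^sub>l\<close>, which needs one fact about four letters.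
\<close>

section \<open>Words and the action of simple reflections\<close>

text \<open>Nothing about the Weyl group action may be assumed: the reflections are string reversals
  of words, so even the braid relation has to be proved. Conjugates of \<open>f_n\<close> by
  reflections run through whole strings and are hard to follow letter by letter. The remedy is
  column insertion. On a block of three letters a word is recovered from a small pattern together
  with a recording history; the operators of the block preserve the history and are piecewise linear
  on patterns, so equations between words become case distinctions on six integers. For four letters
  only the existence of one raising is wanted, so positivity of a string length suffices and no
  recording is kept. Conjugating \<open>f_n\<close> by \<open>w\<close> with \<open>w(i) = n\<close>
  and \<open>w(j) = n + 1\<close> does not depend on \<open>w\<close>: two choices differ by a
  permutation of the letters below \<open>n\<close>, and the reflections generating these commute
  with \<open>f_n\<close>. The descending part must work with elements, since contents do not yet
  separate them. Once they do, the ascending part is carried out on contents alone.\<close>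

primrec content :: "nat list \<Rightarrow> nat \<Rightarrow> int" where
  "content [] = (\<lambda>i. 0)"
| "content (a # w) = (content w)(a := content w a + 1)"

text \<open>The weight identity between phi and epsilon is taken as definition; that it measures how
  often \<open>f_i\<close> applies follows from \<open>word_f_None\<close> and
  \<open>op_power_f_defined\<close>.\<close>

definition word_phi :: "nat \<Rightarrow> nat list \<Rightarrow> int" where
  "word_phi i w = word_eps i w + content w i - content w (i + 1)"

lemma word_eps_nonneg: "0 \<le> word_eps i w"
  by (induction w) (auto simp: letter_eps_def)

lemma word_phi_nonneg: "0 \<le> word_phi i w"
  by (induction w) (auto simp: word_phi_def letter_eps_def letter_phi_def)

text \<open>A letter has phi at most 1 and \<open>word_eps\<close> is nonnegative, so
  \<open>f_i\<close> acts on the first letter only if that letter is \<open>i\<close> and the rest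
  has epsilon 0. This replaces the defining equation as rewrite rule.\<close>

lemma word_f_Cons:
  "word_f i (a # w) = (if a = i \<and> word_eps i w = 0 then Some ((i + 1) # w)
     else map_option ((#) a) (word_f i w))"
  using word_eps_nonneg[of i w] by (auto simp: letter_phi_def letter_f_def)

declare word_f.simps(2) [simp del]

lemma word_f_step:
  "word_f i w = Some w' \<Longrightarrow> word_eps i w' = word_eps i w + 1 \<and> word_e i w' = Some w
     \<and> content w' = (content w)(i := content w i - 1, i + 1 := content w (i + 1) + 1)"
proof (induction w arbitrary: w')
  case (Cons a w)
  show ?case
  proof (cases "a = i \<and> word_eps i w = 0")
    case True
    with Cons.prems show ?thesis
      by (auto simp: word_f_Cons letter_eps_def letter_phi_def letter_e_def fun_eq_iff)
  next
    case False
    then obtain v where v: "word_f i w = Some v" "w' = a # v"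
      using Cons.prems by (auto simp: word_f_Cons split: if_splits)
    note IH = Cons.IH[OF v(1)]
    have "word_eps i w \<ge> 0" by (rule word_eps_nonneg)
    moreover have "content (a # v) j = ((content (a # w))(i := content (a # w) i - 1, i + 1 := content (a # w) (i + 1) + 1)) j" for j
      using IH by (auto dest!: fun_cong[where x = j])
    ultimately show ?thesis using IH False
      by (auto simp: v(2) letter_eps_def letter_phi_def letter_e_def fun_eq_iff)
  qed
qed simp

lemma word_e_step: "word_e i w = Some w' \<Longrightarrow> word_f i w' = Some w"
proof (induction w arbitrary: w')
  case (Cons a w)
  have nn: "word_eps i w \<ge> 0" by (rule word_eps_nonneg)
  show ?case
  proof (cases "letter_phi i a \<ge> word_eps i w")
    case True
    with Cons.prems nn show ?thesis
      by (auto simp: word_f_Cons letter_phi_def letter_e_def split: if_splits)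
  next
    case False
    then obtain v where v: "word_e i w = Some v" "w' = a # v"
      using Cons.prems by (auto split: if_splits)
    note IH = Cons.IH[OF v(1)]
    show ?thesis using IH word_f_step[OF IH] False
      by (auto simp: v(2) word_f_Cons letter_phi_def split: if_splits)
  qed
qed simp

lemma word_e_iff: "word_e i w' = Some w \<longleftrightarrow> word_f i w = Some w'"
  using word_e_step word_f_step by blast

lemma word_f_None: "word_f i w = None \<longleftrightarrow> word_phi i w = 0"
proof (induction w)
  case (Cons a w)
  then show ?case using word_eps_nonneg[of i w] word_phi_nonneg[of i w]
    by (auto simp: word_f_Cons word_phi_def letter_eps_def letter_phi_def)
qed (simp add: word_phi_def)

lemma word_e_None: "word_e i w = None \<longleftrightarrow> word_eps i w = 0"
proof (induction w)
  case (Cons a w)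
  then show ?case using word_eps_nonneg[of i w]
    by (auto simp: letter_eps_def letter_phi_def letter_e_def)
qed simp

section \<open>Strings and their reversal\<close>

lemma op_power_0: "op_power g 0 b = Some b"
  by (simp add: op_power_def)

lemma op_power_Suc: "op_power g (Suc k) b = Option.bind (op_power g k b) g"
  by (simp add: op_power_def)

lemma op_power_Suc2: "op_power g (Suc k) b = Option.bind (g b) (op_power g k)"
proof -
  have none: "((\<lambda>x. Option.bind x g) ^^ k) None = None" by (induction k) auto
  show ?thesis unfolding op_power_def funpow_Suc_right
    by (cases "g b") (auto simp: none op_power_def)
qed

lemma op_power_f_defined: "int k \<le> word_phi i w \<Longrightarrow> \<exists>w'. op_power (word_f i) k w = Some w'
    \<and> word_eps i w' = word_eps i w + int k
    \<and> content w' = (content w)(i := content w i - int k, i + 1 := content w (i + 1) + int k)"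
proof (induction k)
  case (Suc k)
  then have "int k \<le> word_phi i w" by simp
  from Suc.IH[OF this] obtain v where v: "op_power (word_f i) k w = Some v"
    "word_eps i v = word_eps i w + int k"
    "content v = (content w)(i := content w i - int k, i + 1 := content w (i + 1) + int k)" by blast
  have "word_phi i v = word_phi i w - int k"
    using v(2) fun_cong[OF v(3), of i] fun_cong[OF v(3), of "i + 1"] by (simp add: word_phi_def)
  then obtain u where u: "word_f i v = Some u" using word_f_None[of i v] Suc.prems by fastforce
  have "op_power (word_f i) (Suc k) w = Some u" by (simp add: op_power_Suc v(1) u)
  with word_f_step[OF u] v(2,3) show ?case
    by (auto simp: fun_eq_iff)
qed (simp add: op_power_0)

text \<open>Powers of \<open>e_i\<close> are powers of \<open>f_i\<close> read backwards, so from
  here on only \<open>f_i\<close> has to be analysed.\<close>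

lemma op_power_e_iff: "op_power (word_e i) k w' = Some w \<longleftrightarrow> op_power (word_f i) k w = Some w'"
proof (induction k arbitrary: w)
  case (Suc k)
  show ?case unfolding op_power_Suc[of "word_e i"] op_power_Suc2[of "word_f i"]
    using Suc word_e_iff by (auto simp: bind_eq_Some_conv) 
qed (auto simp: op_power_0)

lemma op_power_e_defined: "int k \<le> word_eps i w \<Longrightarrow> \<exists>w'. op_power (word_f i) k w' = Some w"
proof (induction k arbitrary: w)
  case (Suc k)
  then obtain v where v: "word_f i v = Some w"
    using word_e_None[of i w] word_e_iff[of i w] by fastforce
  with word_f_step[OF v] Suc obtain u where "op_power (word_f i) k u = Some v" by fastforce
  then have "op_power (word_f i) (Suc k) u = Some w" using v by (simp add: op_power_Suc)
  then show ?case ..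
qed (simp add: op_power_0)

text \<open>Reading the pairing from the content instead of the weight frees the reflection from the
  rank \<open>n\<close> and defines it for every index; the braid and commutation relations then
  hold without range conditions.\<close>

definition sref :: "nat \<Rightarrow> nat list \<Rightarrow> nat list" where
  "sref i w = (let k = content w i - content w (i + 1) in
     if 0 \<le> k then the (op_power (word_f i) (nat k) w) else the (op_power (word_e i) (nat (- k)) w))"

text \<open>Both directions are expressed by powers of \<open>f_i\<close>: in the second case the
  word itself is the end of a string segment starting at its reflection.\<close>

lemma sref_cases:
  obtains (down) k where "int k = content w i - content w (i + 1)" "op_power (word_f i) k w = Some (sref i w)"
  | (up) k where "int k = content w (i + 1) - content w i" "0 < k" "op_power (word_f i) k (sref i w) = Some w"
proof (cases "0 \<le> content w i - content w (i + 1)")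
  case True
  have "int (nat (content w i - content w (i + 1))) \<le> word_phi i w"
    using True word_eps_nonneg[of i w] by (simp add: word_phi_def)
  from op_power_f_defined[OF this] True that(1)[of "nat (content w i - content w (i + 1))"] show thesis
    by (auto simp: sref_def)
next
  case False
  have "int (nat (content w (i + 1) - content w i)) \<le> word_eps i w"
    using False word_phi_nonneg[of i w] by (simp add: word_phi_def)
  from op_power_e_defined[OF this] obtain v
    where v: "op_power (word_f i) (nat (content w (i + 1) - content w i)) v = Some w" ..
  moreover from v have "sref i w = v"
    using False op_power_e_iff[of i "nat (content w (i + 1) - content w i)" w v] by (simp add: sref_def Let_def)
  ultimately show thesis using False that(2)[of "nat (content w (i + 1) - content w i)"] by auto
qed

lemma op_power_f_cnt: "op_power (word_f i) k w = Some w' \<Longrightarrow>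
   content w' = (content w)(i := content w i - int k, i + 1 := content w (i + 1) + int k)"
proof (induction k arbitrary: w')
  case (Suc k)
  then obtain v where v: "op_power (word_f i) k w = Some v" "word_f i v = Some w'"
    by (auto simp: op_power_Suc bind_eq_Some_conv)
  from Suc.IH[OF v(1)] word_f_step[OF v(2)] show ?case by (auto simp: fun_eq_iff)
qed (auto simp: op_power_0)

lemma op_power_f_inj: "op_power (word_f i) k v = Some w \<Longrightarrow> op_power (word_f i) k v' = Some w \<Longrightarrow> v = v'"
  using op_power_e_iff by (metis option.inject)

lemma sref_cnt: "content (sref i w) = (content w)(i := content w (i + 1), i + 1 := content w i)"
proof (cases rule: sref_cases[of w i])
  case (down k)
  from op_power_f_cnt[OF down(2)] down(1) show ?thesis by (auto simp: fun_eq_iff)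
next
  case (up k)
  note c = op_power_f_cnt[OF up(3)]
  show ?thesis
  proof
    fix j show "content (sref i w) j = ((content w)(i := content w (i + 1), i + 1 := content w i)) j"
    proof -
      have "content w i = content (sref i w) i - int k" "content w (i + 1) = content (sref i w) (i + 1) + int k"
        "j \<noteq> i \<Longrightarrow> j \<noteq> i + 1 \<Longrightarrow> content w j = content (sref i w) j"
        by (subst c, simp)+
      with up(1) have "content (sref i w) i = content w (i + 1)" "content (sref i w) (i + 1) = content w i"
        "j \<noteq> i \<Longrightarrow> j \<noteq> i + 1 \<Longrightarrow> content (sref i w) j = content w j"
        by linarith+
      then show ?thesis by auto
    qed
  qed
qed

lemma sref_sref: "sref i (sref i w) = w"
proof (cases rule: sref_cases[of w i])
  case (down k)
  show ?thesis
  proof (cases rule: sref_cases[of "sref i w" i])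
    case (down k')
    with \<open>int k = _\<close> have "k = 0 \<and> k' = 0" by (auto simp: sref_cnt)
    with down \<open>op_power (word_f i) k w = _\<close> show ?thesis by (auto simp: op_power_0)
  next
    case (up k')
    with down have "k' = k" by (simp add: sref_cnt)
    with up down op_power_f_inj show ?thesis by blast
  qed
next
  case (up k)
  show ?thesis
  proof (cases rule: sref_cases[of "sref i w" i])
    case (down k')
    with up have "k' = k" by (simp add: sref_cnt)
    with up down show ?thesis by auto
  next
    case (up k')
    with \<open>int k = _\<close> \<open>0 < k\<close> show ?thesis by (simp add: sref_cnt)
  qed
qed

lemma sref_fixed: "content w i = content w (i + 1) \<Longrightarrow> sref i w = w"
  by (cases rule: sref_cases[of w i]) (auto simp: op_power_0)

text \<open>Reversing a string turns the arrow from \<open>w\<close> to \<open>w'\<close> into an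
  arrow from the mirror image of \<open>w'\<close> to that of \<open>w\<close>. The cases place the
  arrow above, at, or below the middle of the string; away from the middle the two reflection
  distances differ by 2.\<close>

lemma word_f_sref_mirror: assumes "word_f i w = Some w'" shows "word_f i (sref i w') = Some (sref i w)"
proof -
  note c = word_f_step[OF assms]
  have c': "content w' i = content w i - 1" "content w' (i + 1) = content w (i + 1) + 1" using c by auto
  consider "content w i > content w (i + 1) + 1" | "content w i = content w (i + 1) + 1" | "content w i \<le> content w (i + 1)" by linarith
  then show ?thesis
  proof cases
    case 1
    obtain k where k: "int k = content w i - content w (i + 1)" "op_power (word_f i) k w = Some (sref i w)"
      using 1 by (cases rule: sref_cases[of w i]) auto
    obtain k' where k': "int k' = content w' i - content w' (i + 1)" "op_power (word_f i) k' w' = Some (sref i w')"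
      using 1 c' by (cases rule: sref_cases[of w' i]) auto
    have "k = Suc (Suc k')" using k(1) k'(1) c' by linarith
    then have "Option.bind (op_power (word_f i) k' w') (word_f i) = Some (sref i w)"
      using k(2) assms by (simp add: op_power_Suc2[of _ "Suc k'"] op_power_Suc[symmetric])
    then show ?thesis using k'(2) by simp
  next
    case 2
    obtain k where k: "int k = content w i - content w (i + 1)" "op_power (word_f i) k w = Some (sref i w)"
      using 2 by (cases rule: sref_cases[of w i]) auto
    have "k = Suc 0" using k(1) 2 by linarith
    then have "sref i w = w'" using k(2) assms by (simp add: op_power_Suc op_power_0)
    then show ?thesis using assms sref_sref[of i w] by simp
  next
    case 3
    obtain k where k: "int k = content w (i + 1) - content w i" "op_power (word_f i) k (sref i w) = Some w"
    proof (cases rule: sref_cases[of w i])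
      case (down k)
      with 3 have "k = 0" by linarith
      with down that[of 0] 3 show thesis by (auto simp: op_power_0)
    qed (use that in blast)
    obtain k' where k': "int k' = content w' (i + 1) - content w' i" "op_power (word_f i) k' (sref i w') = Some w'"
      using 3 c' by (cases rule: sref_cases[of w' i]) auto
    have kk: "k' = Suc (Suc k)" using k(1) k'(1) c' by linarith
    then obtain v where v: "word_f i (sref i w') = Some v" "op_power (word_f i) (Suc k) v = Some w'"
      using k'(2) by (auto simp: op_power_Suc2[of _ "Suc k"] bind_eq_Some_conv)
    have "op_power (word_f i) (Suc k) (sref i w) = Some w'"
      using k(2) assms by (simp add: op_power_Suc)
    with v op_power_f_inj show ?thesis by blast
  qed
qed

lemma word_f_sref_one: assumes "content w i = content w (i + 1) + 1" shows "word_f i w = Some (sref i w)"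
proof (cases rule: sref_cases[of w i])
  case (down k)
  then have "k = Suc 0" using assms by linarith
  then show ?thesis using down(2) by (simp add: op_power_Suc op_power_0)
qed (use assms in auto)

lemma word_f_defined: "content w (i + 1) < content w i \<Longrightarrow> \<exists>w'. word_f i w = Some w'"
  using word_f_None[of i w] word_eps_nonneg[of i w] by (fastforce simp: word_phi_def)

section \<open>Commutation of operators with distant indices\<close>

definition far :: "nat \<Rightarrow> nat \<Rightarrow> bool" where
  "far i j \<longleftrightarrow> i + 1 < j \<or> j + 1 < i"

lemma far_sym: "far i j \<Longrightarrow> far j i"
  by (auto simp: far_def)

lemma word_eps_far: "far i j \<Longrightarrow> word_f j w = Some w' \<Longrightarrow> word_eps i w' = word_eps i w"
proof (induction w arbitrary: w')
  case (Cons a w)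
  then show ?case
    by (auto simp: word_f_Cons far_def letter_eps_def letter_phi_def split: if_splits)
qed simp

lemma word_f_far: "far i j \<Longrightarrow> word_f j w = Some w' \<Longrightarrow> word_f i w = Some v
    \<Longrightarrow> \<exists>u. word_f i w' = Some u \<and> word_f j v = Some u"
proof (induction w arbitrary: w' v)
  case (Cons a w)
  consider "a = i \<and> word_eps i w = 0" | "a = j \<and> word_eps j w = 0"
    | "\<not> (a = i \<and> word_eps i w = 0)" "\<not> (a = j \<and> word_eps j w = 0)" by blast
  then show ?case
  proof cases
    case 1
    then show ?thesis using Cons.prems word_eps_far[OF Cons.prems(1), of w]
      by (auto simp: word_f_Cons far_def split: if_splits)
  next
    case 2
    then show ?thesis using Cons.prems word_eps_far[OF far_sym[OF Cons.prems(1)], of w]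
      by (auto simp: word_f_Cons far_def split: if_splits)
  next
    case 3
    then obtain x y where xy: "word_f j w = Some x" "word_f i w = Some y" "w' = a # x" "v = a # y"
      using Cons.prems by (auto simp: word_f_Cons)
    from Cons.IH[OF Cons.prems(1) xy(1,2)] obtain u where "word_f i x = Some u" "word_f j y = Some u" by blast
    then show ?thesis using 3 xy word_eps_far[OF Cons.prems(1) xy(1)]
        word_eps_far[OF far_sym[OF Cons.prems(1)] xy(2)]
      by (auto simp: word_f_Cons)
  qed
qed simp

lemma cnt_far: "far i j \<Longrightarrow> word_f j w = Some w' \<Longrightarrow> content w' i = content w i \<and> content w' (i + 1) = content w (i + 1)"
  using word_f_step[of j w w'] by (auto simp: far_def)

text \<open>This serves reflections that go up the string. The operator \<open>f_i\<close> changes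
  neither epsilon nor phi at the distant index \<open>j\<close>, so \<open>f_j\<close> is also
  defined at \<open>v\<close>, and the downward square closes.\<close>

lemma word_f_far_up: assumes "far i j" "word_f j w = Some w'" "word_f i v = Some w"
  shows "\<exists>u. word_f i u = Some w' \<and> word_f j v = Some u"
proof -
  note f = far_sym[OF assms(1)]
  have "word_phi j v = word_phi j w"
    using word_eps_far[OF f assms(3)] cnt_far[OF f assms(3)] by (simp add: word_phi_def)
  then obtain u where u: "word_f j v = Some u" using word_f_None[of j v] word_f_None[of j w] assms(2) by fastforce
  with word_f_far[OF assms(1) u assms(3)] assms(2) show ?thesis by auto
qed

lemma op_power_f_far: "far i j \<Longrightarrow> word_f j w = Some w' \<Longrightarrow> op_power (word_f i) k w = Some v
    \<Longrightarrow> \<exists>u. op_power (word_f i) k w' = Some u \<and> word_f j v = Some u"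
proof (induction k arbitrary: v)
  case (Suc k)
  then obtain x where x: "op_power (word_f i) k w = Some x" "word_f i x = Some v"
    by (auto simp: op_power_Suc bind_eq_Some_conv)
  from Suc.IH[OF Suc.prems(1,2) x(1)] obtain u where u: "op_power (word_f i) k w' = Some u" "word_f j x = Some u" by blast
  from word_f_far[OF Suc.prems(1) u(2) x(2)] u show ?case by (auto simp: op_power_Suc)
qed (auto simp: op_power_0)

lemma op_power_f_far_up: "far i j \<Longrightarrow> word_f j w = Some w' \<Longrightarrow> op_power (word_f i) k v = Some w
    \<Longrightarrow> \<exists>u. op_power (word_f i) k u = Some w' \<and> word_f j v = Some u"
proof (induction k arbitrary: w w')
  case (Suc k)
  then obtain x where x: "op_power (word_f i) k v = Some x" "word_f i x = Some w"
    by (auto simp: op_power_Suc bind_eq_Some_conv)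
  from word_f_far_up[OF Suc.prems(1,2) x(2)] obtain y where y: "word_f i y = Some w'" "word_f j x = Some y" by blast
  from Suc.IH[OF Suc.prems(1) y(2) x(1)] y show ?case by (auto simp: op_power_Suc)
qed (auto simp: op_power_0)

lemma word_f_sref_far: assumes "far i j" "word_f j w = Some w'"
  shows "word_f j (sref i w) = Some (sref i w')"
proof -
  note c = cnt_far[OF assms]
  show ?thesis
  proof (cases rule: sref_cases[of w i])
    case (down k)
    from op_power_f_far[OF assms down(2)] obtain u where
      u: "op_power (word_f i) k w' = Some u" "word_f j (sref i w) = Some u" by blast
    show ?thesis
    proof (cases rule: sref_cases[of w' i])
      case (down k')
      with \<open>int k = _\<close> c have "k' = k" by simp
      with down u show ?thesis by simp
    qed (use down c in auto)
  next
    case (up k)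
    from op_power_f_far_up[OF assms up(3)] obtain u where
      u: "op_power (word_f i) k u = Some w'" "word_f j (sref i w) = Some u" by blast
    show ?thesis
    proof (cases rule: sref_cases[of w' i])
      case (up k')
      with \<open>int k = _\<close> c have "k' = k" by simp
      with up u op_power_f_inj show ?thesis by auto
    qed (use up c in auto)
  qed
qed

lemma op_power_sref_far: "far i j \<Longrightarrow> op_power (word_f j) k w = Some w' \<Longrightarrow>
  op_power (word_f j) k (sref i w) = Some (sref i w')"
  by (induction k arbitrary: w')
    (auto simp: op_power_0 op_power_Suc bind_eq_Some_conv dest: word_f_sref_far)

lemma sref_far: assumes "far i j" shows "sref i (sref j w) = sref j (sref i w)"
proof -
  have c: "content (sref i w) j = content w j" "content (sref i w) (j + 1) = content w (j + 1)"
    using assms by (auto simp: sref_cnt far_def)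
  show ?thesis
  proof (cases rule: sref_cases[of w j])
    case (down k)
    from op_power_sref_far[OF assms down(2)] have *: "op_power (word_f j) k (sref i w) = Some (sref i (sref j w))" .
    show ?thesis
    proof (cases rule: sref_cases[of "sref i w" j])
      case (down k')
      with \<open>int k = _\<close> c have "k' = k" by simp
      with down * show ?thesis by simp
    qed (use down c in auto)
  next
    case (up k)
    from op_power_sref_far[OF assms up(3)] have *: "op_power (word_f j) k (sref i (sref j w)) = Some (sref i w)" .
    show ?thesis
    proof (cases rule: sref_cases[of "sref i w" j])
      case (up k')
      with \<open>int k = _\<close> c have "k' = k" by simp
      with up * op_power_f_inj show ?thesis by blast
    qed (use up c in auto)
  qed
qed

section \<open>Three consecutive letters\<close>

text \<open>
  Letters are inserted from the right end of the word. In \<open>(y1, y2, y3, a, b, c)\<close>, \<open>c\<close> is the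
  number of letters \<open>q + 2\<close>, \<open>(a, b)\<close> the shape of the subword on \<open>q + 1, q + 2\<close>, and \<open>(y1, y2, y3)\<close>
  the shape of the subword on \<open>q, q + 1, q + 2\<close>.
\<close>

type_synonym pattern3 = "int \<times> int \<times> int \<times> int \<times> int \<times> int"

text \<open>Column insertion for the order q + 2 < q + 1 < q. A displaced letter is pushed to later
  columns, so only the row that finally grows has to be decided.\<close>

fun insert3 :: "nat \<Rightarrow> nat \<Rightarrow> pattern3 \<Rightarrow> pattern3" where
  "insert3 q z (y1, y2, y3, a, b, c) =
    (if z = q + 2 then (y1 + 1, y2, y3, a + 1, b, c + 1)
     else if z = q + 1 then
       (if b < c then (if y2 < a then (y1, y2 + 1, y3, a, b + 1, c) else (y1 + 1, y2, y3, a, b + 1, c))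
        else (y1 + 1, y2, y3, a + 1, b, c))
     else if z = q then
       (if y3 < b then (y1, y2, y3 + 1, a, b, c)
        else if y2 < a then (y1, y2 + 1, y3, a, b, c) else (y1 + 1, y2, y3, a, b, c))
     else (y1, y2, y3, a, b, c))"

primrec pat3 :: "nat \<Rightarrow> nat list \<Rightarrow> pattern3" where
  "pat3 q [] = (0, 0, 0, 0, 0, 0)"
| "pat3 q (z # w) = insert3 q z (pat3 q w)"

text \<open>The interlacing inequalities of a Gelfand--Tsetlin pattern.\<close>

fun valid3 :: "pattern3 \<Rightarrow> bool" where
  "valid3 (y1, y2, y3, a, b, c) \<longleftrightarrow> y1 \<ge> a \<and> a \<ge> y2 \<and> y2 \<ge> b \<and> b \<ge> y3 \<and> a \<ge> c \<and> c \<ge> b"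

lemma valid3_pat3: "valid3 (pat3 q w)"
proof (induction w)
  case (Cons z w)
  then show ?case by (cases "pat3 q w") auto
qed simp

lemma pat3_cnt: "pat3 q w = (y1, y2, y3, a, b, c) \<Longrightarrow>
  content w (q + 2) = c \<and> content w (q + 1) = a + b - c \<and> content w q = y1 + y2 + y3 - a - b"
proof (induction w arbitrary: y1 y2 y3 a b c)
  case (Cons z w)
  obtain y1' y2' y3' a' b' c' where t: "pat3 q w = (y1', y2', y3', a', b', c')" by (cases "pat3 q w")
  from Cons.IH[OF t] Cons.prems show ?case by (auto simp: t split: if_splits)
qed simp

lemma pat3_f1: "pat3 q w = (y1, y2, y3, a, b, c) \<Longrightarrow>
  word_eps (q + 1) w = c - b \<and>
  (\<forall>w'. word_f (q + 1) w = Some w' \<longrightarrow> pat3 q w' = (y1, y2, y3, a, b, c + 1))"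
proof (induction w arbitrary: y1 y2 y3 a b c)
  case (Cons z w)
  obtain y1' y2' y3' a' b' c' where t: "pat3 q w = (y1', y2', y3', a', b', c')" by (cases "pat3 q w")
  note IH = Cons.IH[OF t]
  have v: "valid3 (pat3 q w)" by (rule valid3_pat3)
  have e: "word_eps (q + 1) w = c' - b'" using IH by blast
  have f: "word_f (q + 1) w = Some u \<Longrightarrow> pat3 q u = (y1', y2', y3', a', b', c' + 1)" for u using IH by blast
  have ph: "c' < a'" if "word_f (q + 1) w = Some u" for u
  proof -
    have "word_phi (q + 1) w \<noteq> 0" using that word_f_None[of "q + 1" w] by auto
    then show ?thesis using word_phi_nonneg[of "q + 1" w] pat3_cnt[OF t] e by (simp add: word_phi_def)
  qed
  consider "z = q" | "z = q + 1" | "z = q + 2" | "z \<noteq> q \<and> z \<noteq> q + 1 \<and> z \<noteq> q + 2" by blast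
  then show ?case
    by cases (use Cons.prems v e f ph in \<open>fastforce simp: t word_f_Cons letter_eps_def letter_phi_def split: if_splits\<close>)+
qed simp

text \<open>In the tableau, \<open>a + b - y2 - c\<close> is the number of letters q + 1 in the
  first row minus the number of letters q in the second. By the bracketing rule its sign decides in
  which of the two rows \<open>f_q\<close> acts.\<close>

lemma pat3_f0: "pat3 q w = (y1, y2, y3, a, b, c) \<Longrightarrow>
  word_eps q w = b - y3 + max 0 (a + b - y2 - c) \<and>
  (\<forall>w'. word_f q w = Some w' \<longrightarrow> pat3 q w' =
     (if a + b - y2 - c \<ge> 0 then (y1, y2, y3, a + 1, b, c) else (y1, y2, y3, a, b + 1, c)))"
proof (induction w arbitrary: y1 y2 y3 a b c)
  case (Cons z w)
  obtain y1' y2' y3' a' b' c' where t: "pat3 q w = (y1', y2', y3', a', b', c')" by (cases "pat3 q w")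
  note IH = Cons.IH[OF t]
  have v: "valid3 (pat3 q w)" by (rule valid3_pat3)
  have e: "word_eps q w = b' - y3' + max 0 (a' + b' - y2' - c')" using IH by blast
  have f: "word_f q w = Some u \<Longrightarrow> pat3 q u = (if a' + b' - y2' - c' \<ge> 0 then (y1', y2', y3', a' + 1, b', c') else (y1', y2', y3', a', b' + 1, c'))" for u using IH by blast
  have ph: "0 < word_eps q w + y1' + y2' + y3' - 2 * a' - 2 * b' + c'" if "word_f q w = Some u" for u
  proof -
    have "word_phi q w \<noteq> 0" using that word_f_None[of q w] by auto
    then show ?thesis using word_phi_nonneg[of q w] pat3_cnt[OF t] by (simp add: word_phi_def)
  qed
  have eps: "word_eps q (z # w) = b - y3 + max 0 (a + b - y2 - c)"
    using Cons.prems v e by (auto simp: t letter_eps_def letter_phi_def split: if_splits)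
  moreover have "pat3 q w' = (if a + b - y2 - c \<ge> 0 then (y1, y2, y3, a + 1, b, c) else (y1, y2, y3, a, b + 1, c))"
    if w': "word_f q (z # w) = Some w'" for w'
  proof (cases "z = q \<and> word_eps q w = 0")
    case True
    with w' Cons.prems v e show ?thesis by (auto simp: t word_f_Cons split: if_splits)
  next
    case False
    then obtain u where u: "word_f q w = Some u" "w' = z # u" using w' by (auto simp: word_f_Cons split: if_splits)
    note fu = f[OF u(1)] and phu = ph[OF u(1)]
    consider "z = q" "word_eps q w > 0" | "z = q + 1" | "z = q + 2" | "z \<noteq> q \<and> z \<noteq> q + 1 \<and> z \<noteq> q + 2"
      using False word_eps_nonneg[of q w] by force
    then show ?thesis
    by cases (use Cons.prems v e fu phu u in \<open>auto simp: t split: if_splits\<close>)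
  qed
  ultimately show ?case by blast
qed simp

section \<open>The piecewise linear action on patterns\<close>

fun raise1 :: "pattern3 \<Rightarrow> pattern3" where
  "raise1 (y1, y2, y3, a, b, c) = (y1, y2, y3, a, b, c + 1)"

text \<open>Whichever of \<open>a\<close> and \<open>b\<close> moves, \<open>d\<close> grows by one,
  so \<open>d\<close> is a coordinate along the string: \<open>a\<close> absorbs its positive values
  and \<open>b\<close> its negative ones. Allowing all integers \<open>k\<close> makes the shifts
  additive and covers the upward direction too.\<close>

fun shift0 :: "int \<Rightarrow> pattern3 \<Rightarrow> pattern3" where
  "shift0 k (y1, y2, y3, a, b, c) = (let d = a + b - y2 - c in
     (y1, y2, y3, a + max (d + k) 0 - max d 0, b + min (d + k) 0 - min d 0, c))"

text \<open>The difference of the contents of q and q + 1 is \<open>d' - d\<close>, so reversing the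
  string moves the coordinate \<open>d\<close> to \<open>d'\<close>.\<close>

fun reflect0 :: "pattern3 \<Rightarrow> pattern3" where
  "reflect0 (y1, y2, y3, a, b, c) = (let d = a + b - y2 - c; d' = y1 + y3 - a - b in
     (y1, y2, y3, a + max d' 0 - max d 0, b + min d' 0 - min d 0, c))"

fun reflect1 :: "pattern3 \<Rightarrow> pattern3" where
  "reflect1 (y1, y2, y3, a, b, c) = (y1, y2, y3, a, b, a + b - c)"

lemma shift0_add: "shift0 k (shift0 l T) = shift0 (l + k) T"
  by (cases T) (auto simp: Let_def algebra_simps max_def min_def)

lemma shift0_0: "shift0 0 T = T"
  by (cases T) (auto simp: Let_def)

lemma pat3_f0_shift: "word_f q w = Some w' \<Longrightarrow> pat3 q w' = shift0 1 (pat3 q w)"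
  by (cases "pat3 q w") (auto simp: pat3_f0 Let_def max_def min_def)

lemma pat3_f1_raise: "word_f (q + 1) w = Some w' \<Longrightarrow> pat3 q w' = raise1 (pat3 q w)"
  using pat3_f1[of q w] by (cases "pat3 q w") auto

lemma pat3_op_power0: "op_power (word_f q) k w = Some w' \<Longrightarrow> pat3 q w' = shift0 (int k) (pat3 q w)"
proof (induction k arbitrary: w')
  case (Suc k)
  then obtain v where v: "op_power (word_f q) k w = Some v" "word_f q v = Some w'"
    by (auto simp: op_power_Suc bind_eq_Some_conv)
  show ?case using Suc.IH[OF v(1)] pat3_f0_shift[OF v(2)] by (simp add: shift0_add add.commute)
qed (auto simp: op_power_0 shift0_0)

lemma pat3_op_power1: "op_power (word_f (q + 1)) k w = Some w' \<Longrightarrow> pat3 q w = (y1, y2, y3, a, b, c) \<Longrightarrow>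
   pat3 q w' = (y1, y2, y3, a, b, c + int k)"
proof (induction k arbitrary: w')
  case (Suc k)
  then obtain v where v: "op_power (word_f (q + 1)) k w = Some v" "word_f (q + 1) v = Some w'"
    by (auto simp: op_power_Suc bind_eq_Some_conv)
  show ?case using Suc.IH[OF v(1) Suc.prems(2)] pat3_f1_raise[OF v(2)] by simp
qed (auto simp: op_power_0)

lemma pat3_sref0: "pat3 q (sref q w) = reflect0 (pat3 q w)"
proof -
  obtain y1 y2 y3 a b c where t: "pat3 q w = (y1, y2, y3, a, b, c)" by (cases "pat3 q w")
  have k: "content w q - content w (q + 1) = (y1 + y3 - a - b) - (a + b - y2 - c)"
    using pat3_cnt[OF t] by simp
  have "pat3 q (sref q w) = shift0 (content w q - content w (q + 1)) (pat3 q w)"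
  proof (cases rule: sref_cases[of w q])
    case (down k)
    with pat3_op_power0[OF down(2)] show ?thesis by simp
  next
    case (up k)
    have "shift0 (- int k) (pat3 q w) = shift0 (- int k) (shift0 (int k) (pat3 q (sref q w)))"
      using pat3_op_power0[OF up(3)] by simp
    then show ?thesis using up(1) by (simp add: shift0_add shift0_0)
  qed
  then show ?thesis unfolding k t by (simp add: Let_def algebra_simps)
qed

lemma pat3_sref1: "pat3 q (sref (q + 1) w) = reflect1 (pat3 q w)"
proof -
  obtain y1 y2 y3 a b c where t: "pat3 q w = (y1, y2, y3, a, b, c)" by (cases "pat3 q w")
  obtain y1' y2' y3' a' b' c' where t': "pat3 q (sref (q + 1) w) = (y1', y2', y3', a', b', c')"
    by (cases "pat3 q (sref (q + 1) w)")
  have k: "content w (q + 1) - content w (q + 1 + 1) = a + b - 2 * c"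
    using pat3_cnt[OF t] by simp
  show ?thesis
  proof (cases rule: sref_cases[of w "q + 1"])
    case (down m)
    with pat3_op_power1[OF down(2) t] k t show ?thesis by simp
  next
    case (up m)
    with pat3_op_power1[OF up(3) t'] k t t' show ?thesis by simp
  qed
qed

section \<open>Recovering a word from its pattern and history\<close>

fun shape3 :: "pattern3 \<Rightarrow> int \<times> int \<times> int" where
  "shape3 (y1, y2, y3, a, b, c) = (y1, y2, y3)"

text \<open>The recording tableau; letters outside \<open>{q..q + 2}\<close> are recorded literally.\<close>

primrec history3 :: "nat \<Rightarrow> nat list \<Rightarrow> (nat option \<times> int \<times> int \<times> int) list" where
  "history3 q [] = []"
| "history3 q (z # w) = (if z \<in> {q..q + 2} then None else Some z, shape3 (pat3 q (z # w))) # history3 q w"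

lemma shape3_shift0: "shape3 (shift0 k T) = shape3 T"
  by (cases T) (simp add: Let_def)

lemma shape3_raise1: "shape3 (raise1 T) = shape3 T"
  by (cases T) simp

lemma history3_f: "p \<in> {q, q + 1} \<Longrightarrow> word_f p w = Some w' \<Longrightarrow> history3 q w' = history3 q w"
proof (induction w arbitrary: w')
  case (Cons z w)
  have "shape3 (pat3 q w') = shape3 (pat3 q (z # w))"
    using Cons.prems by (auto simp only: insert_iff empty_iff pat3_f0_shift pat3_f1_raise shape3_shift0 shape3_raise1)
  moreover obtain x u where "w' = x # u" "history3 q u = history3 q w" "x \<in> {q..q + 2} \<and> z \<in> {q..q + 2} \<or> x = z"
    using Cons.prems Cons.IH by (auto simp del: pat3.simps simp: word_f_Cons split: if_splits)
  ultimately show ?case by auto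
qed simp

lemma history3_sref: assumes "p \<in> {q, q + 1}" shows "history3 q (sref p w) = history3 q w"
proof -
  have pow: "history3 q v' = history3 q v" if "op_power (word_f p) k v = Some v'" for k v v'
    using that
  proof (induction k arbitrary: v')
    case (Suc k)
    then show ?case using history3_f[OF assms] by (auto simp: op_power_Suc bind_eq_Some_conv)
  qed (auto simp: op_power_0)
  show ?thesis by (cases rule: sref_cases[of w p]) (metis pow)+
qed

text \<open>Reverse insertion: with the old shape known, the new pattern shows which row grew at
  each level, and this determines the letter. A letter outside the block is determined by its
  literal record.\<close>

lemma insert3_inj: assumes "valid3 S" "valid3 T" "shape3 S = shape3 T" "insert3 q z S = insert3 q z' T"
    "(if z \<in> {q..q + 2} then None else Some z) = (if z' \<in> {q..q + 2} then None else Some z')"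
  shows "z = z' \<and> S = T"
proof -
  obtain y1 y2 y3 a b c where S: "S = (y1, y2, y3, a, b, c)" by (cases S)
  obtain a' b' c' where T: "T = (y1, y2, y3, a', b', c')" using assms(3) S by (cases T) auto
  have r: "x \<in> {q..q + 2} \<longleftrightarrow> x = q \<or> x = q + 1 \<or> x = q + 2" for x by auto
  show ?thesis
  proof (cases "z \<in> {q..q + 2}")
    case True
    then have "z' \<in> {q..q + 2}" using assms(5) by (auto split: if_splits)
    with True have "z = q \<or> z = q + 1 \<or> z = q + 2" "z' = q \<or> z' = q + 1 \<or> z' = q + 2" by auto
    then show ?thesis using assms(1,2,4) unfolding S T by (elim disjE) (auto split: if_splits)
  next
    case False
    then have "z = z'" "z \<noteq> q" "z \<noteq> q + 1" "z \<noteq> q + 2" using assms(5) by (auto split: if_splits)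
    then show ?thesis using assms(4) unfolding S T by auto
  qed
qed

text \<open>The injectivity half of the Robinson--Schensted correspondence. Two words reached from
  one word by operators of the block share their history, so they agree as soon as six integers
  do.\<close>

lemma pat3_history3_inj: "pat3 q w = pat3 q w' \<Longrightarrow> history3 q w = history3 q w' \<Longrightarrow> w = w'"
proof (induction w arbitrary: w')
  case Nil
  then show ?case by (cases w') auto
next
  case (Cons z w)
  obtain z' v where w': "w' = z' # v" using Cons.prems(2) by (cases w') auto
  have h: "history3 q w = history3 q v" using Cons.prems(2) by (simp add: w')
  have "shape3 (pat3 q w) = shape3 (pat3 q v)"
    using h by (cases w; cases v) (auto simp del: pat3.simps(2))
  with Cons.prems have "z = z' \<and> pat3 q w = pat3 q v"
    by (intro insert3_inj[of _ _ q] valid3_pat3) (auto simp: w')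
  with Cons.IH[OF _ h] show ?case by (simp add: w')
qed

text \<open>Both sides have the history of \<open>w\<close>, and on patterns the relation is an
  identity between compositions of \<open>reflect0\<close> and \<open>reflect1\<close>, settled by
  the signs of the linear forms involved.\<close>

lemma sref_braid: "sref q (sref (q + 1) (sref q w)) = sref (q + 1) (sref q (sref (q + 1) w))"
proof (rule pat3_history3_inj)
  show "pat3 q (sref q (sref (q + 1) (sref q w))) = pat3 q (sref (q + 1) (sref q (sref (q + 1) w)))"
    unfolding pat3_sref0 pat3_sref1
    by (cases "pat3 q w") (auto simp: Let_def max_def min_def)
qed (simp add: history3_sref)

text \<open>
  The effect on patterns of \<open>f\<^sub>q\<^sub>+\<^sub>1\<close> conjugated by \<open>s\<^sub>q\<^sub>+\<^sub>1 s\<^sub>q\<close>. That it does not involve \<open>c\<close> is what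
  makes the two triangles below commute.
\<close>

fun raise01 :: "pattern3 \<Rightarrow> pattern3" where
  "raise01 (y1, y2, y3, a, b, c) =
     (if a + b < y1 + y3 then (y1, y2, y3, a + 1, b, c) else (y1, y2, y3, a, b + 1, c))"

lemma reflect0_reflect0: "reflect0 (reflect0 T) = T"
  by (cases T) (auto simp: Let_def max_def min_def)

lemma reflect1_reflect1: "reflect1 (reflect1 T) = T"
  by (cases T) simp

lemma pat3_edge02: assumes "word_f (q + 1) (sref q w) = Some (sref q w')"
  shows "pat3 q w' = raise01 (raise1 (pat3 q w))"
proof -
  have "reflect0 (pat3 q w') = raise1 (reflect0 (pat3 q w))"
    using pat3_f1_raise[OF assms] by (simp add: pat3_sref0)
  then have "pat3 q w' = reflect0 (raise1 (reflect0 (pat3 q w)))" by (metis reflect0_reflect0)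
  also have "\<dots> = raise01 (raise1 (pat3 q w))"
    by (cases "pat3 q w") (auto simp: Let_def max_def min_def)
  finally show ?thesis .
qed

lemma pat3_edge01: assumes "word_f (q + 1) (sref q (sref (q + 1) w)) = Some (sref q (sref (q + 1) w'))"
  shows "pat3 q w' = raise01 (pat3 q w)"
proof -
  have "reflect0 (reflect1 (pat3 q w')) = raise1 (reflect0 (reflect1 (pat3 q w)))"
    using pat3_f1_raise[OF assms] pat3_sref0 pat3_sref1 by simp
  then have "pat3 q w' = reflect1 (reflect0 (raise1 (reflect0 (reflect1 (pat3 q w)))))"
    by (metis reflect0_reflect0 reflect1_reflect1)
  also have "\<dots> = raise01 (pat3 q w)"
    by (cases "pat3 q w") (auto simp: Let_def max_def min_def)
  finally show ?thesis .
qed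

lemma history3_edge02: assumes "word_f (q + 1) (sref q w) = Some (sref q w')"
  shows "history3 q w' = history3 q w"
  using history3_f[OF _ assms, of q] by (simp add: history3_sref)

lemma history3_edge01: assumes "word_f (q + 1) (sref q (sref (q + 1) w)) = Some (sref q (sref (q + 1) w'))"
  shows "history3 q w' = history3 q w"
  using history3_f[OF _ assms, of q] history3_sref[of _ q] by simp

text \<open>On patterns the edge from q to q + 2 is \<open>raise01\<close> after
  \<open>raise1\<close>, and these two commute. So applying \<open>f_(q+1)\<close> to
  \<open>y\<close> and passing from \<open>x\<close> to \<open>z\<close> lead to one pattern with
  one history.\<close>

lemma triangle_a:
  assumes e: "word_f (q + 1) (sref q (sref (q + 1) x)) = Some (sref q (sref (q + 1) y))"
    "word_f (q + 1) (sref q x) = Some (sref q z)" and c: "content y (q + 2) < content y (q + 1)"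
  shows "word_f (q + 1) y = Some z"
proof -
  obtain u where u: "word_f (q + 1) y = Some u" using word_f_defined[of y "q + 1"] c by auto
  have "u = z"
  proof (rule pat3_history3_inj)
    show "pat3 q u = pat3 q z"
      using pat3_edge01[OF e(1)] pat3_edge02[OF e(2)] pat3_f1_raise[OF u]
      by (cases "pat3 q x") auto
    show "history3 q u = history3 q z"
      using history3_edge01[OF e(1)] history3_edge02[OF e(2)] history3_f[OF _ u] by simp
  qed
  with u show ?thesis by simp
qed

lemma triangle_b:
  assumes e: "word_f (q + 1) x = Some y" 
    "word_f (q + 1) (sref q (sref (q + 1) y)) = Some (sref q (sref (q + 1) u))"
    "word_f (q + 1) (sref q x) = Some (sref q z)"
  shows "u = z"
proof (rule pat3_history3_inj)
  show "pat3 q u = pat3 q z"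
    using pat3_edge01[OF e(2)] pat3_edge02[OF e(3)] pat3_f1_raise[OF e(1)]
    by (cases "pat3 q x") auto
  show "history3 q u = history3 q z"
    using history3_edge01[OF e(2)] history3_edge02[OF e(3)] history3_f[OF _ e(1)] by simp
qed

text \<open>The word \<open>u\<close> exists once epsilon at \<open>sref q x\<close> is positive. If
  \<open>a + b - y2 - c\<close> is nonnegative, the first hypothesis, \<open>c > b\<close>,
  suffices. Otherwise that epsilon equals \<open>(a - y2) - min (y1 + y3 - a - b) 0\<close>, where
  neither part is negative, and the second hypothesis forces one of them to be positive.\<close>

lemma chain_up:
  assumes "word_f (q + 1) y = Some x"
    "word_f (q + 1) (sref q (sref (q + 1) z)) = Some (sref q (sref (q + 1) x))"
  shows "\<exists>u. word_f (q + 1) (sref q u) = Some (sref q x)"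
proof -
  have *: "0 < word_eps (q + 1) v" if "word_f (q + 1) u = Some v" for u v
    using word_f_step[OF that] word_eps_nonneg[of "q + 1" u] by simp
  have eps: "word_eps (q + 1) v = c - b" if "pat3 q v = (y1, y2, y3, a, b, c)" for v y1 y2 y3 a b c
    using pat3_f1[OF that] by blast
  obtain y1 y2 y3 a b c where t: "pat3 q x = (y1, y2, y3, a, b, c)" by (cases "pat3 q x")
  obtain a' b' c' where t': "pat3 q (sref q x) = (y1, y2, y3, a', b', c')"
     "c' = c" "b' = b + min (y1 + y3 - a - b) 0 - min (a + b - y2 - c) 0"
    by (simp add: pat3_sref0 t Let_def)
  have t'': "pat3 q (sref q (sref (q + 1) x)) = (y1, y2, y3, a + max (y1 + y3 - a - b) 0 - max (c - y2) 0,
      b + min (y1 + y3 - a - b) 0 - min (c - y2) 0, a + b - c)"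
    using pat3_sref1[of q x] by (simp add: pat3_sref0 t Let_def)
  have v: "valid3 (pat3 q x)" by (rule valid3_pat3)
  have "0 < word_eps (q + 1) (sref q x)"
    using *[OF assms(1)] *[OF assms(2)] v
    unfolding eps[OF t] eps[OF t'(1)] eps[OF t''] t t'(2,3) by (auto simp: max_def min_def split: if_splits)
  then obtain u where "word_e (q + 1) (sref q x) = Some u" using word_e_None[of "q + 1" "sref q x"] by fastforce
  then have "word_f (q + 1) (sref q (sref q u)) = Some (sref q x)" by (simp add: sref_sref word_e_iff)
  then show ?thesis ..
qed

section \<open>Four consecutive letters\<close>

text \<open>A fourth row below the pattern of the letters \<open>q + 1, q + 2, q + 3\<close>.\<close>

type_synonym row4 = "int \<times> int \<times> int \<times> int"

text \<open>The same column insertion continued by one row: which of \<open>y1, y2, y3\<close> grows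
  is read off from the pattern, and the push caused by this growth is followed into the outer
  shape.\<close>

fun insert4 :: "nat \<Rightarrow> nat \<Rightarrow> pattern3 \<Rightarrow> row4 \<Rightarrow> row4" where
  "insert4 q z (y1, y2, y3, a, b, c) (x1, x2, x3, x4) =
    (if z = q + 3 then (x1 + 1, x2, x3, x4)
     else if z = q + 2 then
       (if b < c \<and> y2 < a \<and> x2 < y1 then (x1, x2 + 1, x3, x4) else (x1 + 1, x2, x3, x4))
     else if z = q + 1 then
       (if y3 < b \<and> x3 < y2 then (x1, x2, x3 + 1, x4)
        else if (y3 < b \<or> y2 < a) \<and> x2 < y1 then (x1, x2 + 1, x3, x4) else (x1 + 1, x2, x3, x4))
     else if z = q then
       (if x4 < y3 then (x1, x2, x3, x4 + 1)
        else if x3 < y2 then (x1, x2, x3 + 1, x4)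
        else if x2 < y1 then (x1, x2 + 1, x3, x4) else (x1 + 1, x2, x3, x4))
     else (x1, x2, x3, x4))"

primrec row4 :: "nat \<Rightarrow> nat list \<Rightarrow> row4" where
  "row4 q [] = (0, 0, 0, 0)"
| "row4 q (z # w) = insert4 q z (pat3 (Suc q) w) (row4 q w)"

fun valid4 :: "pattern3 \<Rightarrow> row4 \<Rightarrow> bool" where
  "valid4 (y1, y2, y3, a, b, c) (x1, x2, x3, x4) \<longleftrightarrow>
     x1 \<ge> y1 \<and> y1 \<ge> x2 \<and> x2 \<ge> y2 \<and> y2 \<ge> x3 \<and> x3 \<ge> y3 \<and> y3 \<ge> x4"

lemma valid4_row4: "valid4 (pat3 (Suc q) w) (row4 q w)"
proof (induction w)
  case (Cons z w)
  obtain y1 y2 y3 a b c where t: "pat3 (Suc q) w = (y1, y2, y3, a, b, c)" by (cases "pat3 (Suc q) w")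
  obtain x1 x2 x3 x4 where r: "row4 q w = (x1, x2, x3, x4)" by (cases "row4 q w")
  have "valid3 (pat3 (Suc q) w)" by (rule valid3_pat3)
  with Cons show ?case using t r by (auto simp: numeral_eq_Suc)
qed simp

lemma row4_cnt: "row4 q w = (x1, x2, x3, x4) \<Longrightarrow> pat3 (Suc q) w = (y1, y2, y3, a, b, c) \<Longrightarrow>
  content w q = x1 + x2 + x3 + x4 - y1 - y2 - y3"
proof (induction w arbitrary: x1 x2 x3 x4 y1 y2 y3 a b c)
  case (Cons z w)
  obtain y1' y2' y3' a' b' c' where t: "pat3 (Suc q) w = (y1', y2', y3', a', b', c')" by (cases "pat3 (Suc q) w")
  obtain x1' x2' x3' x4' where r: "row4 q w = (x1', x2', x3', x4')" by (cases "row4 q w")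
  note IH = Cons.IH[OF r t]
  consider "z = q" | "z = q + 1" | "z = q + 2" | "z = q + 3" | "z \<notin> {q, q + 1, q + 2, q + 3}" by blast
  then show ?case
    by cases (use Cons.prems t r IH in \<open>auto simp: numeral_eq_Suc split: if_splits\<close>)
qed simp

text \<open>\<open>depth1\<close>, \<open>depth2\<close>, \<open>depth3\<close> are the partial sums
  of the bracketing rule on the rows of the tableau: letters q in rows 1 to k minus letters q + 1 in
  rows 1 to k - 1. Row k has \<open>x_k - y_k\<close> letters q; rows 1 and 2 have
  \<open>y1 - a\<close> and \<open>y2 - b\<close> letters q + 1.\<close>

fun depth1 :: "pattern3 \<Rightarrow> row4 \<Rightarrow> int" where
  "depth1 (y1, y2, y3, a, b, c) (x1, x2, x3, x4) = x1 - y1"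

fun depth2 :: "pattern3 \<Rightarrow> row4 \<Rightarrow> int" where
  "depth2 (y1, y2, y3, a, b, c) (x1, x2, x3, x4) = x1 + x2 - 2 * y1 - y2 + a"

fun depth3 :: "pattern3 \<Rightarrow> row4 \<Rightarrow> int" where
  "depth3 (y1, y2, y3, a, b, c) (x1, x2, x3, x4) = x1 + x2 + x3 - 2 * y1 - 2 * y2 - y3 + a + b"

definition depth :: "pattern3 \<Rightarrow> row4 \<Rightarrow> int" where
  "depth T X = max (max (depth1 T X) (depth2 T X)) (depth3 T X)"

text \<open>The operator \<open>f_q\<close> acts in the first row whose partial sum attains the
  maximum.\<close>

fun grow :: "row4 \<Rightarrow> pattern3 \<Rightarrow> pattern3" where
  "grow X (y1, y2, y3, a, b, c) = (let T = (y1, y2, y3, a, b, c) in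
    if depth1 T X \<ge> depth2 T X \<and> depth1 T X \<ge> depth3 T X then (y1 + 1, y2, y3, a, b, c)
    else if depth2 T X \<ge> depth3 T X then (y1, y2 + 1, y3, a, b, c)
    else (y1, y2, y3 + 1, a, b, c))"

lemma word_phi_depth: "word_phi q w = depth (pat3 (Suc q) w) (row4 q w)"
proof (induction w)
  case (Cons z w)
  obtain y1 y2 y3 a b c where t: "pat3 (Suc q) w = (y1, y2, y3, a, b, c)" by (cases "pat3 (Suc q) w")
  obtain x1 x2 x3 x4 where r: "row4 q w = (x1, x2, x3, x4)" by (cases "row4 q w")
  note v = valid3_pat3[of "Suc q" w] valid4_row4[of q w]
  have n: "content w q = x1 + x2 + x3 + x4 - y1 - y2 - y3" "content w (Suc q) = y1 + y2 + y3 - a - b"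
    using row4_cnt[OF r t] pat3_cnt[OF t] by (simp_all add: numeral_eq_Suc)
  have e: "word_eps q w = depth (pat3 (Suc q) w) (row4 q w) - content w q + content w (Suc q)"
    using Cons by (simp add: word_phi_def)
  consider "z = q" | "z = q + 1" | "z = q + 2" | "z = q + 3" | "z \<notin> {q, q + 1, q + 2, q + 3}" by blast
  then show ?case
    by cases (use v e n in \<open>auto simp: t r numeral_eq_Suc depth_def word_phi_def letter_eps_def letter_phi_def max_def split: if_splits\<close>)
qed (simp add: word_phi_def depth_def)

lemma row4_f0: "word_f q w = Some w' \<Longrightarrow>
  pat3 (Suc q) w' = grow (row4 q w) (pat3 (Suc q) w) \<and> row4 q w' = row4 q w"
proof (induction w arbitrary: w')
  case (Cons z w)
  obtain y1 y2 y3 a b c where t: "pat3 (Suc q) w = (y1, y2, y3, a, b, c)" by (cases "pat3 (Suc q) w")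
  obtain x1 x2 x3 x4 where r: "row4 q w = (x1, x2, x3, x4)" by (cases "row4 q w")
  note v = valid3_pat3[of "Suc q" w, unfolded t] valid4_row4[of q w, unfolded t r]
  have n: "content w q = x1 + x2 + x3 + x4 - y1 - y2 - y3" "content w (Suc q) = y1 + y2 + y3 - a - b"
    using row4_cnt[OF r t] pat3_cnt[OF t] by (simp_all add: numeral_eq_Suc)
  have e: "word_eps q w = depth (y1, y2, y3, a, b, c) (x1, x2, x3, x4) - content w q + content w (Suc q)"
    using word_phi_depth[of q w] by (simp add: t r word_phi_def)
  show ?case
  proof (cases "z = q \<and> word_eps q w = 0")
    case True
    with Cons.prems have w': "w' = (Suc q) # w" by (simp add: word_f_Cons)
    from True v e n show ?thesis by (auto simp: w' t r numeral_eq_Suc depth_def Let_def max_def split: if_splits)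
  next
    case False
    then obtain u where u: "word_f q w = Some u" "w' = z # u" using Cons.prems by (auto simp: word_f_Cons split: if_splits)
    have p: "depth (y1, y2, y3, a, b, c) (x1, x2, x3, x4) > 0"
      using word_f_None[of q w] word_phi_nonneg[of q w] u(1) word_phi_depth[of q w] by (simp add: t r)
    note IH = Cons.IH[OF u(1), unfolded t r]
    consider "z = q" "word_eps q w > 0" | "z = q + 1" | "z = q + 2" | "z = q + 3" | "z \<notin> {q, q + 1, q + 2, q + 3}"
      using False word_eps_nonneg[of q w] by force
    then show ?thesis
    proof cases
      case 1
      with IH v e n p show ?thesis by (auto simp: u(2) t r numeral_eq_Suc depth_def Let_def max_def split: if_splits)
    next
      case 2
      with IH v p show ?thesis by (auto simp: u(2) t r numeral_eq_Suc depth_def Let_def max_def split: if_splits)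
    next
      case 3
      with IH v p show ?thesis by (auto simp: u(2) t r numeral_eq_Suc depth_def Let_def max_def split: if_splits)
    next
      case 4
      with IH v p show ?thesis by (auto simp: u(2) t r numeral_eq_Suc depth_def Let_def max_def split: if_splits)
    next
      case 5
      with IH v p show ?thesis by (auto simp: u(2) t r numeral_eq_Suc depth_def Let_def max_def split: if_splits)
    qed
  qed
qed simp

text \<open>The effect of applying \<open>e\<^sub>q\<close> \<open>r\<close> times; \<open>d3\<close> and \<open>d2 - d3\<close> count the decrements of \<open>y3\<close> and \<open>y2\<close>.\<close>

fun sink :: "int \<Rightarrow> row4 \<Rightarrow> pattern3 \<Rightarrow> pattern3" where
  "sink r X (y1, y2, y3, a, b, c) = (let T = (y1, y2, y3, a, b, c); S2 = depth2 T X; S3 = depth3 T X;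
     m = depth T X; d3 = max 0 (S3 - m + r); d2 = max 0 (max S2 S3 - m + r) in
     (y1 - (r - d2), y2 - (d2 - d3), y3 - d3, a, b, c))"

text \<open>The primed values are the partial sums after \<open>r\<close> upward steps. Each step
  raises the maximum by one. A step above row 3 narrows the gap between the maximum and
  \<open>S3\<close> by one, and once that gap is closed all further steps act in row 3; the gap to
  \<open>max S2 S3\<close> governs rows 2 and 3 together. This is the origin of the truncated
  differences \<open>d3\<close> and \<open>d2\<close>, and the reason why they add up.\<close>

lemma sink_arith:
  fixes S1 S2 S3 r :: int
  assumes r: "0 \<le> r" and m: "m = max (max S1 S2) S3"
    and d: "d3 = max 0 (S3 - m + r)" "d2 = max 0 (max S2 S3 - m + r)"
    and S': "S3' = S3 + 2 * r - d3" "S2' = S2 + 2 * r - d2 - d3" "S1' = S1 + r - d2"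
  shows "max (max S1' S2') S3' = m + r" "max 0 (S3' - (m + r) + 1) = max 0 (S3 - m + (r + 1)) - d3"
    "max 0 (max S2' S3' - (m + r) + 1) = max 0 (max S2 S3 - m + (r + 1)) - d2"
  using assms by (smt (verit))+

lemma sink_add: assumes "0 \<le> r" shows "sink 1 X (sink r X T) = sink (r + 1) X T"
proof -
  obtain y1 y2 y3 a b c where T: "T = (y1, y2, y3, a, b, c)" by (cases T)
  obtain x1 x2 x3 x4 where X: "X = (x1, x2, x3, x4)" by (cases X)
  define S1 S2 S3 where S: "S1 = depth1 T X" "S2 = depth2 T X" "S3 = depth3 T X"
  define m where "m = max (max S1 S2) S3"
  define d3 d2 where d: "d3 = max 0 (S3 - m + r)" "d2 = max 0 (max S2 S3 - m + r)"
  have m: "depth T X = m" by (simp add: depth_def S m_def)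
  let ?U = "(y1 - (r - d2), y2 - (d2 - d3), y3 - d3, a, b, c)"
  have U: "sink r X T = ?U" by (simp add: T X Let_def d S m flip: m[unfolded T X])
  define S3' S2' S1' where S': "S3' = S3 + 2 * r - d3" "S2' = S2 + 2 * r - d2 - d3" "S1' = S1 + r - d2"
  have D: "depth1 ?U X = S1'" "depth2 ?U X = S2'" "depth3 ?U X = S3'"
    by (simp_all add: X S' S T)
  note ar = sink_arith[OF assms m_def d S']
  have D0: "depth ?U X = m + r" unfolding depth_def D by (rule ar(1))
  have "sink 1 X ?U = (y1 - (r - d2) - (1 - (max 0 (max S2' S3' - (m + r) + 1))),
     y2 - (d2 - d3) - (max 0 (max S2' S3' - (m + r) + 1) - max 0 (S3' - (m + r) + 1)),
     y3 - d3 - max 0 (S3' - (m + r) + 1), a, b, c)"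
    unfolding sink.simps Let_def D D0 ..
  also have "\<dots> = sink (r + 1) X (y1, y2, y3, a, b, c)"
    unfolding ar(2,3) sink.simps Let_def using m by (simp add: T S)
  finally show ?thesis unfolding U by (simp only: T)
qed

lemma sink_0: "sink 0 X T = T"
proof -
  obtain y1 y2 y3 a b c where T: "T = (y1, y2, y3, a, b, c)" by (cases T)
  have "max 0 (depth3 T X - depth T X + 0) = 0" "max 0 (max (depth2 T X) (depth3 T X) - depth T X + 0) = 0"
    by (auto simp: depth_def)
  then show ?thesis unfolding T sink.simps Let_def by simp
qed

text \<open>Only \<open>f_q\<close> has been computed on patterns. As \<open>sink 1\<close> undoes
  \<open>grow\<close>, additivity identifies \<open>sink\<close> with the powers of
  \<open>e_q\<close>.\<close>

lemma sink_grow: "sink 1 X (grow X T) = T"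
proof -
  obtain y1 y2 y3 a b c where T: "T = (y1, y2, y3, a, b, c)" by (cases T)
  obtain x1 x2 x3 x4 where X: "X = (x1, x2, x3, x4)" by (cases X)
  define S1 S2 S3 where S: "S1 = depth1 T X" "S2 = depth2 T X" "S3 = depth3 T X"
  consider "S1 \<ge> S2" "S1 \<ge> S3" | "S1 < S2" "S2 \<ge> S3" | "S1 < S3" "S2 < S3" by linarith
  then show ?thesis
  proof cases
    case 1
    define U where "U = (y1 + 1, y2, y3, a, b, c)"
    have g: "grow X T = U" using 1 by (simp add: S T U_def Let_def)
    have D: "depth1 U X = S1 - 1" "depth2 U X = S2 - 2" "depth3 U X = S3 - 2" by (simp_all add: U_def X S T)
    then have "depth U X = S1 - 1" using 1 by (simp add: depth_def)
    with D 1 show ?thesis unfolding g by (simp add: U_def T Let_def)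
  next
    case 2
    define U where "U = (y1, y2 + 1, y3, a, b, c)"
    have g: "grow X T = U" using 2 by (simp add: S T U_def Let_def)
    have D: "depth1 U X = S1" "depth2 U X = S2 - 1" "depth3 U X = S3 - 2" by (simp_all add: U_def X S T)
    then have "depth U X = S2 - 1" using 2 by (simp add: depth_def)
    with D 2 show ?thesis unfolding g by (simp add: U_def T Let_def)
  next
    case 3
    define U where "U = (y1, y2, y3 + 1, a, b, c)"
    have g: "grow X T = U" using 3 by (simp add: S T U_def Let_def)
    have D: "depth1 U X = S1" "depth2 U X = S2" "depth3 U X = S3 - 1" by (simp_all add: U_def X S T)
    then have "depth U X = S3 - 1" using 3 by (simp add: depth_def)
    with D 3 show ?thesis unfolding g by (simp add: U_def T Let_def)
  qed
qed

declare sink.simps [simp del]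

lemma pat3_op_power_sink: "op_power (word_f q) k v = Some w \<Longrightarrow>
  pat3 (Suc q) v = sink (int k) (row4 q w) (pat3 (Suc q) w) \<and> row4 q v = row4 q w"
proof (induction k arbitrary: v)
  case (Suc k)
  then obtain u where u: "word_f q v = Some u" "op_power (word_f q) k u = Some w"
    by (auto simp: op_power_Suc2 bind_eq_Some_conv)
  note IH = Suc.IH[OF u(2)] and f = row4_f0[OF u(1)]
  have row: "row4 q v = row4 q w" using IH f by simp
  have "pat3 (Suc q) v = sink 1 (row4 q v) (grow (row4 q v) (pat3 (Suc q) v))" by (rule sink_grow[symmetric])
  also have "\<dots> = sink 1 (row4 q w) (sink (int k) (row4 q w) (pat3 (Suc q) w))"
    using IH f row by metis
  also have "\<dots> = sink (int (Suc k)) (row4 q w) (pat3 (Suc q) w)" by (simp add: sink_add add.commute)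
  finally show ?case using row by simp
qed (auto simp: op_power_0 sink_0)

text \<open>The fourth row is the shape on all four letters, which every operator of the block
  preserves. This is needed because the patterns on both sides of an edge are reflected with the
  same row.\<close>

lemma row4_f1: "word_f (Suc q) w = Some w' \<Longrightarrow> row4 q w' = row4 q w"
proof (induction w arbitrary: w')
  case (Cons z w)
  obtain y1 y2 y3 a b c where t: "pat3 (Suc q) w = (y1, y2, y3, a, b, c)" by (cases "pat3 (Suc q) w")
  obtain x1 x2 x3 x4 where r: "row4 q w = (x1, x2, x3, x4)" by (cases "row4 q w")
  note v = valid3_pat3[of "Suc q" w, unfolded t] valid4_row4[of q w, unfolded t r]
  have e: "word_eps (Suc q) w = b - y3 + max 0 (a + b - y2 - c)" using pat3_f0[OF t] by blast
  show ?case
  proof (cases "z = Suc q \<and> word_eps (Suc q) w = 0")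
    case True
    with Cons.prems have w': "w' = Suc (Suc q) # w" by (simp add: word_f_Cons)
    from True v e show ?thesis by (auto simp: w' t r numeral_eq_Suc max_def split: if_splits)
  next
    case False
    then obtain u where u: "word_f (Suc q) w = Some u" "w' = z # u" using Cons.prems by (auto simp: word_f_Cons split: if_splits)
    have ph: "0 < word_eps (Suc q) w + y1 + y2 + y3 - 2 * a - 2 * b + c"
      using word_f_None[of "Suc q" w] u(1) word_phi_nonneg[of "Suc q" w] pat3_cnt[OF t] by (simp add: word_phi_def)
    have t': "pat3 (Suc q) u = (if a + b - y2 - c \<ge> 0 then (y1, y2, y3, a + 1, b, c) else (y1, y2, y3, a, b + 1, c))"
      using pat3_f0[OF t] u(1) by blast
    consider "z = q" | "z = Suc q" "word_eps (Suc q) w > 0" | "z = q + 2" | "z = q + 3" | "z \<notin> {q, q + 1, q + 2, q + 3}"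
      using False word_eps_nonneg[of "Suc q" w] by force
    then show ?thesis
      by cases (use Cons.IH[OF u(1)] t' v e ph in \<open>auto simp: u(2) t r numeral_eq_Suc max_def split: if_splits\<close>)
  qed
qed simp

lemma row4_f2: "word_f (Suc (Suc q)) w = Some w' \<Longrightarrow> row4 q w' = row4 q w"
proof (induction w arbitrary: w')
  case (Cons z w)
  obtain y1 y2 y3 a b c where t: "pat3 (Suc q) w = (y1, y2, y3, a, b, c)" by (cases "pat3 (Suc q) w")
  obtain x1 x2 x3 x4 where r: "row4 q w = (x1, x2, x3, x4)" by (cases "row4 q w")
  note v = valid3_pat3[of "Suc q" w, unfolded t] valid4_row4[of q w, unfolded t r]
  have e: "word_eps (Suc (Suc q)) w = c - b" using pat3_f1[OF t] by simp
  show ?case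
  proof (cases "z = Suc (Suc q) \<and> word_eps (Suc (Suc q)) w = 0")
    case True
    with Cons.prems have w': "w' = Suc (Suc (Suc q)) # w" by (simp add: word_f_Cons)
    from True v e show ?thesis by (auto simp: w' t r numeral_eq_Suc split: if_splits)
  next
    case False
    then obtain u where u: "word_f (Suc (Suc q)) w = Some u" "w' = z # u" using Cons.prems by (auto simp: word_f_Cons split: if_splits)
    have t': "pat3 (Suc q) u = (y1, y2, y3, a, b, c + 1)"
      using pat3_f1[OF t] u(1) by simp
    consider "z = q" | "z = Suc q" | "z = q + 2" "c > b" | "z = q + 3" | "z \<notin> {q, q + 1, q + 2, q + 3}"
      using False e v by force
    then show ?thesis
      by cases (use Cons.IH[OF u(1)] t' v in \<open>auto simp: u(2) t r numeral_eq_Suc split: if_splits\<close>)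
  qed
qed simp

lemma row4_sref: assumes "p \<in> {q, Suc q, Suc (Suc q)}" shows "row4 q (sref p w) = row4 q w"
proof -
  have pow: "row4 q v' = row4 q v" if "op_power (word_f p) k v = Some v'" for k v v'
    using that
  proof (induction k arbitrary: v')
    case (Suc k)
    then show ?case using assms row4_f0 row4_f1 row4_f2 by (fastforce simp: op_power_Suc bind_eq_Some_conv)
  qed (auto simp: op_power_0)
  show ?thesis by (cases rule: sref_cases[of w p]) (metis pow)+
qed

text \<open>
  Only positivity carries over: the two string lengths themselves can differ, for instance for
  some words with \<open>2, 4, 2, 2\<close> letters \<open>q, q + 1, q + 2, q + 3\<close>.
\<close>

lemma far_root_arith:
  fixes x1 :: int
  assumes "x1 \<ge> y1" "y1 \<ge> x2" "x2 \<ge> y2" "y2 \<ge> x3" "x3 \<ge> y3" "y3 \<ge> x4"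
   "y1 \<ge> a" "a \<ge> y2" "y2 \<ge> b" "b \<ge> y3"
  "a' = a + (if a + b < y1 + y3 then 1 else 0)" "b' = b + (if a + b < y1 + y3 then 0 else 1)"
  "y1 \<ge> a'" "y2 \<ge> b'"
  "r = (y1 + y2 + y3 - a - b) - (x1 + x2 + x3 + x4 - y1 - y2 - y3)"
  "y1 + y2 + y3 - a - b > a + b - c" "a + b - c \<ge> (x1 + x2 + x3 + x4 - y1 - y2 - y3)" "a + b - c \<ge> c"
  "a \<ge> c" "c \<ge> b"
  "S1 = x1 - y1" "S2 = x1 + x2 - 2 * y1 - y2 + a" "S3 = x1 + x2 + x3 - 2 * y1 - 2 * y2 - y3 + a + b"
  "m = max (max S1 S2) S3" "d3 = max 0 (S3 - m + r)" "d2 = max 0 (max S2 S3 - m + r)"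
  "S2' = x1 + x2 - 2 * y1 - y2 + a'" "S3' = x1 + x2 + x3 - 2 * y1 - 2 * y2 - y3 + a' + b'"
  "m' = max (max S1 S2') S3'" "d3' = max 0 (S3' - m' + (r - 1))" "d2' = max 0 (max S2' S3' - m' + (r - 1))"
  "u1 = y1 - (r - d2)" "u2 = y2 - (d2 - d3)" "u3 = y3 - d3"
  "v1 = y1 - (r - 1 - d2')" "v2 = y2 - (d2' - d3')" "v3 = y3 - d3'"
  and pos: "b' + min (v1 + v3 - a' - b') 0 - min (a' + b' - v2 - c) 0 < c"
  shows "b + min (u1 + u3 - a - b) 0 - min (a + b - u2 - c) 0 < c"
proof -
  \<comment> \<open>Replacing \<open>(a, b, r)\<close> by \<open>(a', b', r - 1)\<close> leaves one
    more unit in exactly one of the three entries. In the middle alternative with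
    \<open>a' = a + 1\<close>, all \<open>r\<close> steps act on \<open>y2\<close>, so the outer two
    entries are untouched.\<close>
  have k: "v1 = u1 + 1 \<and> v2 = u2 \<and> v3 = u3 \<or> v1 = u1 \<and> v2 = u2 + 1 \<and> v3 = u3 \<and> (a' = a + 1 \<longrightarrow> u1 = y1 \<and> u3 = y3)
     \<or> v1 = u1 \<and> v2 = u2 \<and> v3 = u3 + 1"
  proof -
    have r: "r \<ge> 1" using assms(15-17) by linarith
    have m: "m \<ge> S1" "m \<ge> S2" "m \<ge> S3" "m = S1 \<or> m = S2 \<or> m = S3" using assms(24) by auto
    have S3': "S3' = S3 + 1" using assms(11,12,22,23,27,28) by auto
    have "d2' = d2 \<and> d3' = d3 \<or> d2' = d2 - 1 \<and> d3' = d3 \<and> (a' = a + 1 \<longrightarrow> d2 = r \<and> d3 = 0)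
       \<or> d2' = d2 - 1 \<and> d3' = d3 - 1"
    proof (cases "a' = a + 1")
      case True
      then have S2': "S2' = S2 + 1" using assms(22,27) by auto
      show ?thesis
      proof (cases "m = S2 \<or> m = S3")
        case t: True
        then have "m' = m + 1" using m assms(29) S2' S3' by auto
        then show ?thesis using t m r S2' S3' unfolding assms(25,26,30,31) by (auto simp: max_def)
      next
        case False
        then have "m' = m" using m assms(29) S2' S3' by auto
        then show ?thesis using m r S2' S3' unfolding assms(25,26,30,31) by (auto simp: max_def)
      qed
    next
      case False
      then have S2': "S2' = S2" using assms(11,22,27) by (auto split: if_splits)
      show ?thesis
      proof (cases "m = S3")
        case t: True
        then have "m' = m + 1" using m assms(29) S2' S3' by auto
        then show ?thesis using t m r S2' S3' False unfolding assms(25,26,30,31) by (auto simp: max_def)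
      next
        case f: False
        then have "m' = m" using m assms(29) S2' S3' by auto
        then show ?thesis using m r S2' S3' False unfolding assms(25,26,30,31) by (auto simp: max_def)
      qed
    qed
    then show ?thesis unfolding assms(32-37) by auto
  qed
  have u2: "u2 \<le> a" using assms(8,25,26,33) by linarith
  define D E where "D = u1 + u3 - a - b" and "E = a + b - u2 - c"
  \<comment> \<open>\<open>D - E\<close> is the content of q minus the content of q + 2, which is
    assumed to be at most 0.\<close>
  have DE: "D + u2 \<le> E + u2" using assms(15,17,32-34) unfolding D_def E_def by linarith
  have ab: "a' = a + 1 \<and> b' = b \<and> a + b < y1 + y3 \<or> a' = a \<and> b' = b + 1" using assms(11,12) by auto
  from k consider "v1 + v3 = u1 + u3 + 1" "v2 = u2" | "v1 + v3 = u1 + u3" "v2 = u2 + 1" "a' = a + 1 \<longrightarrow> u1 = y1 \<and> u3 = y3" by linarith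
  then have "b + min D 0 - min E 0 < c"
  proof cases
    case 1
    then have p: "b' + min D 0 - min (E + 1) 0 < c" using pos ab unfolding D_def E_def by (auto simp: algebra_simps)
    show ?thesis using p DE ab u2 assms(18,20) E_def D_def by (auto simp: min_def split: if_splits)
  next
    case 2
    then have p: "b' + min (D - 1) 0 - min E 0 < c" using pos ab unfolding D_def E_def by (auto simp: algebra_simps)
    moreover have "D > 0" if "a' = a + 1" using ab 2(3) that unfolding D_def by linarith
    ultimately show ?thesis using DE ab u2 assms(18,20) E_def D_def by (auto simp: min_def split: if_splits)
  qed
  then show ?thesis unfolding D_def E_def .
qed

lemma pat3_sref_sink:
  assumes "content z q \<le> content z (Suc q)"
  shows "pat3 (Suc q) (sref q z) = sink (content z (Suc q) - content z q) (row4 q z) (pat3 (Suc q) z)"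
proof (cases rule: sref_cases[of z q])
  case (down k)
  then have "k = 0" "content z (Suc q) - content z q = 0" using assms by auto
  with down show ?thesis by (simp add: op_power_0 sink_0)
next
  case (up k)
  with pat3_op_power_sink[OF up(3)] show ?thesis by simp
qed

lemma word_eps_reflect:
  assumes "pat3 q w = (y1, y2, y3, a, b, c)"
  shows "word_eps (q + 1) (sref q w) = c - (b + min (y1 + y3 - a - b) 0 - min (a + b - y2 - c) 0)"
proof -
  have "pat3 q (sref q w) = reflect0 (y1, y2, y3, a, b, c)" using assms by (simp add: pat3_sref0)
  then show ?thesis using pat3_f1[of q "sref q w"] by (simp add: Let_def)
qed

text \<open>The edge acts on the last three letters by \<open>raise01\<close>, so \<open>z'\<close>
  differs from \<open>z\<close> by one unit in \<open>a\<close> or \<open>b\<close>, over the same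
  fourth row. The inequalities between contents make the reflection at q go upwards for both words,
  by \<open>k\<close> and \<open>k - 1\<close> steps, so \<open>sink\<close> computes both images
  and positivity can be compared by integer arithmetic.\<close>

lemma far_root_up_aux:
  assumes e: "word_f (q + 2) (sref (q + 1) (sref (q + 2) z)) = Some (sref (q + 1) (sref (q + 2) z'))"
    and c: "content z (q + 1) > content z (q + 2)" "content z (q + 2) \<ge> content z q" "content z (q + 2) \<ge> content z (q + 3)"
    and pos: "word_eps (q + 2) (sref (q + 1) (sref q z')) > 0"
  shows "word_eps (q + 2) (sref (q + 1) (sref q z)) > 0"
proof -
  obtain y1 y2 y3 a b c where t: "pat3 (Suc q) z = (y1, y2, y3, a, b, c)" by (cases "pat3 (Suc q) z")
  obtain x1 x2 x3 x4 where r: "row4 q z = (x1, x2, x3, x4)" by (cases "row4 q z")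
  have t': "pat3 (Suc q) z' = raise01 (pat3 (Suc q) z)"
    using e by (intro pat3_edge01) (simp add: numeral_eq_Suc)
  have r': "row4 q z' = row4 q z"
    using row4_f2[of q "sref (q + 1) (sref (q + 2) z)" "sref (q + 1) (sref (q + 2) z')"] e
    by (simp add: row4_sref numeral_eq_Suc)
  define a' b' where ab: "a' = a + (if a + b < y1 + y3 then 1 else 0)" "b' = b + (if a + b < y1 + y3 then 0 else 1)"
  have T': "pat3 (Suc q) z' = (y1, y2, y3, a', b', c)" by (simp add: t' t ab)
  have n: "content z q = x1 + x2 + x3 + x4 - y1 - y2 - y3" "content z (Suc q) = y1 + y2 + y3 - a - b"
      "content z (q + 2) = a + b - c" "content z (q + 3) = c"
    using row4_cnt[OF r t] pat3_cnt[OF t] by (simp_all add: numeral_eq_Suc)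
  have n': "content z' q = content z q" "content z' (Suc q) = content z (Suc q) - 1"
    using row4_cnt[of q z', OF _ T'] row4_cnt[OF r t] pat3_cnt[OF t] pat3_cnt[OF T'] r r' ab by (auto split: if_splits)
  note v = valid3_pat3[of "Suc q" z, unfolded t] valid4_row4[of q z, unfolded t r] valid3_pat3[of "Suc q" z', unfolded T']
  define k where k: "k = (y1 + y2 + y3 - a - b) - (x1 + x2 + x3 + x4 - y1 - y2 - y3)"
  define S1 where S1: "S1 = x1 - y1"
  define S2 where S2: "S2 = x1 + x2 - 2 * y1 - y2 + a"
  define S3 where S3: "S3 = x1 + x2 + x3 - 2 * y1 - 2 * y2 - y3 + a + b"
  define m where m: "m = max (max S1 S2) S3"
  define d3 where d3: "d3 = max 0 (S3 - m + k)"
  define d2 where d2: "d2 = max 0 (max S2 S3 - m + k)"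
  define S2' where S2': "S2' = x1 + x2 - 2 * y1 - y2 + a'"
  define S3' where S3': "S3' = x1 + x2 + x3 - 2 * y1 - 2 * y2 - y3 + a' + b'"
  define m' where m': "m' = max (max S1 S2') S3'"
  define d3' where d3': "d3' = max 0 (S3' - m' + (k - 1))"
  define d2' where d2': "d2' = max 0 (max S2' S3' - m' + (k - 1))"
  have D: "depth2 (y1, y2, y3, a, b, c) (x1, x2, x3, x4) = S2" "depth3 (y1, y2, y3, a, b, c) (x1, x2, x3, x4) = S3"
    "depth (y1, y2, y3, a, b, c) (x1, x2, x3, x4) = m"
    by (simp_all add: S2 S3 m S1 depth_def)
  have D': "depth2 (y1, y2, y3, a', b', c) (x1, x2, x3, x4) = S2'" "depth3 (y1, y2, y3, a', b', c) (x1, x2, x3, x4) = S3'"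
    "depth (y1, y2, y3, a', b', c) (x1, x2, x3, x4) = m'"
    by (simp_all add: S2' S3' m' S1 depth_def)
  have "content z (Suc q) - content z q = k" "content z q \<le> content z (Suc q)" "content z' (Suc q) - content z' q = k - 1" "content z' q \<le> content z' (Suc q)"
    using n n' c by (simp_all add: k)
  then have s: "pat3 (Suc q) (sref q z) = sink k (x1, x2, x3, x4) (y1, y2, y3, a, b, c)"
    and s': "pat3 (Suc q) (sref q z') = sink (k - 1) (x1, x2, x3, x4) (y1, y2, y3, a', b', c)"
    using pat3_sref_sink[of z q, unfolded t r] pat3_sref_sink[of z' q, unfolded T' r' r] by simp_all
  have s: "pat3 (Suc q) (sref q z) = (y1 - (k - d2), y2 - (d2 - d3), y3 - d3, a, b, c)"
    unfolding s sink.simps Let_def D d2 d3 ..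
  have s': "pat3 (Suc q) (sref q z') = (y1 - (k - 1 - d2'), y2 - (d2' - d3'), y3 - d3', a', b', c)"
    unfolding s' sink.simps Let_def D' d2' d3' ..
  have p: "b' + min ((y1 - (k - 1 - d2')) + (y3 - d3') - a' - b') 0 - min (a' + b' - (y2 - (d2' - d3')) - c) 0 < c"
    using pos word_eps_reflect[OF s'] by (simp add: numeral_eq_Suc)
  have V: "x1 \<ge> y1" "y1 \<ge> x2" "x2 \<ge> y2" "y2 \<ge> x3" "x3 \<ge> y3" "y3 \<ge> x4"
    "y1 \<ge> a" "a \<ge> y2" "y2 \<ge> b" "b \<ge> y3" "y1 \<ge> a'" "y2 \<ge> b'" "a \<ge> c" "c \<ge> b"
    using v by simp_all
  have N: "y1 + y2 + y3 - a - b > a + b - c" "a + b - c \<ge> (x1 + x2 + x3 + x4 - y1 - y2 - y3)" "a + b - c \<ge> c"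
    using c n by simp_all
  have "b + min ((y1 - (k - d2)) + (y3 - d3) - a - b) 0 - min (a + b - (y2 - (d2 - d3)) - c) 0 < c"
    by (rule far_root_arith[OF V(1-10) ab V(11,12) k N V(13,14) S1 S2 S3 m d3 d2 S2' S3' m' d3' d2'
          refl refl refl refl refl refl p])
  then show ?thesis using word_eps_reflect[OF s] by (simp add: numeral_eq_Suc)
qed

text \<open>Applying \<open>sref q\<close> after \<open>sref (q + 1)\<close> moves the edge on q, q
  + 1 to the letters q + 1, q + 2, inside the block of the last three letters. The fourth letter
  then enters through a single reflection at q.\<close>

lemma far_root_up:
  assumes e: "word_f (q + 2) (sref (q + 1) (sref q (sref (q + 2) (sref (q + 1) x))))
      = Some (sref (q + 1) (sref q (sref (q + 2) (sref (q + 1) y))))"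
    and c: "content x q > content x (q + 1)" "content x (q + 1) \<ge> content x (q + 2)" "content x (q + 1) \<ge> content x (q + 3)"
    and y: "word_f (q + 2) u = Some y"
  shows "\<exists>u. word_f (q + 2) u = Some x"
proof -
  define z z' where z: "z = sref q (sref (q + 1) x)" "z' = sref q (sref (q + 1) y)"
  have fr: "far q (q + 2)" by (simp add: far_def)
  have zx: "sref (q + 1) (sref q z) = x" "sref (q + 1) (sref q z') = y" by (simp_all add: z sref_sref)
  have "word_eps (q + 2) (sref (q + 1) (sref q z)) > 0"
  proof (rule far_root_up_aux)
    show "word_f (q + 2) (sref (q + 1) (sref (q + 2) z)) = Some (sref (q + 1) (sref (q + 2) z'))"
      using e by (simp only: z sref_far[OF fr])
    show "word_eps (q + 2) (sref (q + 1) (sref q z')) > 0"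
      using word_f_step[OF y] word_eps_nonneg[of "q + 2" u] unfolding zx(2) by simp
  qed (use c in \<open>simp_all add: z sref_cnt numeral_eq_Suc\<close>)
  then obtain u where "word_e (q + 2) x = Some u" using word_e_None[of "q + 2" x] zx by fastforce
  then show ?thesis using word_e_iff by blast
qed

section \<open>Uniqueness of normal forms\<close>

text \<open>Newman's lemma in the form of Winkler and Buchberger.\<close>

lemma zigzag_normal_forms_unique:
  fixes R :: "'a \<Rightarrow> 'a \<Rightarrow> bool" and r :: "('a \<times> 'a) set"
  assumes wf: "wf r" and dec: "\<And>x y. R x y \<Longrightarrow> (y, x) \<in> r"
    and peak: "\<And>x a b. R x a \<Longrightarrow> R x b \<Longrightarrow>
      (\<lambda>u v. (R u v \<or> R v u) \<and> (u, x) \<in> r \<and> (v, x) \<in> r)\<^sup>*\<^sup>* a b"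
    and conn: "(\<lambda>u v. R u v \<or> R v u)\<^sup>*\<^sup>* a b" and nf: "\<And>z. \<not> R a z" "\<And>z. \<not> R b z"
  shows "a = b"
proof -
  define NF where "NF x = {y. R\<^sup>*\<^sup>* x y \<and> (\<forall>z. \<not> R y z)}" for x
  have ex: "NF x \<noteq> {}" for x
    using wf
  proof (induction x rule: wf_induct_rule)
    case (less x)
    show ?case
    proof (cases "\<exists>y. R x y")
      case True
      then obtain y where y: "R x y" ..
      with less[OF dec[OF y]] show ?thesis
        unfolding NF_def by (auto intro: converse_rtranclp_into_rtranclp)
    qed (auto simp: NF_def)
  qed
  have sub: "NF y \<subseteq> NF x" if "R x y" for x y
    using that by (auto simp: NF_def intro: converse_rtranclp_into_rtranclp)
  \<comment> \<open>Along an \<open>R\<close>-step the sets of normal forms are nested, and nested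
    singletons are equal; so a zigzag through vertices with unique normal forms keeps the normal
    form.\<close>
  have step_eq: "NF x = NF y" if xy: "R x y \<or> R y x" "\<forall>n\<in>NF x. \<forall>n'\<in>NF x. n = n'"
    "\<forall>n\<in>NF y. \<forall>n'\<in>NF y. n = n'" for x y
  proof -
    obtain n where n: "NF x = {n}" using ex[of x] xy(2) by blast
    obtain n' where n': "NF y = {n'}" using ex[of y] xy(3) by blast
    have "NF y \<subseteq> NF x \<or> NF x \<subseteq> NF y" using sub xy(1) by blast
    then show ?thesis unfolding n n' by auto
  qed
  have uniq: "\<forall>n\<in>NF x. \<forall>n'\<in>NF x. n = n'" for x
    using wf
  proof (induction x rule: wf_induct_rule)
    case (less x)
    show ?case
    proof (intro ballI)
      fix n n' assume n: "n \<in> NF x" "n' \<in> NF x"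
      show "n = n'"
      proof (cases "\<exists>z. R x z")
        case False
        with n have "x = n" "x = n'" unfolding NF_def by (auto elim: converse_rtranclpE)
        then show ?thesis by simp
      next
        case True
        then have "n \<noteq> x" "n' \<noteq> x" using n by (auto simp: NF_def)
        with n have "\<exists>a. R x a \<and> n \<in> NF a" "\<exists>b. R x b \<and> n' \<in> NF b"
          unfolding NF_def by (metis (mono_tags, lifting) converse_rtranclpE mem_Collect_eq)+
        then obtain a b where ab: "R x a" "n \<in> NF a" "R x b" "n' \<in> NF b" by blast
        from peak[OF ab(1,3)] have "NF a = NF b"
        proof (induction rule: rtranclp_induct)
          case (step u v)
          from step.hyps(2) have uv: "R u v \<or> R v u" "(u, x) \<in> r" "(v, x) \<in> r" by blast+
          from step_eq[OF uv(1) less[OF uv(2)] less[OF uv(3)]] step.IH show ?case by simp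
        qed simp
        with ab less[OF dec[OF ab(1)]] show ?thesis by simp
      qed
    qed
  qed
  from conn have "NF a = NF b"
  proof (induction rule: rtranclp_induct)
    case (step u v)
    from step_eq[OF step.hyps(2) uniq uniq] step.IH show ?case by simp
  qed simp
  moreover have "a \<in> NF a" "b \<in> NF b" using nf by (auto simp: NF_def)
  ultimately show ?thesis using uniq by blast
qed

abbreviation swap :: "nat \<Rightarrow> nat \<Rightarrow> nat" where
  "swap k \<equiv> transpose k (k + 1)"

section \<open>Injectivity of the weight on components\<close>

text \<open>The assumptions concern only the reflections and the operator at the top index. The last
  four describe edges among the top three or four letters, spelled out by reflections because
  general edges are constructed from these assumptions.\<close>

locale atom_structure =
  fixes n :: nat and cnt :: "'b \<Rightarrow> nat \<Rightarrow> int" and s :: "nat \<Rightarrow> 'b \<Rightarrow> 'b" and f :: "'b \<Rightarrow> 'b option"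
  assumes n: "1 \<le> n"
    and cnt_nonneg: "0 \<le> cnt b i"
    and s_s: "s k (s k b) = b"
    and s_cnt: "cnt (s k b) i = cnt b (swap k i)"
    and s_fixed: "cnt b k = cnt b (k + 1) \<Longrightarrow> s k b = b"
    and s_far: "k + 1 < l \<Longrightarrow> s k (s l b) = s l (s k b)"
    and s_braid: "s k (s (k + 1) (s k b)) = s (k + 1) (s k (s (k + 1) b))"
    and f_inj: "f a = Some b \<Longrightarrow> f a' = Some b \<Longrightarrow> a = a'"
    and f_cnt: "f a = Some b \<Longrightarrow> cnt b = (cnt a)(n := cnt a n - 1, n + 1 := cnt a (n + 1) + 1)"
    and f_defined: "cnt a (n + 1) < cnt a n \<Longrightarrow> \<exists>b. f a = Some b"
    and f_far: "k + 1 < n \<Longrightarrow> f a = Some b \<Longrightarrow> f (s k a) = Some (s k b)"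
    and f_mirror: "f a = Some b \<Longrightarrow> f (s n b) = Some (s n a)"
    and f_one: "cnt a n = cnt a (n + 1) + 1 \<Longrightarrow> f a = Some (s n a)"
    and f_triangle1: "2 \<le> n \<Longrightarrow> f (s (n - 1) (s n x)) = Some (s (n - 1) (s n y)) \<Longrightarrow>
      f (s (n - 1) x) = Some (s (n - 1) z) \<Longrightarrow> cnt y (n + 1) < cnt y n \<Longrightarrow> f y = Some z"
    and f_triangle2: "2 \<le> n \<Longrightarrow> f x = Some y \<Longrightarrow> f (s (n - 1) (s n y)) = Some (s (n - 1) (s n u)) \<Longrightarrow>
      f (s (n - 1) x) = Some (s (n - 1) z) \<Longrightarrow> u = z"
    and f_chain: "2 \<le> n \<Longrightarrow> f y = Some x \<Longrightarrow> f (s (n - 1) (s n z)) = Some (s (n - 1) (s n x)) \<Longrightarrow>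
      \<exists>u. f (s (n - 1) u) = Some (s (n - 1) x)"
    and f_square: "3 \<le> n \<Longrightarrow>
      f (s (n - 1) (s (n - 2) (s n (s (n - 1) x)))) = Some (s (n - 1) (s (n - 2) (s n (s (n - 1) y)))) \<Longrightarrow>
      cnt x (n - 1) < cnt x (n - 2) \<Longrightarrow> cnt x n \<le> cnt x (n - 1) \<Longrightarrow> cnt x (n + 1) \<le> cnt x (n - 1) \<Longrightarrow>
      f u = Some y \<Longrightarrow> \<exists>u. f u = Some x"
begin

abbreviation I :: "nat set" where "I \<equiv> {1..n + 1}"

section \<open>Coset representatives and conjugated operators\<close>

definition act :: "nat list \<Rightarrow> 'b \<Rightarrow> 'b" where "act ks b = foldr s ks b"
definition perm :: "nat list \<Rightarrow> nat \<Rightarrow> nat" where "perm ks i = foldr swap ks i"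

lemma act_simps [simp]: "act [] b = b" "act (k # ks) b = s k (act ks b)" "act (ks @ ls) b = act ks (act ls b)"
  by (simp_all add: act_def)

lemma perm_simps [simp]: "perm [] i = i" "perm (k # ks) i = swap k (perm ks i)" "perm (ks @ ls) i = perm ks (perm ls i)"
  by (simp_all add: perm_def)

lemma s_far': "k + 1 < l \<or> l + 1 < k \<Longrightarrow> s k (s l b) = s l (s k b)"
  using s_far by metis

text \<open>The cycle carrying j to m + 1 and lowering j + 1, ..., m + 1 by one: a coset
  representative for the stabilizer of the top letter.\<close>

definition down :: "nat \<Rightarrow> nat \<Rightarrow> 'b \<Rightarrow> 'b" where "down m j b = fold s [j..<m + 1] b"

lemma down_Suc: "j \<le> m \<Longrightarrow> down m j b = down m (j + 1) (s j b)"
  by (simp add: down_def upt_conv_Cons del: upt_Suc)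

lemma down_top: "down m (m + 1) b = b"
  by (simp add: down_def)

lemma down_s_below: "k + 1 < j \<Longrightarrow> j \<le> m + 1 \<Longrightarrow> down m j (s k b) = s k (down m j b)"
proof (induction "m + 1 - j" arbitrary: j b)
  case 0
  then have "j = m + 1" by simp
  then show ?case by (simp only: down_top)
next
  case (Suc d)
  then have j: "j \<le> m" by simp
  have "down m (j + 1) (s j (s k b)) = down m (j + 1) (s k (s j b))" using Suc.prems by (simp add: s_far')
  also have "\<dots> = s k (down m (j + 1) (s j b))" using Suc.hyps(2) Suc.prems by (intro Suc.hyps(1)) auto
  finally show ?case by (simp add: down_Suc j)
qed

text \<open>The cycle sends k and k + 1 to k - 1 and k, hence the shift of the index. The only
  nontrivial case is k = j + 1, which is one braid move.\<close>

lemma down_s_above: "j < k \<Longrightarrow> k \<le> m \<Longrightarrow> down m j (s k b) = s (k - 1) (down m j b)"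
proof (induction "k - j" arbitrary: j b)
  case (Suc d)
  show ?case
  proof (cases "k = j + 1")
    case True
    have "down m j (s k b) = down m (j + 2) (s k (s j (s k b)))"
      using Suc.prems True down_Suc[of j m] down_Suc[of "j + 1" m] by simp
    also have "\<dots> = down m (j + 2) (s j (s k (s j b)))" using True s_braid[of j b] by simp
    also have "\<dots> = s j (down m (j + 2) (s k (s j b)))" using Suc.prems True by (intro down_s_below) auto
    also have "down m (j + 2) (s k (s j b)) = down m j b"
      using Suc.prems True down_Suc[of j m] down_Suc[of "j + 1" m] by simp
    finally show ?thesis using True by simp
  next
    case False
    have "down m j (s k b) = down m (j + 1) (s j (s k b))" using Suc.prems by (simp add: down_Suc)
    also have "\<dots> = down m (j + 1) (s k (s j b))" using Suc.prems False by (simp add: s_far')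
    also have "\<dots> = s (k - 1) (down m (j + 1) (s j b))" using Suc False by (intro Suc.hyps(1)) auto
    finally show ?thesis using Suc.prems by (simp add: down_Suc)
  qed
qed simp

lemma down_inj: "down m j a = down m j b \<Longrightarrow> a = b"
proof (induction "m + 1 - j" arbitrary: j a b)
  case 0
  then show ?case by (simp add: down_def)
next
  case (Suc d)
  then have "down m (j + 1) (s j a) = down m (j + 1) (s j b)" by (simp add: down_Suc)
  from Suc.hyps(1)[OF _ this] Suc.hyps(2) have "s j a = s j b" by simp
  then show ?case using s_s by metis
qed

text \<open>
  The fixed word of reflections behind \<open>lift i j\<close> carries the letters \<open>i, j\<close> to \<open>n, n + 1\<close>. Although
  \<open>edge n (n + 1)\<close> is \<open>f\<^sub>n\<close>, \<open>edge i (i + 1)\<close> differs from the crystal operator \<open>f\<^sub>i\<close> for \<open>i < n\<close>.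
\<close>

definition lift :: "nat \<Rightarrow> nat \<Rightarrow> 'b \<Rightarrow> 'b" where
  "lift i j b = down (n - 1) (if i < j then i else i - 1) (down n j b)"

definition edge :: "nat \<Rightarrow> nat \<Rightarrow> 'b \<Rightarrow> 'b \<Rightarrow> bool" where
  "edge i j a b \<longleftrightarrow> f (lift i j a) = Some (lift i j b)"

lemma lift_inj: "lift i j a = lift i j b \<Longrightarrow> a = b"
  unfolding lift_def using down_inj by blast

lemma down_s_cases:
  assumes "1 \<le> k" "k \<le> m" "1 \<le> j" "j \<le> m + 1"
  shows "k + 1 < j \<and> (\<forall>b. down m (swap k j) (s k b) = s k (down m j b)) \<and> swap k j = j \<or>
    k + 1 = j \<and> (\<forall>b. down m (swap k j) (s k b) = down m j b) \<and> swap k j = k \<or>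
    k = j \<and> (\<forall>b. down m (swap k j) (s k b) = down m j b) \<and> swap k j = k + 1 \<or>
    j < k \<and> (\<forall>b. down m (swap k j) (s k b) = s (k - 1) (down m j b)) \<and> swap k j = j"
proof -
  consider "k + 1 < j" | "k + 1 = j" | "k = j" | "j < k" by linarith
  then show ?thesis
  proof cases
    case 1
    then show ?thesis using assms down_s_below[OF 1] by (simp add: transpose_def)
  next
    case 2
    then show ?thesis using assms down_Suc[of k m] by (auto simp: transpose_def s_s)
  next
    case 3
    then show ?thesis using assms down_Suc[of k m] by (auto simp: transpose_def s_s)
  next
    case 4
    then show ?thesis using assms down_s_above[OF 4] by (simp add: transpose_def)
  qed
qed

text \<open>Multiplying a coset representative by a simple reflection gives another representative,
  up to at most one simple reflection of the stabilizer of the top two letters. That reflection has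
  an index below n - 1 and commutes with \<open>f\<close>; this makes edges equivariant.\<close>

lemma lift_s: assumes "k \<in> {1..n}" "i \<in> I" "j \<in> I" "i \<noteq> j"
  shows "(\<forall>b. lift (swap k i) (swap k j) (s k b) = lift i j b) \<or>
    (\<exists>l. l + 1 < n \<and> (\<forall>b. lift (swap k i) (swap k j) (s k b) = s l (lift i j b)))"
proof -
  \<comment> \<open>The position of \<open>i\<close> after the first cycle has carried
    \<open>j\<close> to the top.\<close>
  define i' where "i' = (if i < j then i else i - 1)"
  define i'' where "i'' = (if swap k i < swap k j then swap k i else swap k i - 1)"
  have k: "1 \<le> k" "k \<le> n" and i: "1 \<le> i" "i \<le> n + 1" and j: "1 \<le> j" "j \<le> n + 1" using assms by auto
  have i': "1 \<le> i'" "i' \<le> n" using assms(2-4) by (auto simp: i'_def)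
  have L: "lift i j b = down (n - 1) i' (down n j b)" for b
    by (simp add: lift_def i'_def)
  \<comment> \<open>Once the reflection has passed the first cycle as \<open>s l\<close>, the second
    cycle is handled in the same way, one rank lower.\<close>
  have fin: "?thesis" if l: "1 \<le> l" "l + 1 \<le> n" and d: "\<And>b. down n (swap k j) (s k b) = s l (down n j b)"
    and ii: "i'' = swap l i'" for l
  proof -
    have e: "lift (swap k i) (swap k j) (s k b) = down (n - 1) (swap l i') (s l (down n j b))" for b
      unfolding lift_def d i''_def[symmetric] ii ..
    have m: "l \<le> n - 1" "i' \<le> n - 1 + 1" using l i' n by auto
    from down_s_cases[OF l(1) m(1) i'(1) m(2)]
    have "l + 1 < i' \<and> (\<forall>b. down (n - 1) (swap l i') (s l b) = s l (down (n - 1) i' b)) \<or>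
        (\<forall>b. down (n - 1) (swap l i') (s l b) = down (n - 1) i' b) \<or>
        i' < l \<and> (\<forall>b. down (n - 1) (swap l i') (s l b) = s (l - 1) (down (n - 1) i' b))" by blast
    then show ?thesis
    proof (elim disjE conjE)
      assume a: "l + 1 < i'" "\<forall>b. down (n - 1) (swap l i') (s l b) = s l (down (n - 1) i' b)"
      then have "l + 1 < n" using i' by simp
      moreover have "lift (swap k i) (swap k j) (s k b) = s l (lift i j b)" for b
        unfolding e a(2)[rule_format] L ..
      ultimately show ?thesis by blast
    next
      assume a: "\<forall>b. down (n - 1) (swap l i') (s l b) = down (n - 1) i' b"
      then have "lift (swap k i) (swap k j) (s k b) = lift i j b" for b
        unfolding e L by blast
      then show ?thesis by blast
    next
      assume a: "i' < l" "\<forall>b. down (n - 1) (swap l i') (s l b) = s (l - 1) (down (n - 1) i' b)"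
      then have "l - 1 + 1 < n" using l by simp
      moreover have "lift (swap k i) (swap k j) (s k b) = s (l - 1) (lift i j b)" for b
        unfolding e a(2)[rule_format] L ..
      ultimately show ?thesis by blast
    qed
  qed
  from down_s_cases[OF k j] consider
      "k + 1 < j" "\<And>b. down n (swap k j) (s k b) = s k (down n j b)" "swap k j = j"
    | "k + 1 = j" "\<And>b. down n (swap k j) (s k b) = down n j b" "swap k j = k"
    | "k = j" "\<And>b. down n (swap k j) (s k b) = down n j b" "swap k j = k + 1"
    | "j < k" "\<And>b. down n (swap k j) (s k b) = s (k - 1) (down n j b)" "swap k j = j" by blast
  then show ?thesis
  proof cases
    case 1
    have "i'' = swap k i'" unfolding i''_def i'_def 1(3) using 1(1) i assms(4) by (auto simp: transpose_def)
    with 1 k j show ?thesis by (intro fin[of k]) auto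
  next
    case 2
    have "i'' = i'" unfolding i''_def i'_def 2(3) using 2(1) i assms(4) by (auto simp: transpose_def)
    then show ?thesis unfolding lift_def i''_def[symmetric] i'_def[symmetric] 2(2) by blast
  next
    case 3
    have "i'' = i'" unfolding i''_def i'_def 3(3) using 3(1) i assms(4) by (auto simp: transpose_def)
    then show ?thesis unfolding lift_def i''_def[symmetric] i'_def[symmetric] 3(2) by blast
  next
    case 4
    have "i'' = swap (k - 1) i'" unfolding i''_def i'_def 4(3) using 4(1) i j assms(4) by (auto simp: transpose_def)
    with 4 k j show ?thesis by (intro fin[of "k - 1"]) auto
  qed
qed

lemma swap_in_I: "k \<in> {1..n} \<Longrightarrow> i \<in> I \<Longrightarrow> swap k i \<in> I"
  by (auto simp: transpose_def)

lemma edge_s: assumes "k \<in> {1..n}" "i \<in> I" "j \<in> I" "i \<noteq> j" "edge i j a b"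
  shows "edge (swap k i) (swap k j) (s k a) (s k b)"
  using lift_s[OF assms(1-4)] assms(5) f_far unfolding edge_def by fastforce

lemma perm_in_I: "set ks \<subseteq> {1..n} \<Longrightarrow> i \<in> I \<Longrightarrow> perm ks i \<in> I"
proof (induction ks)
  case (Cons k ks)
  then have "k \<in> {1..n}" "perm ks i \<in> I" by auto
  from swap_in_I[OF this] show ?case by simp
qed simp

lemma perm_inj: "perm ks i = perm ks j \<longleftrightarrow> i = j"
proof (induction ks)
  case (Cons k ks)
  then show ?case by (metis perm_simps(2) transpose_involutory)
qed simp

lemma edge_act: "set ks \<subseteq> {1..n} \<Longrightarrow> i \<in> I \<Longrightarrow> j \<in> I \<Longrightarrow> i \<noteq> j \<Longrightarrow> edge i j a b \<Longrightarrow>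
  edge (perm ks i) (perm ks j) (act ks a) (act ks b)"
proof (induction ks)
  case (Cons k ks)
  then have k: "k \<in> {1..n}" and ks: "set ks \<subseteq> {1..n}" by auto
  have "edge (swap k (perm ks i)) (swap k (perm ks j)) (s k (act ks a)) (s k (act ks b))"
    using Cons ks by (intro edge_s k perm_in_I) (auto simp: perm_inj)
  then show ?case by simp
qed simp

lemma act_rev: "act (rev ks) (act ks b) = b" "act ks (act (rev ks) b) = b"
  by (induction ks arbitrary: b) (auto simp: s_s)

lemma perm_rev: "perm (rev ks) (perm ks i) = i" "perm ks (perm (rev ks) i) = i"
  by (induction ks arbitrary: i) auto

lemma act_cnt: "cnt (act ks b) (perm ks i) = cnt b i"
  by (induction ks) (auto simp: s_cnt)

lemma edge_fun: "edge i j a b \<Longrightarrow> edge i j a b' \<Longrightarrow> b = b'"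
  unfolding edge_def using lift_inj by force

lemma edge_injective: "edge i j a b \<Longrightarrow> edge i j a' b \<Longrightarrow> a = a'"
  unfolding edge_def using lift_inj f_inj by metis

lemma edge_top: "edge n (n + 1) a b \<longleftrightarrow> f a = Some b"
  using n by (simp add: edge_def lift_def down_def)

end

context atom_structure
begin

section \<open>Transport of the relations to arbitrary letters\<close>

lemma perm_fix: "set ks \<subseteq> {1..m} \<Longrightarrow> m + 1 < i \<Longrightarrow> perm ks i = i"
  by (induction ks) (auto simp: transpose_def)

lemma perm_le: "set ks \<subseteq> {1..m} \<Longrightarrow> 1 \<le> i \<Longrightarrow> i \<le> m + 1 \<Longrightarrow> 1 \<le> perm ks i \<and> perm ks i \<le> m + 1"
  by (induction ks) (auto simp: transpose_def)

lemma perm_move: "1 \<le> i \<Longrightarrow> i \<le> m + 1 \<Longrightarrow> perm (rev [i..<m + 1]) i = m + 1"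
proof (induction m)
  case (Suc m)
  then show ?case by (cases "i = Suc m + 1") (auto simp: transpose_def)
qed simp

text \<open>The last entry is carried to the top first; the others are then arranged by reflections
  of smaller index, which fix the top letter.\<close>

lemma perm_to_top: "distinct is \<Longrightarrow> set is \<subseteq> {1..m + 1} \<Longrightarrow>
  \<exists>ks. set ks \<subseteq> {1..m} \<and> map (perm ks) is = [m + 2 - length is..<m + 2]"
proof (induction m arbitrary: "is")
  case 0
  then have "length is \<le> 1" using card_mono[OF _ 0(2)] by (simp add: distinct_card)
  with 0 show ?case by (intro exI[of _ "[]"]) (cases "is"; auto)
next
  case (Suc l)
  show ?case
  proof (cases "is" rule: rev_cases)
    case Nil
    then show ?thesis by (intro exI[of _ "[]"]) simp
  next
    case (snoc xs x)
    define ks where "ks = rev [x..<Suc l + 1]"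
    have ks: "set ks \<subseteq> {1..Suc l}" "perm ks x = Suc l + 1"
      using Suc.prems snoc perm_move[of x "Suc l"] by (auto simp: ks_def)
    have sub: "perm ks y \<in> {1..l + 1}" if "y \<in> set xs" for y
    proof -
      have "perm ks y \<noteq> perm ks x" using that Suc.prems snoc by (auto simp: perm_inj)
      then show ?thesis using perm_le[OF ks(1), of y] that Suc.prems snoc ks(2) by force
    qed
    have "distinct (map (perm ks) xs)" using Suc.prems snoc by (auto simp: distinct_map inj_on_def perm_inj)
    moreover have "set (map (perm ks) xs) \<subseteq> {1..l + 1}" using sub by auto
    ultimately obtain ls where ls: "set ls \<subseteq> {1..l}"
      "map (perm ls) (map (perm ks) xs) = [l + 2 - length (map (perm ks) xs)..<l + 2]" using Suc.IH by blast
    have "perm ls (Suc l + 1) = Suc l + 1" using ls(1) by (intro perm_fix) auto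
    moreover have "[Suc l + 2 - length (xs @ [x])..<Suc l + 2] = [l + 2 - length xs..<l + 2] @ [Suc l + 1]"
      by simp
    moreover have "map (perm (ls @ ks)) xs = map (perm ls) (map (perm ks) xs)" by simp
    ultimately have "map (perm (ls @ ks)) (xs @ [x]) = [Suc l + 2 - length (xs @ [x])..<Suc l + 2]"
      using ls(2) ks(2) by (simp del: upt_Suc map_map)
    moreover have "set (ls @ ks) \<subseteq> {1..Suc l}" using ls(1) ks(1) by auto
    ultimately show ?thesis unfolding snoc by blast
  qed
qed

lemma edge_act_iff: assumes "set ks \<subseteq> {1..n}" "i \<in> I" "j \<in> I" "i \<noteq> j"
  shows "edge (perm ks i) (perm ks j) (act ks a) (act ks b) \<longleftrightarrow> edge i j a b"
proof
  assume "edge (perm ks i) (perm ks j) (act ks a) (act ks b)"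
  then have "edge (perm (rev ks) (perm ks i)) (perm (rev ks) (perm ks j)) (act (rev ks) (act ks a)) (act (rev ks) (act ks b))"
    using assms perm_in_I by (intro edge_act[of "rev ks"]) (auto simp: perm_inj simp del: atLeastAtMost_iff)
  then show "edge i j a b" by (simp add: perm_rev act_rev)
qed (use edge_act assms in blast)

lemma obtain_top2: assumes "i \<in> I" "j \<in> I" "i \<noteq> j"
  obtains ks where "set ks \<subseteq> {1..n}" "perm ks i = n" "perm ks j = n + 1"
proof -
  obtain ks where ks: "set ks \<subseteq> {1..n}" "map (perm ks) [i, j] = [n + 2 - length [i, j]..<n + 2]"
    using perm_to_top[of "[i, j]" n] assms by auto
  have "[n + 2 - length [i, j]..<n + 2] = [n, n + 1]" by (simp add: upt_rec)
  with ks that show thesis by simp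
qed

lemma obtain_top3: assumes "i \<in> I" "j \<in> I" "k \<in> I" "distinct [i, j, k]"
  obtains ks where "set ks \<subseteq> {1..n}" "perm ks i = n - 1" "perm ks j = n" "perm ks k = n + 1" "2 \<le> n"
proof -
  have "card {i, j, k} \<le> card I" using assms by (intro card_mono) auto
  then have n2: "2 \<le> n" using assms(4) by simp
  obtain ks where ks: "set ks \<subseteq> {1..n}" "map (perm ks) [i, j, k] = [n + 2 - length [i, j, k]..<n + 2]"
    using perm_to_top[of "[i, j, k]" n] assms by auto
  have "[n + 2 - length [i, j, k]..<n + 2] = [n - 1, n, n + 1]" using n2 by (simp add: upt_rec)
  with ks that n2 show thesis by simp
qed

lemma obtain_top4: assumes "i \<in> I" "j \<in> I" "k \<in> I" "l \<in> I" "distinct [i, j, k, l]"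
  obtains ks where "set ks \<subseteq> {1..n}" "perm ks i = n - 2" "perm ks j = n - 1" "perm ks k = n" "perm ks l = n + 1" "3 \<le> n"
proof -
  have "card {i, j, k, l} \<le> card I" using assms by (intro card_mono) auto
  then have n3: "3 \<le> n" using assms(5) by simp
  obtain ks where ks: "set ks \<subseteq> {1..n}" "map (perm ks) [i, j, k, l] = [n + 2 - length [i, j, k, l]..<n + 2]"
    using perm_to_top[of "[i, j, k, l]" n] assms by auto
  obtain m where m: "n = 3 + m" using n3 le_Suc_ex by blast
  have "[n + 2 - length [i, j, k, l]..<n + 2] = [n - 2, n - 1, n, n + 1]" unfolding m by (simp add: upt_rec)
  with ks that n3 show thesis by simp
qed

lemma edge_cnt: assumes "i \<in> I" "j \<in> I" "i \<noteq> j" "edge i j a b"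
  shows "cnt b = (cnt a)(i := cnt a i - 1, j := cnt a j + 1)"
proof
  fix k
  obtain ks where ks: "set ks \<subseteq> {1..n}" "perm ks i = n" "perm ks j = n + 1" using obtain_top2[OF assms(1-3)] .
  have "f (act ks a) = Some (act ks b)"
    using edge_act[OF ks(1) assms] by (simp only: ks edge_top)
  from f_cnt[OF this] have "cnt (act ks b) (perm ks k) = ((cnt (act ks a))(perm ks i := cnt (act ks a) (perm ks i) - 1, perm ks j := cnt (act ks a) (perm ks j) + 1)) (perm ks k)"
    by (simp only: ks)
  then show "cnt b k = ((cnt a)(i := cnt a i - 1, j := cnt a j + 1)) k"
    using assms(3) by (auto simp: act_cnt perm_inj)
qed

lemma edge_exists: assumes "i \<in> I" "j \<in> I" "cnt a j < cnt a i" shows "\<exists>b. edge i j a b"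
proof -
  have ij: "i \<noteq> j" using assms(3) by auto
  obtain ks where ks: "set ks \<subseteq> {1..n}" "perm ks i = n" "perm ks j = n + 1" using obtain_top2[OF assms(1,2) ij] .
  have "cnt (act ks a) (perm ks j) < cnt (act ks a) (perm ks i)" using assms(3) unfolding act_cnt .
  then have "cnt (act ks a) (n + 1) < cnt (act ks a) n" unfolding ks .
  from f_defined[OF this] obtain y where "f (act ks a) = Some y" ..
  then have "edge n (n + 1) (act ks a) (act ks (act (rev ks) y))" unfolding edge_top act_rev .
  then have "edge i j a (act (rev ks) y)" using edge_act_iff[OF ks(1) assms(1,2) ij] ks by metis
  then show ?thesis ..
qed

lemma edge_mirror: assumes "i \<in> I" "j \<in> I" "i \<noteq> j" "edge i j a b" shows "edge j i b a"
proof -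
  obtain ks where ks: "set ks \<subseteq> {1..n}" "perm ks i = n" "perm ks j = n + 1" using obtain_top2[OF assms(1-3)] .
  have "f (act ks a) = Some (act ks b)" using edge_act[OF ks(1) assms] by (simp only: ks edge_top)
  then have "edge n (n + 1) (s n (act ks b)) (s n (act ks a))" unfolding edge_top by (rule f_mirror)
  then have "edge (swap n n) (swap n (n + 1)) (s n (s n (act ks b))) (s n (s n (act ks a)))"
    using n by (intro edge_s) auto
  then have "edge (perm ks j) (perm ks i) (act ks b) (act ks a)" by (simp add: ks s_s)
  then show ?thesis using edge_act_iff[OF ks(1) assms(2,1)] assms(3) by metis
qed

lemma edge_adjacent: "2 \<le> n \<Longrightarrow> edge (n - 1) n a b \<longleftrightarrow> f (s (n - 1) (s n a)) = Some (s (n - 1) (s n b))"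
  "2 \<le> n \<Longrightarrow> edge (n - 1) (n + 1) a b \<longleftrightarrow> f (s (n - 1) a) = Some (s (n - 1) b)"
  "3 \<le> n \<Longrightarrow> edge (n - 2) (n - 1) a b \<longleftrightarrow>
    f (s (n - 1) (s (n - 2) (s n (s (n - 1) a)))) = Some (s (n - 1) (s (n - 2) (s n (s (n - 1) b))))"
proof -
  have top: "down m m x = s m x" "down m (m + 1) x = x" for m x
    by (simp_all add: down_def)
  have top2: "1 \<le> m \<Longrightarrow> down m (m - 1) x = s m (s (m - 1) x)" for m x
    using down_Suc[of "m - 1" m x] top by simp
  show "2 \<le> n \<Longrightarrow> edge (n - 1) n a b \<longleftrightarrow> f (s (n - 1) (s n a)) = Some (s (n - 1) (s n b))"
    by (simp add: edge_def lift_def top)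
  show "2 \<le> n \<Longrightarrow> edge (n - 1) (n + 1) a b \<longleftrightarrow> f (s (n - 1) a) = Some (s (n - 1) b)"
    by (simp add: edge_def lift_def top(1) top(2)[simplified])
  show "3 \<le> n \<Longrightarrow> edge (n - 2) (n - 1) a b \<longleftrightarrow>
    f (s (n - 1) (s (n - 2) (s n (s (n - 1) a)))) = Some (s (n - 1) (s (n - 2) (s n (s (n - 1) b))))"
  proof -
    assume "3 \<le> n"
    then have "n - 2 < n - 1" "n - 1 - 1 = n - 2" "1 \<le> n" "1 \<le> n - 1" by auto
    then show ?thesis
      using top2[of n] top2[of "n - 1"] by (simp add: edge_def lift_def)
  qed
qed

lemma triangle1: assumes "i \<in> I" "j \<in> I" "k \<in> I" "distinct [i, j, k]"
    and e: "edge i j x y" "edge i k x z" and c: "cnt y k < cnt y j"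
  shows "edge j k y z"
proof -
  obtain ks where ks: "set ks \<subseteq> {1..n}" "perm ks i = n - 1" "perm ks j = n" "perm ks k = n + 1" "2 \<le> n"
    using obtain_top3[OF assms(1-4)] .
  note tr = edge_act_iff[OF ks(1)]
  have "edge (n - 1) n (act ks x) (act ks y)" "edge (n - 1) (n + 1) (act ks x) (act ks z)"
    using tr[of i j] tr[of i k] assms by (auto simp: ks)
  moreover have "cnt (act ks y) (perm ks k) < cnt (act ks y) (perm ks j)"
    using c unfolding act_cnt .
  ultimately have "edge n (n + 1) (act ks y) (act ks z)"
    unfolding edge_top edge_adjacent(1)[OF ks(5)] edge_adjacent(2)[OF ks(5)] ks(3,4) by (rule f_triangle1[OF ks(5)])
  then show ?thesis using tr[of j k] assms by (auto simp: ks)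
qed

lemma triangle2: assumes "i \<in> I" "j \<in> I" "k \<in> I" "distinct [i, j, k]"
    and e: "edge j k x y" "edge i j y u" "edge i k x z"
  shows "u = z"
proof -
  obtain ks where ks: "set ks \<subseteq> {1..n}" "perm ks i = n - 1" "perm ks j = n" "perm ks k = n + 1" "2 \<le> n"
    using obtain_top3[OF assms(1-4)] .
  note tr = edge_act_iff[OF ks(1)]
  have "edge n (n + 1) (act ks x) (act ks y)" "edge (n - 1) n (act ks y) (act ks u)"
      "edge (n - 1) (n + 1) (act ks x) (act ks z)"
    using tr[of i j] tr[of i k] tr[of j k] assms by (auto simp: ks)
  then have "act ks u = act ks z"
    unfolding edge_top edge_adjacent(1)[OF ks(5)] edge_adjacent(2)[OF ks(5)] by (rule f_triangle2[OF ks(5)])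
  then show ?thesis by (metis act_rev(1))
qed

lemma chain: assumes "i \<in> I" "j \<in> I" "k \<in> I" "distinct [i, j, k]"
    and e: "edge j k y x" "edge i j z x"
  shows "\<exists>u. edge i k u x"
proof -
  obtain ks where ks: "set ks \<subseteq> {1..n}" "perm ks i = n - 1" "perm ks j = n" "perm ks k = n + 1" "2 \<le> n"
    using obtain_top3[OF assms(1-4)] .
  note tr = edge_act_iff[OF ks(1)]
  have "edge n (n + 1) (act ks y) (act ks x)" "edge (n - 1) n (act ks z) (act ks x)"
    using tr[of i j] tr[of j k] assms by (auto simp: ks)
  then have "\<exists>u. edge (n - 1) (n + 1) u (act ks x)"
    unfolding edge_top edge_adjacent(1)[OF ks(5)] edge_adjacent(2)[OF ks(5)] by (rule f_chain[OF ks(5)])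
  then obtain u where "edge (perm ks i) (perm ks k) (act ks (act (rev ks) u)) (act ks x)" 
    unfolding ks act_rev by blast
  then show ?thesis using tr[of i k] assms by auto
qed

lemma square: assumes "i \<in> I" "j \<in> I" "k \<in> I" "l \<in> I" "distinct [i, j, k, l]"
    and e: "edge i j x y" "edge k l u y" and c: "cnt x j < cnt x i" "cnt x k \<le> cnt x j" "cnt x l \<le> cnt x j"
  shows "\<exists>u. edge k l u x"
proof -
  obtain ks where ks: "set ks \<subseteq> {1..n}" "perm ks i = n - 2" "perm ks j = n - 1" "perm ks k = n" "perm ks l = n + 1" "3 \<le> n"
    using obtain_top4[OF assms(1-5)] .
  note tr = edge_act_iff[OF ks(1)]
  have "edge (perm ks i) (perm ks j) (act ks x) (act ks y)" "edge (perm ks k) (perm ks l) (act ks u) (act ks y)"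
    using tr[of i j] tr[of k l] assms by auto
  moreover have "cnt (act ks x) (perm ks j) < cnt (act ks x) (perm ks i)" "cnt (act ks x) (perm ks k) \<le> cnt (act ks x) (perm ks j)"
     "cnt (act ks x) (perm ks l) \<le> cnt (act ks x) (perm ks j)"
    using c unfolding act_cnt by simp_all
  ultimately have "\<exists>u. edge n (n + 1) u (act ks x)"
    unfolding edge_top edge_adjacent(3)[OF ks(6)] ks(2-5) by (intro f_square[OF ks(6)])
  then obtain u where "edge (perm ks k) (perm ks l) (act ks (act (rev ks) u)) (act ks x)" 
    unfolding ks act_rev by blast
  then show ?thesis using tr[of k l] assms by auto
qed

text \<open>The word is a conjugate of \<open>s n\<close>. If the two contents agree,
  \<open>s n\<close> fixes the conjugated element, so the whole word fixes \<open>x\<close>.\<close>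

lemma obtain_transposition: assumes "i \<in> I" "j \<in> I" "i \<noteq> j"
  obtains ks where "set ks \<subseteq> {1..n}" "\<And>k. perm ks k = transpose i j k" "\<And>x. cnt x i = cnt x j \<Longrightarrow> act ks x = x"
proof -
  obtain ks where ks: "set ks \<subseteq> {1..n}" "perm ks i = n" "perm ks j = n + 1" using obtain_top2[OF assms] .
  have "perm (rev ks @ [n] @ ks) k = transpose i j k" for k
  proof -
    consider "k = i" | "k = j" | "k \<noteq> i" "k \<noteq> j" by blast
    then show ?thesis
    proof cases
      case 1
      then show ?thesis using perm_rev(1)[of ks j] by (simp add: ks)
    next
      case 2
      then show ?thesis using perm_rev(1)[of ks i] by (simp add: ks)
    next
      case 3
      then have "perm ks k \<noteq> n" "perm ks k \<noteq> n + 1" using perm_inj[of ks k i] perm_inj[of ks k j] ks by auto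
      with 3 show ?thesis by (simp add: transpose_def perm_rev)
    qed
  qed
  moreover have "act (rev ks @ [n] @ ks) x = x" if "cnt x i = cnt x j" for x
  proof -
    have "cnt (act ks x) (perm ks i) = cnt (act ks x) (perm ks j)" using that unfolding act_cnt .
    then have "cnt (act ks x) n = cnt (act ks x) (n + 1)" unfolding ks .
    from s_fixed[OF this] show ?thesis by (simp add: act_rev)
  qed
  moreover have "set (rev ks @ [n] @ ks) \<subseteq> {1..n}" using ks(1) n by auto
  ultimately show thesis by (intro that)
qed

text \<open>Moving a letter from \<open>i\<close> to \<open>j\<close> lowers the sum of squares by
  twice \<open>cnt a i - cnt a j - 1\<close>, so a difference of at least two is what makes it drop.
  For a difference of one the edge is a reflection. Sorting reflections are included so that normal
  forms are unique literally and not only up to the Weyl group.\<close>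

definition dn :: "'b \<Rightarrow> 'b \<Rightarrow> bool" where
  "dn a b \<longleftrightarrow> (\<exists>k\<in>{1..n}. cnt a k < cnt a (k + 1) \<and> b = s k a) \<or>
     (\<exists>i\<in>I. \<exists>j\<in>I. cnt a j + 2 \<le> cnt a i \<and> edge i j a b)"

definition sq :: "'b \<Rightarrow> nat" where "sq b = nat (\<Sum>i\<in>I. (cnt b i)\<^sup>2)"
text \<open>Reflections preserve \<open>sq\<close>; under a sorting reflection this
  position-weighted sum drops by the difference of the two contents exchanged.\<close>

definition disorder :: "'b \<Rightarrow> nat" where "disorder b = nat (\<Sum>i\<in>I. int i * cnt b i)"

definition below :: "('b \<times> 'b) set" where "below = measures [sq, disorder]"

end

section \<open>The two measures under swaps and moves\<close>

lemma sum_swap: fixes g :: "nat \<Rightarrow> nat \<Rightarrow> int"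
  assumes "k \<in> {1..n}"
  shows "(\<Sum>i\<in>{1..n + 1}. g i (swap k i)) = (\<Sum>i\<in>{1..n + 1}. g (swap k i) i)"
  by (rule sum.reindex_bij_witness[of _ "swap k" "swap k"]) (use assms in \<open>auto simp: transpose_def\<close>)

lemma sum_diff2: fixes g h :: "nat \<Rightarrow> int"
  assumes "finite A" "i \<in> A" "j \<in> A" "i \<noteq> j" "\<And>k. k \<noteq> i \<Longrightarrow> k \<noteq> j \<Longrightarrow> g k = h k"
  shows "sum g A - sum h A = g i - h i + (g j - h j)"
proof -
  have "sum g A - sum h A = (\<Sum>k\<in>A. g k - h k)" by (simp add: sum_subtractf)
  also have "\<dots> = (\<Sum>k\<in>{i, j}. g k - h k)" using assms by (intro sum.mono_neutral_right) auto
  finally show ?thesis using assms(4) by simp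
qed

lemma sum_sq_swap: fixes c :: "nat \<Rightarrow> int" assumes "k \<in> {1..n}"
  shows "(\<Sum>i\<in>{1..n + 1}. (c (swap k i))\<^sup>2) = (\<Sum>i\<in>{1..n + 1}. (c i)\<^sup>2)"
  using sum_swap[OF assms, of "\<lambda>i j. (c j)\<^sup>2"] by simp

lemma sum_disorder_swap: fixes c :: "nat \<Rightarrow> int" assumes "k \<in> {1..n}"
  shows "(\<Sum>i\<in>{1..n + 1}. int i * c (swap k i)) = (\<Sum>i\<in>{1..n + 1}. int i * c i) + c k - c (k + 1)"
proof -
  have "(\<Sum>i\<in>{1..n + 1}. int i * c (swap k i)) - (\<Sum>i\<in>{1..n + 1}. int i * c i) =
    int k * c (swap k k) - int k * c k + (int (k + 1) * c (swap k (k + 1)) - int (k + 1) * c (k + 1))"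
    using assms by (intro sum_diff2) auto
  then show ?thesis by (simp add: algebra_simps)
qed

lemma sum_sq_move: fixes c :: "nat \<Rightarrow> int" assumes "i \<in> {1..n + 1}" "j \<in> {1..n + 1}" "i \<noteq> j"
  shows "(\<Sum>k\<in>{1..n + 1}. ((c(i := c i - 1, j := c j + 1)) k)\<^sup>2) = (\<Sum>k\<in>{1..n + 1}. (c k)\<^sup>2) - 2 * (c i - c j - 1)"
proof -
  have "(\<Sum>k\<in>{1..n + 1}. ((c(i := c i - 1, j := c j + 1)) k)\<^sup>2) - (\<Sum>k\<in>{1..n + 1}. (c k)\<^sup>2) =
    ((c(i := c i - 1, j := c j + 1)) i)\<^sup>2 - (c i)\<^sup>2 + (((c(i := c i - 1, j := c j + 1)) j)\<^sup>2 - (c j)\<^sup>2)"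
    using assms by (intro sum_diff2) auto
  then show ?thesis using assms by (simp add: power2_eq_square algebra_simps)
qed

context atom_structure
begin

lemma sq_s: "k \<in> {1..n} \<Longrightarrow> sq (s k b) = sq b"
  using sum_sq_swap[of k n "cnt b"] by (simp add: sq_def s_cnt)

lemma sq_act: "set ks \<subseteq> {1..n} \<Longrightarrow> sq (act ks b) = sq b"
  by (induction ks) (auto simp: sq_s)

lemma sq_edge: assumes "i \<in> I" "j \<in> I" "cnt a j + 2 \<le> cnt a i" "edge i j a b" shows "sq b < sq a"
proof -
  have ij: "i \<noteq> j" using assms(3) by auto
  have "(\<Sum>i\<in>I. (cnt b i)\<^sup>2) = (\<Sum>i\<in>I. (cnt a i)\<^sup>2) - 2 * (cnt a i - cnt a j - 1)"
    unfolding edge_cnt[OF assms(1,2) ij assms(4)] by (rule sum_sq_move[OF assms(1,2) ij])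
  moreover have "0 \<le> (\<Sum>i\<in>I. (cnt b i)\<^sup>2)" by (intro sum_nonneg) auto
  ultimately show ?thesis using assms(3) by (simp add: sq_def)
qed

lemma below_s: assumes "k \<in> {1..n}" "cnt a k < cnt a (k + 1)" shows "(s k a, a) \<in> below"
proof -
  have "0 \<le> (\<Sum>i\<in>I. int i * cnt (s k a) i)" using cnt_nonneg by (intro sum_nonneg) auto
  then have "disorder (s k a) < disorder a"
    using sum_disorder_swap[OF assms(1), of "cnt a"] assms(2) by (simp add: disorder_def s_cnt)
  then show ?thesis using sq_s[OF assms(1)] by (simp add: below_def)
qed

lemma below_sq: "sq b < sq a \<Longrightarrow> (b, a) \<in> below"
  by (simp add: below_def)

lemma dn_below: "dn a b \<Longrightarrow> (b, a) \<in> below"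
  unfolding dn_def using below_s sq_edge below_sq by blast

lemma trans_below: "trans below"
  by (auto simp: below_def trans_def measures_def)

lemma wf_below: "wf below"
  by (simp add: below_def)

text \<open>A zigzag step with both ends below \<open>x\<close>, as the peak condition of the normal
  form lemma demands.\<close>

definition link :: "'b \<Rightarrow> 'b \<Rightarrow> 'b \<Rightarrow> bool" where
  "link x u v \<longleftrightarrow> (dn u v \<or> dn v u) \<and> (u, x) \<in> below \<and> (v, x) \<in> below"

lemma link_sym: "(link x)\<^sup>*\<^sup>* u v \<Longrightarrow> (link x)\<^sup>*\<^sup>* v u"
  by (induction rule: rtranclp_induct) (auto simp: link_def intro: converse_rtranclp_into_rtranclp)

lemma dn_s: "k \<in> {1..n} \<Longrightarrow> s k y = y \<or> dn y (s k y) \<or> dn (s k y) y"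
proof -
  assume k: "k \<in> {1..n}"
  consider "cnt y k < cnt y (k + 1)" | "cnt y k = cnt y (k + 1)" | "cnt y (k + 1) < cnt y k" by linarith
  then show ?thesis
  proof cases
    case 3
    then have "cnt (s k y) k < cnt (s k y) (k + 1)" by (simp add: s_cnt)
    then show ?thesis using k s_s[of k y] unfolding dn_def by metis
  qed (use k s_fixed dn_def in blast)+
qed

lemma link_s: assumes "k \<in> {1..n}" "sq y < sq x" shows "(link x)\<^sup>*\<^sup>* y (s k y)"
proof -
  have "(y, x) \<in> below" "(s k y, x) \<in> below" using assms sq_s below_sq by auto
  then show ?thesis using dn_s[OF assms(1), of y] by (auto simp: link_def)
qed

lemma link_act: "set ks \<subseteq> {1..n} \<Longrightarrow> sq y < sq x \<Longrightarrow> (link x)\<^sup>*\<^sup>* y (act ks y)"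
proof (induction ks)
  case (Cons k ks)
  then have "(link x)\<^sup>*\<^sup>* y (act ks y)" "(link x)\<^sup>*\<^sup>* (act ks y) (s k (act ks y))"
    using sq_act[of ks y] link_s[of k "act ks y" x] by auto
  then show ?case by simp
qed simp

lemma dn_edge: "i \<in> I \<Longrightarrow> j \<in> I \<Longrightarrow> cnt a j + 2 \<le> cnt a i \<Longrightarrow> edge i j a b \<Longrightarrow> dn a b"
  unfolding dn_def by blast

lemma link_dn: "dn u v \<Longrightarrow> (u, x) \<in> below \<Longrightarrow> link x u v \<and> link x v u"
  using dn_below[of u v] trans_below unfolding link_def by (meson transD)

text \<open>If \<open>j\<close> and \<open>k\<close> have equal content, the transposition of
  \<open>j\<close> and \<open>k\<close> fixes \<open>x\<close> and carries one target to the other.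
  Otherwise the first triangle gives an edge from \<open>j\<close> to \<open>k\<close> between the
  targets; as \<open>j\<close> has just gained a letter, that edge is a descent.\<close>

lemma link_source_le: assumes "i \<in> I" "j \<in> I" "k \<in> I" "cnt x j + 2 \<le> cnt x i" "cnt x k + 2 \<le> cnt x i"
    "edge i j x y" "edge i k x z" "cnt x k \<le> cnt x j"
  shows "(link x)\<^sup>*\<^sup>* y z"
proof (cases "j = k")
  case True
  then show ?thesis using edge_fun assms by blast
next
  case False
  have ij: "i \<noteq> j" "i \<noteq> k" using assms by auto
  have sq: "sq y < sq x" by (rule sq_edge[OF assms(1,2,4,6)])
  show ?thesis
  proof (cases "cnt x k = cnt x j")
    case True
    obtain ks where ks: "set ks \<subseteq> {1..n}" "\<And>l. perm ks l = transpose j k l" "\<And>x. cnt x j = cnt x k \<Longrightarrow> act ks x = x"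
      using obtain_transposition[OF assms(2,3) False] by blast
    have "edge (perm ks i) (perm ks j) (act ks x) (act ks y)"
      by (rule edge_act[OF ks(1) assms(1,2) ij(1) assms(6)])
    then have "edge i k x (act ks y)" using ij ks(3)[of x] True by (simp add: ks(2))
    then have "z = act ks y" using edge_fun assms(7) by blast
    then show ?thesis using link_act[OF ks(1) sq] by simp
  next
    case ne: False
    have c: "cnt y = (cnt x)(i := cnt x i - 1, j := cnt x j + 1)" by (rule edge_cnt[OF assms(1,2) ij(1) assms(6)])
    then have cy: "cnt y k + 2 \<le> cnt y j" using ne assms(8) ij False by simp
    then have "cnt y k < cnt y j" by simp
    moreover have "distinct [i, j, k]" using False ij by simp
    ultimately have "edge j k y z" using triangle1[OF assms(1-3) _ assms(6,7)] by blast
    then have "dn y z" using dn_edge cy assms by blast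
    with link_dn below_sq[OF sq] show ?thesis by blast
  qed
qed

lemma link_source: assumes "i \<in> I" "j \<in> I" "k \<in> I" "cnt x j + 2 \<le> cnt x i" "cnt x k + 2 \<le> cnt x i"
    "edge i j x y" "edge i k x z"
  shows "(link x)\<^sup>*\<^sup>* y z"
  using link_source_le[OF assms] link_source_le[OF assms(1,3,2,5,4,7,6), THEN link_sym] by linarith

text \<open>The counterpart at a common receiving letter: after \<open>j\<close> has lost a letter,
  \<open>i\<close> exceeds it by at least two unless their contents were equal, and the second
  triangle identifies the end of the resulting descent.\<close>

lemma link_target_le: assumes "i \<in> I" "j \<in> I" "k \<in> I" "cnt x k + 2 \<le> cnt x i" "cnt x k + 2 \<le> cnt x j"
    "edge i k x y" "edge j k x z" "cnt x j \<le> cnt x i"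
  shows "(link x)\<^sup>*\<^sup>* z y"
proof (cases "i = j")
  case True
  then show ?thesis using edge_fun assms by blast
next
  case False
  have ij: "i \<noteq> k" "j \<noteq> k" using assms by auto
  have sq: "sq z < sq x" by (rule sq_edge[OF assms(2,3,5,7)])
  show ?thesis
  proof (cases "cnt x i = cnt x j")
    case True
    obtain ks where ks: "set ks \<subseteq> {1..n}" "\<And>l. perm ks l = transpose i j l" "\<And>x. cnt x i = cnt x j \<Longrightarrow> act ks x = x"
      using obtain_transposition[OF assms(1,2) False] by blast
    have "edge (perm ks j) (perm ks k) (act ks x) (act ks z)"
      by (rule edge_act[OF ks(1) assms(2,3) ij(2) assms(7)])
    then have "edge i k x (act ks z)" using ij ks(3)[of x] True by (simp add: ks(2))
    then have "y = act ks z" using edge_fun assms(6) by blast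
    then show ?thesis using link_act[OF ks(1) sq] by simp
  next
    case ne: False
    have c: "cnt z = (cnt x)(j := cnt x j - 1, k := cnt x k + 1)" by (rule edge_cnt[OF assms(2,3) ij(2) assms(7)])
    then have cz: "cnt z j + 2 \<le> cnt z i" using ne assms(8) ij False by simp
    then obtain u where u: "edge i j z u" using edge_exists[OF assms(1,2), of z] by auto
    have "u = y" using triangle2[OF assms(1-3) _ assms(7) u assms(6)] False ij by simp
    then have "dn z y" using dn_edge u cz assms by blast
    with link_dn below_sq[OF sq] show ?thesis by blast
  qed
qed

lemma link_target: assumes "i \<in> I" "j \<in> I" "k \<in> I" "cnt x k + 2 \<le> cnt x i" "cnt x k + 2 \<le> cnt x j"
    "edge i k x y" "edge j k x z"
  shows "(link x)\<^sup>*\<^sup>* y z"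
  using link_target_le[OF assms, THEN link_sym] link_target_le[OF assms(2,1,3,5,4,7,6)] by linarith

lemma link_edges: assumes "i \<in> I" "j \<in> I" "k \<in> I" "l \<in> I" "cnt x j + 2 \<le> cnt x i" "cnt x l + 2 \<le> cnt x k"
    "edge i j x y" "edge k l x z"
  shows "(link x)\<^sup>*\<^sup>* y z"
proof -
  have *: "(link x)\<^sup>*\<^sup>* y z" if ijkl: "i \<in> I" "j \<in> I" "k \<in> I" "l \<in> I" "cnt x j + 2 \<le> cnt x i" "cnt x l + 2 \<le> cnt x k"
    "edge i j x y" "edge k l x z" "cnt x k \<le> cnt x i" for i j k l y z
  proof -
    have il: "cnt x l + 2 \<le> cnt x i" using ijkl by simp
    then obtain u where u: "edge i l x u" using edge_exists[OF ijkl(1,4), of x] by auto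
    have "(link x)\<^sup>*\<^sup>* y u" by (rule link_source[OF ijkl(1,2,4) ijkl(5) il ijkl(7) u])
    moreover have "(link x)\<^sup>*\<^sup>* u z" by (rule link_target[OF ijkl(1,3,4) il ijkl(6) u ijkl(8)])
    ultimately show ?thesis by simp
  qed
  show ?thesis
    using *[OF assms] *[OF assms(3,4,1,2,6,5,8,7), THEN link_sym] by linarith
qed

lemma link_s_edge: assumes "k \<in> {1..n}" "cnt x k < cnt x (k + 1)" "i \<in> I" "j \<in> I" "cnt x j + 2 \<le> cnt x i" "edge i j x y"
  shows "(link x)\<^sup>*\<^sup>* (s k x) y"
proof -
  have ij: "i \<noteq> j" using assms(5) by auto
  have "edge (swap k i) (swap k j) (s k x) (s k y)" by (rule edge_s[OF assms(1,3,4) ij assms(6)])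
  moreover have "cnt (s k x) (swap k j) + 2 \<le> cnt (s k x) (swap k i)" using assms(5) by (simp add: s_cnt)
  ultimately have "dn (s k x) (s k y)" using swap_in_I[OF assms(1)] assms(3,4) dn_edge by blast
  then have "link x (s k x) (s k y)" using link_dn below_s[OF assms(1,2)] by blast
  moreover have "(link x)\<^sup>*\<^sup>* (s k y) y" by (rule link_sym[OF link_s[OF assms(1) sq_edge[OF assms(3-6)]]])
  ultimately show ?thesis by (rule converse_rtranclp_into_rtranclp)
qed

lemma dn_s_asc: "k \<in> {1..n} \<Longrightarrow> cnt a k < cnt a (k + 1) \<Longrightarrow> dn a (s k a)"
  unfolding dn_def by blast

text \<open>The two ways of sorting bound a square or a hexagon of the Coxeter relations. Every
  arrow in it is again a sorting step, so the whole polygon stays below \<open>x\<close>.\<close>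

lemma link_s_s: assumes "k \<in> {1..n}" "l \<in> {1..n}" "cnt x k < cnt x (k + 1)" "cnt x l < cnt x (l + 1)" "k < l"
  shows "(link x)\<^sup>*\<^sup>* (s k x) (s l x)"
proof -
  note d = dn_s_asc[OF assms(1,3)] dn_s_asc[OF assms(2,4)]
  note bx = dn_below[OF d(1)] dn_below[OF d(2)]
  show ?thesis
  proof (cases "l = k + 1")
    case False
    then have kl: "k + 1 < l" using assms(5) by simp
    have "dn (s k x) (s l (s k x))" "dn (s l x) (s k (s l x))"
      using assms kl by (auto intro!: dn_s_asc simp: s_cnt transpose_def)
    then have "link x (s k x) (s l (s k x))" "link x (s k (s l x)) (s l x)" using link_dn bx by blast+
    then show ?thesis using s_far[OF kl, of x] by (metis converse_rtranclp_into_rtranclp r_into_rtranclp)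
  next
    case True
    have 1: "dn (s k x) (s l (s k x))" "dn (s l x) (s k (s l x))"
      using assms unfolding True by (auto intro!: dn_s_asc simp: s_cnt transpose_def)
    have 2: "dn (s l (s k x)) (s k (s l (s k x)))" "dn (s k (s l x)) (s l (s k (s l x)))"
      using assms unfolding True by (auto intro!: dn_s_asc simp: s_cnt transpose_def)
    have b: "(s l (s k x), x) \<in> below" "(s k (s l x), x) \<in> below"
      using dn_below[OF 1(1)] dn_below[OF 1(2)] bx trans_below by (meson transD)+
    have "link x (s k x) (s l (s k x))" "link x (s l (s k x)) (s k (s l (s k x)))"
      "link x (s l (s k (s l x))) (s k (s l x))" "link x (s k (s l x)) (s l x)"
      using link_dn 1 2 b bx by blast+
    moreover have "s k (s l (s k x)) = s l (s k (s l x))" unfolding True by (rule s_braid)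
    ultimately show ?thesis by (metis converse_rtranclp_into_rtranclp r_into_rtranclp)
  qed
qed

lemma dn_peak: assumes "dn x a" "dn x b" shows "(link x)\<^sup>*\<^sup>* a b"
proof -
  have ss: "(link x)\<^sup>*\<^sup>* (s k x) (s l x)" if kl: "k \<in> {1..n}" "l \<in> {1..n}" "cnt x k < cnt x (k + 1)" "cnt x l < cnt x (l + 1)" for k l
    using link_s_s[OF kl] link_s_s[OF kl(2,1,4,3), THEN link_sym] by (cases k l rule: linorder_cases) auto
  from assms show ?thesis unfolding dn_def
    using ss link_edges link_s_edge link_s_edge[THEN link_sym] by (elim disjE bexE conjE) blast+
qed

lemma dn_zigzag: assumes "k \<in> {1..n}" shows "(\<lambda>u v. dn u v \<or> dn v u)\<^sup>*\<^sup>* a (s k a)"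
  using dn_s[OF assms, of a] by auto

text \<open>An arrow of \<open>f\<close> is a descent in the upper part of its string, the
  reflection \<open>s n\<close> in the middle, and in the lower part a descent read backwards,
  through the mirrored edge.\<close>

lemma dn_zigzag_f: assumes "f a = Some b" shows "(\<lambda>u v. dn u v \<or> dn v u)\<^sup>*\<^sup>* a b"
proof -
  have nI: "n \<in> I" "n + 1 \<in> I" using n by auto
  have e: "edge n (n + 1) a b" using assms edge_top by blast
  consider "cnt a (n + 1) + 2 \<le> cnt a n" | "cnt a n = cnt a (n + 1) + 1" | "cnt a n \<le> cnt a (n + 1)" by linarith
  then show ?thesis
  proof cases
    case 1
    with e nI have "dn a b" by (intro dn_edge)
    then show ?thesis by auto
  next
    case 2
    from f_one[OF this] assms have "b = s n a" by simp
    then show ?thesis using dn_zigzag[of n a] n by simp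
  next
    case 3
    have "edge (n + 1) n b a" using edge_mirror[OF nI _ e] by simp
    moreover have "cnt b n + 2 \<le> cnt b (n + 1)" using f_cnt[OF assms] 3 by simp
    ultimately have "dn b a" using nI by (intro dn_edge)
    then show ?thesis by auto
  qed
qed

section \<open>Components and paths between elements of equal content\<close>

definition component_step :: "'b \<Rightarrow> 'b \<Rightarrow> bool" where
  "component_step a b \<longleftrightarrow> (\<exists>k\<in>{1..n}. b = s k a) \<or> f a = Some b \<or> f b = Some a"

lemma zigzag_sym: "(\<lambda>u v. dn u v \<or> dn v u)\<^sup>*\<^sup>* a b \<Longrightarrow> (\<lambda>u v. dn u v \<or> dn v u)\<^sup>*\<^sup>* b a"
  by (induction rule: rtranclp_induct) (auto intro: converse_rtranclp_into_rtranclp)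

lemma component_zigzag: "component_step\<^sup>*\<^sup>* a b \<Longrightarrow> (\<lambda>u v. dn u v \<or> dn v u)\<^sup>*\<^sup>* a b"
proof (induction rule: rtranclp_induct)
  case (step b c)
  have "(\<lambda>u v. dn u v \<or> dn v u)\<^sup>*\<^sup>* b c"
    using step.hyps(2) dn_zigzag dn_zigzag_f zigzag_sym unfolding component_step_def by blast
  with step.IH show ?case by simp
qed simp

lemma dn_follow: "dn a b \<Longrightarrow> cnt a' = cnt a \<Longrightarrow> \<exists>b'. dn a' b' \<and> cnt b' = cnt b \<and> (b' = b \<longrightarrow> a' = a)"
proof -
  assume d: "dn a b" and c: "cnt a' = cnt a"
  from d consider k where "k \<in> {1..n}" "cnt a k < cnt a (k + 1)" "b = s k a"
    | i j where "i \<in> I" "j \<in> I" "cnt a j + 2 \<le> cnt a i" "edge i j a b" unfolding dn_def by blast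
  then show ?thesis
  proof cases
    case 1
    then have "dn a' (s k a')" using c by (intro dn_s_asc) auto
    moreover have "cnt (s k a') = cnt b" using c 1 by (auto simp: s_cnt)
    moreover have "s k a' = b \<longrightarrow> a' = a" using 1 s_s by metis
    ultimately show ?thesis by blast
  next
    case 2
    then obtain b' where b': "edge i j a' b'" using edge_exists[of i j a'] c by auto
    then have "dn a' b'" using 2 c by (intro dn_edge) auto
    moreover have "i \<noteq> j" using 2(3) by auto
    then have "cnt b' = cnt b" using edge_cnt[OF 2(1,2) _ 2(4)] edge_cnt[OF 2(1,2) _ b'] c by simp
    ultimately show ?thesis using edge_injective b' 2(4) by blast
  qed
qed

lemma dn_follows: "dn\<^sup>*\<^sup>* a b \<Longrightarrow> cnt a' = cnt a \<Longrightarrow> \<exists>b'. dn\<^sup>*\<^sup>* a' b' \<and> cnt b' = cnt b \<and> (b' = b \<longrightarrow> a' = a)"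
proof (induction rule: rtranclp_induct)
  case (step b c)
  then obtain b' where b': "dn\<^sup>*\<^sup>* a' b'" "cnt b' = cnt b" "b' = b \<longrightarrow> a' = a" by blast
  from dn_follow[OF step.hyps(2) b'(2)] b' show ?case by (meson rtranclp.rtrancl_into_rtrancl)
qed blast

lemma component_inj: assumes "component_step\<^sup>*\<^sup>* a b" "cnt a = cnt b" shows "a = b"
proof -
  have "\<exists>d. dn\<^sup>*\<^sup>* a d \<and> (\<forall>z. \<not> dn d z)" for a
    using wf_below
  proof (induction a rule: wf_induct_rule)
    case (less a)
    show ?case
    proof (cases "\<exists>b. dn a b")
      case True
      then obtain b where b: "dn a b" ..
      with less[OF dn_below[OF b]] show ?thesis by (meson converse_rtranclp_into_rtranclp)
    qed blast
  qed
  then obtain d where d: "dn\<^sup>*\<^sup>* a d" "\<And>z. \<not> dn d z" by blast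
  obtain d' where d': "dn\<^sup>*\<^sup>* b d'" "cnt d' = cnt d" "d' = d \<longrightarrow> b = a"
    using dn_follows[OF d(1)] assms(2) by metis
  have nf: "\<not> dn d' z" for z using dn_follow[of d' z d] d(2) d'(2) by auto
  have up: "dn\<^sup>*\<^sup>* x y \<Longrightarrow> (\<lambda>u v. dn u v \<or> dn v u)\<^sup>*\<^sup>* x y" for x y
    by (erule rtranclp_mono[THEN predicate2D, rotated]) auto
  have "(\<lambda>u v. dn u v \<or> dn v u)\<^sup>*\<^sup>* d d'"
    using zigzag_sym[OF up[OF d(1)]] component_zigzag[OF assms(1)] up[OF d'(1)] by simp
  then have "d = d'"
    using zigzag_normal_forms_unique[OF wf_below, of dn d d'] dn_below dn_peak d(2) nf
    unfolding link_def by blast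
  with d'(3) show ?thesis by simp
qed

end

section \<open>The largest weight of a component\<close>

definition move :: "int \<Rightarrow> nat \<Rightarrow> nat \<Rightarrow> (nat \<Rightarrow> int) \<Rightarrow> nat \<Rightarrow> int" where
  "move k i j c = c(i := c i - k, j := c j + k)"

locale atom_component = atom_structure +
  fixes b0 :: 'a
begin

definition C :: "'a set" where "C = {b. component_step\<^sup>*\<^sup>* b0 b}"
definition S :: "(nat \<Rightarrow> int) set" where "S = cnt ` C"

lemma C_step: "b \<in> C \<Longrightarrow> component_step b b' \<Longrightarrow> b' \<in> C"
  by (simp add: C_def)

lemma C_s: "b \<in> C \<Longrightarrow> k \<in> {1..n} \<Longrightarrow> s k b \<in> C"
  by (erule C_step) (auto simp: component_step_def)

lemma C_act: "b \<in> C \<Longrightarrow> set ks \<subseteq> {1..n} \<Longrightarrow> act ks b \<in> C"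
  by (induction ks) (auto intro: C_s)

lemma C_edge: assumes "i \<in> I" "j \<in> I" "i \<noteq> j" "edge i j a b" shows "a \<in> C \<longleftrightarrow> b \<in> C"
proof -
  obtain ks where ks: "set ks \<subseteq> {1..n}" "perm ks i = n" "perm ks j = n + 1" using obtain_top2[OF assms(1-3)] .
  have "f (act ks a) = Some (act ks b)" using edge_act[OF ks(1) assms] by (simp only: ks edge_top)
  then have "act ks a \<in> C \<longleftrightarrow> act ks b \<in> C"
    using C_step[of "act ks a" "act ks b"] C_step[of "act ks b" "act ks a"] unfolding component_step_def by blast
  then show ?thesis using C_act[of _ ks] C_act[of _ "rev ks"] ks(1) act_rev(1) by (metis set_rev)
qed

lemma step_sym: "component_step\<^sup>*\<^sup>* a b \<Longrightarrow> component_step\<^sup>*\<^sup>* b a"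
proof (induction rule: rtranclp_induct)
  case (step b c)
  then have "component_step c b" unfolding component_step_def using s_s by metis
  with step.IH show ?case by (rule converse_rtranclp_into_rtranclp[rotated])
qed simp

lemma C_inj: "a \<in> C \<Longrightarrow> b \<in> C \<Longrightarrow> cnt a = cnt b \<Longrightarrow> a = b"
  unfolding C_def using component_inj step_sym by (metis mem_Collect_eq rtranclp_trans)

lemma edge_move: assumes "i \<in> I" "j \<in> I" "i \<noteq> j" "edge i j a b"
  shows "cnt b = move 1 i j (cnt a)" "cnt a = move 1 j i (cnt b)"
  using edge_cnt[OF assms] assms(3) by (auto simp: move_def fun_eq_iff)

lemma S_swap: "c \<in> S \<Longrightarrow> k \<in> {1..n} \<Longrightarrow> c \<circ> swap k \<in> S"
  unfolding S_def by (auto simp: image_iff s_cnt fun_eq_iff intro!: bexI[OF _ C_s])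

lemma S_lower: assumes "c \<in> S" "i \<in> I" "j \<in> I" "c j < c i" shows "move 1 i j c \<in> S"
proof -
  obtain a where a: "a \<in> C" "c = cnt a" using assms(1) by (auto simp: S_def)
  obtain b where b: "edge i j a b" using edge_exists[of i j a] assms a by auto
  have ij: "i \<noteq> j" using assms by auto
  show ?thesis unfolding a(2) edge_move(1)[OF assms(2,3) ij b, symmetric] S_def
    using C_edge[OF assms(2,3) ij b] a(1) by blast
qed

text \<open>This turns membership of a content into an actual edge: an edge leaves the element with
  the raised content, its target has the content of \<open>b\<close>, and in one component this
  forces the target to be \<open>b\<close>.\<close>

lemma S_raise: assumes "b \<in> C" "i \<in> I" "j \<in> I" "i \<noteq> j" "cnt b j \<le> cnt b i" "move 1 j i (cnt b) \<in> S"
  shows "\<exists>a\<in>C. edge i j a b"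
proof -
  obtain a where a: "a \<in> C" "cnt a = move 1 j i (cnt b)" using assms(6) by (auto simp: S_def)
  then have "cnt a j < cnt a i" using assms(4,5) by (simp add: move_def)
  then obtain b' where b': "edge i j a b'" using edge_exists[OF assms(2,3)] by blast
  have "cnt b' = cnt b" using edge_move(1)[OF assms(2-4) b'] a(2) assms(4) by (auto simp: move_def)
  then have "b' = b" using C_inj C_edge[OF assms(2-4) b'] a(1) assms(1) by blast
  with a(1) b' show ?thesis by blast
qed

lemma S_edge: "i \<in> I \<Longrightarrow> j \<in> I \<Longrightarrow> i \<noteq> j \<Longrightarrow> edge i j a b \<Longrightarrow> b \<in> C \<Longrightarrow> move 1 j i (cnt b) \<in> S"
  using C_edge[of i j a b] edge_move(2)[of i j a b] unfolding S_def by (metis imageI)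

lemma S_chain: assumes "c \<in> S" "i \<in> I" "j \<in> I" "k \<in> I" "c j < c i" "c k < c j" "move 1 j i c \<in> S" "move 1 k j c \<in> S"
  shows "move 1 k i c \<in> S"
proof -
  obtain b where b: "b \<in> C" "c = cnt b" using assms(1) by (auto simp: S_def)
  obtain z where z: "edge i j z b" using S_raise[OF b(1) assms(2,3)] assms b by auto
  obtain y where y: "edge j k y b" using S_raise[OF b(1) assms(3,4)] assms b by auto
  have "distinct [i, j, k]" using assms(5,6) by auto
  from chain[OF assms(2-4) this y z] obtain u where u: "edge i k u b" ..
  have "i \<noteq> k" using assms(5,6) by auto
  from S_edge[OF assms(2,4) this u b(1)] show ?thesis unfolding b(2) .
qed

lemma S_square: assumes "c \<in> S" "i \<in> I" "j \<in> I" "k \<in> I" "l \<in> I" "distinct [i, j, k, l]"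
    "c j \<le> c i" "c k < c j" "c l \<le> c k" "move 1 j i c \<in> S" "move 1 l k c \<in> S"
  shows "move 1 l k (move 1 j i c) \<in> S"
proof -
  obtain y where y: "y \<in> C" "c = cnt y" using assms(1) by (auto simp: S_def)
  have ij: "i \<noteq> j" and kl: "k \<noteq> l" using assms(6) by auto
  obtain x where x: "edge i j x y" using S_raise[OF y(1) assms(2,3) ij] assms y by auto
  obtain u where u: "edge k l u y" using S_raise[OF y(1) assms(4,5) kl] assms y by auto
  have cx: "cnt x = move 1 j i c" using edge_move(2)[OF assms(2,3) ij x] y by simp
  have "cnt x j < cnt x i" "cnt x k \<le> cnt x j" "cnt x l \<le> cnt x j"
    unfolding cx using assms(6-9) by (auto simp: move_def)
  from square[OF assms(2-6) x u this] obtain v where v: "edge k l v x" ..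
  show ?thesis using S_edge[OF assms(4,5) kl v] C_edge[OF assms(2,3) ij x] y cx by simp
qed

definition total :: int where "total = (\<Sum>i\<in>I. cnt b0 i)"

lemma sum_move: fixes c :: "nat \<Rightarrow> int" assumes "i \<in> I" "j \<in> I" "i \<noteq> j"
  shows "(\<Sum>l\<in>I. move k i j c l) = (\<Sum>l\<in>I. c l)"
proof -
  have "(\<Sum>l\<in>I. move k i j c l) - (\<Sum>l\<in>I. c l) = move k i j c i - c i + (move k i j c j - c j)"
    using assms by (intro sum_diff2) (auto simp: move_def)
  then show ?thesis using assms by (simp add: move_def)
qed

lemma step_total: "component_step a b \<Longrightarrow> (\<Sum>i\<in>I. cnt b i) = (\<Sum>i\<in>I. cnt a i)"
proof -
  have e: "f a = Some b \<Longrightarrow> (\<Sum>i\<in>I. cnt b i) = (\<Sum>i\<in>I. cnt a i)" for a b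
  proof -
    assume "f a = Some b"
    moreover have "n \<in> I" "n + 1 \<in> I" "n \<noteq> n + 1" using n by auto
    ultimately show ?thesis
      using edge_move(1)[of n "n + 1" a b] sum_move[of n "n + 1" 1 "cnt a"] unfolding edge_top by simp
  qed
  have s: "k \<in> {1..n} \<Longrightarrow> (\<Sum>i\<in>I. cnt (s k a) i) = (\<Sum>i\<in>I. cnt a i)" for k
    using sum_swap[of k n "\<lambda>i j. cnt a j"] by (simp add: s_cnt)
  show "component_step a b \<Longrightarrow> ?thesis" unfolding component_step_def using e[of a b] e[of b a] s by auto
qed

lemma C_total: "b \<in> C \<Longrightarrow> (\<Sum>i\<in>I. cnt b i) = total"
proof -
  assume "b \<in> C"
  then have "component_step\<^sup>*\<^sup>* b0 b" by (simp add: C_def)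
  then show ?thesis
  proof (induction rule: rtranclp_induct)
    case (step a b)
    then show ?case using step_total[of a b] by (simp only:)
  qed (simp add: total_def)
qed

section \<open>Raising relation on contents\<close>

definition sqs :: "(nat \<Rightarrow> int) \<Rightarrow> int" where "sqs c = (\<Sum>i\<in>I. (c i)\<^sup>2)"

text \<open>Contents are nonnegative with a fixed sum, so the sums of squares are bounded and
  raising terminates.\<close>

lemma sqs_bound: assumes "c \<in> S" shows "sqs c \<le> total\<^sup>2"
proof -
  obtain b where b: "b \<in> C" "c = cnt b" using assms by (auto simp: S_def)
  have le: "c i \<le> total" if "i \<in> I" for i
    using member_le_sum[OF that, of c] cnt_nonneg C_total[OF b(1)] b(2) by auto
  have "sqs c \<le> (\<Sum>i\<in>I. c i * total)"
    unfolding sqs_def power2_eq_square using le cnt_nonneg b(2) by (intro sum_mono mult_left_mono) auto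
  also have "\<dots> = total\<^sup>2" using C_total[OF b(1)] b(2) by (simp add: power2_eq_square flip: sum_distrib_right)
  finally show ?thesis .
qed

text \<open>The descents read backwards: a difference of at least two before lowering is a
  difference of at least zero before raising. Accordingly raising increases the sum of squares by
  \<open>2 * (c i - c j + 1)\<close>.\<close>

definition up :: "(nat \<Rightarrow> int) \<Rightarrow> (nat \<Rightarrow> int) \<Rightarrow> bool" where
  "up c d \<longleftrightarrow> c \<in> S \<and> d \<in> S \<and> ((\<exists>k\<in>{1..n}. c k < c (k + 1) \<and> d = c \<circ> swap k) \<or>
     (\<exists>i\<in>I. \<exists>j\<in>I. i \<noteq> j \<and> c j \<le> c i \<and> d = move 1 j i c))"

definition above :: "((nat \<Rightarrow> int) \<times> (nat \<Rightarrow> int)) set" where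
  "above = measures [\<lambda>c. nat (total\<^sup>2 - sqs c), \<lambda>c. nat (\<Sum>i\<in>I. int i * c i)]"

lemma sqs_swap: "k \<in> {1..n} \<Longrightarrow> sqs (c \<circ> swap k) = sqs c"
  using sum_sq_swap[of k n c] by (simp add: sqs_def)

lemma sqs_move: "i \<in> I \<Longrightarrow> j \<in> I \<Longrightarrow> i \<noteq> j \<Longrightarrow> c j \<le> c i \<Longrightarrow> sqs c < sqs (move 1 j i c)"
  using sum_sq_move[of j n i c] by (simp add: sqs_def move_def)

lemma above_sqs: "c \<in> S \<Longrightarrow> d \<in> S \<Longrightarrow> sqs c < sqs d \<Longrightarrow> (d, c) \<in> above"
  using sqs_bound[of c] sqs_bound[of d] by (auto simp: above_def)

lemma above_swap: assumes "c \<in> S" "k \<in> {1..n}" "c k < c (k + 1)" shows "(c \<circ> swap k, c) \<in> above"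
proof -
  obtain b where b: "b \<in> C" "c = cnt b" using assms by (auto simp: S_def)
  have "0 \<le> (\<Sum>i\<in>I. int i * (c \<circ> swap k) i)" using cnt_nonneg b(2) by (intro sum_nonneg) auto
  then have "nat (\<Sum>i\<in>I. int i * (c \<circ> swap k) i) < nat (\<Sum>i\<in>I. int i * c i)"
    using sum_disorder_swap[OF assms(2), of c] assms(3) by simp
  then show ?thesis using sqs_swap[OF assms(2), of c] by (simp add: above_def)
qed

lemma up_above: "up c d \<Longrightarrow> (d, c) \<in> above"
  unfolding up_def using above_swap above_sqs sqs_move by metis

lemma wf_above: "wf above" and trans_above: "trans above"
  by (auto simp: above_def trans_def measures_def)

definition tie :: "(nat \<Rightarrow> int) \<Rightarrow> (nat \<Rightarrow> int) \<Rightarrow> (nat \<Rightarrow> int) \<Rightarrow> bool" where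
  "tie x u v \<longleftrightarrow> (up u v \<or> up v u) \<and> (u, x) \<in> above \<and> (v, x) \<in> above"

lemma tie_sym: "(tie x)\<^sup>*\<^sup>* u v \<Longrightarrow> (tie x)\<^sup>*\<^sup>* v u"
  by (induction rule: rtranclp_induct) (auto simp: tie_def intro: converse_rtranclp_into_rtranclp)

lemma swap_le_eq: "c k = c (k + 1) \<Longrightarrow> c \<circ> swap k = (c :: nat \<Rightarrow> int)"
  by (auto simp: fun_eq_iff transpose_def)

lemma swap_swap: "c \<circ> swap k \<circ> swap k = (c :: nat \<Rightarrow> int)"
  by (auto simp: fun_eq_iff)

lemma up_swap: assumes "c \<in> S" "k \<in> {1..n}" shows "c \<circ> swap k = c \<or> up c (c \<circ> swap k) \<or> up (c \<circ> swap k) c"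
proof -
  consider "c k < c (k + 1)" | "c k = c (k + 1)" | "c (k + 1) < c k" by linarith
  then show ?thesis
  proof cases
    case 1
    then show ?thesis using assms S_swap unfolding up_def by blast
  next
    case 2
    then show ?thesis using swap_le_eq by blast
  next
    case 3
    then have "(c \<circ> swap k) k < (c \<circ> swap k) (k + 1)" by simp
    then have "up (c \<circ> swap k) c" using assms S_swap[OF assms] swap_swap[of c k] unfolding up_def by metis
    then show ?thesis by blast
  qed
qed

lemma tie_swap: assumes "x \<in> S" "c \<in> S" "k \<in> {1..n}" "sqs x < sqs c" shows "(tie x)\<^sup>*\<^sup>* c (c \<circ> swap k)"
proof -
  have "(c, x) \<in> above" "(c \<circ> swap k, x) \<in> above" using assms sqs_swap S_swap above_sqs by auto
  then show ?thesis using up_swap[OF assms(2,3)] by (auto simp: tie_def)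
qed

lemma comp_perm: "c \<circ> perm (k # ks) = (c \<circ> swap k) \<circ> perm ks"
  by (auto simp: fun_eq_iff)

lemma S_perm: "set ks \<subseteq> {1..n} \<Longrightarrow> c \<in> S \<Longrightarrow> c \<circ> perm ks \<in> S"
proof (induction ks arbitrary: c)
  case Nil
  then show ?case by (simp add: comp_def)
next
  case (Cons k ks)
  then have k: "k \<in> {1..n}" and ks: "set ks \<subseteq> {1..n}" by auto
  show ?case unfolding comp_perm by (rule Cons.IH[OF ks S_swap[OF Cons.prems(2) k]])
qed

lemma tie_perm: "set ks \<subseteq> {1..n} \<Longrightarrow> x \<in> S \<Longrightarrow> c \<in> S \<Longrightarrow> sqs x < sqs c \<Longrightarrow> (tie x)\<^sup>*\<^sup>* c (c \<circ> perm ks)"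
proof (induction ks arbitrary: c)
  case Nil
  then show ?case by (simp add: comp_def)
next
  case (Cons k ks)
  from Cons.prems have k: "k \<in> {1..n}" and ks: "set ks \<subseteq> {1..n}" by auto
  have "(tie x)\<^sup>*\<^sup>* c (c \<circ> swap k)" by (rule tie_swap[OF Cons.prems(2,3) k Cons.prems(4)])
  moreover have "(tie x)\<^sup>*\<^sup>* (c \<circ> swap k) ((c \<circ> swap k) \<circ> perm ks)"
    using Cons.prems(4) by (intro Cons.IH[OF ks Cons.prems(2) S_swap[OF Cons.prems(3) k]]) (simp only: sqs_swap[OF k])
  ultimately show ?case unfolding comp_perm by (rule rtranclp_trans)
qed

lemma S_transpose: assumes "i \<in> I" "j \<in> I" "c \<in> S" shows "c \<circ> transpose i j \<in> S"
proof (cases "i = j")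
  case False
  obtain ks where ks: "set ks \<subseteq> {1..n}" "\<And>l. perm ks l = transpose i j l"
      "\<And>x. cnt x i = cnt x j \<Longrightarrow> act ks x = x"
    using obtain_transposition[OF assms(1,2) False] by blast
  then have "perm ks = transpose i j" by auto
  with S_perm[OF ks(1) assms(3)] show ?thesis by simp
qed (use assms in simp)

lemma tie_transpose: assumes "i \<in> I" "j \<in> I" "x \<in> S" "c \<in> S" "sqs x < sqs c" shows "(tie x)\<^sup>*\<^sup>* c (c \<circ> transpose i j)"
proof (cases "i = j")
  case False
  obtain ks where ks: "set ks \<subseteq> {1..n}" "\<And>l. perm ks l = transpose i j l"
      "\<And>x. cnt x i = cnt x j \<Longrightarrow> act ks x = x"
    using obtain_transposition[OF assms(1,2) False] by blast
  then have "perm ks = transpose i j" by auto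
  with tie_perm[OF ks(1) assms(3-5)] show ?thesis by simp
qed simp

section \<open>Local confluence of raising\<close>

lemma up_move: "c \<in> S \<Longrightarrow> i \<in> I \<Longrightarrow> j \<in> I \<Longrightarrow> i \<noteq> j \<Longrightarrow> c j \<le> c i \<Longrightarrow> move 1 j i c \<in> S \<Longrightarrow> up c (move 1 j i c)"
  unfolding up_def by blast

lemma tie_up: "up u v \<Longrightarrow> (u, x) \<in> above \<Longrightarrow> tie x u v \<and> tie x v u"
  using up_above[of u v] trans_above unfolding tie_def by (meson transD)

lemma above_move: "c \<in> S \<Longrightarrow> i \<in> I \<Longrightarrow> j \<in> I \<Longrightarrow> i \<noteq> j \<Longrightarrow> c j \<le> c i \<Longrightarrow> move 1 j i c \<in> S \<Longrightarrow> (move 1 j i c, c) \<in> above"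
  using up_above up_move by blast

text \<open>As both results lie in \<open>S\<close>, arithmetic of contents closes the peak: they
  differ by one raising that takes a letter from \<open>k\<close> to \<open>j\<close>, or by a
  transposition if \<open>c j = c k\<close>.\<close>

lemma tie_source_le: assumes "c \<in> S" "i \<in> I" "j \<in> I" "k \<in> I" "i \<noteq> j" "i \<noteq> k" "c j \<le> c i" "c k \<le> c j"
    "move 1 j i c \<in> S" "move 1 k i c \<in> S"
  shows "(tie c)\<^sup>*\<^sup>* (move 1 j i c) (move 1 k i c)"
proof (cases "j = k")
  case False
  show ?thesis
  proof (cases "c j = c k")
    case True
    have "move 1 j i c \<circ> transpose j k = move 1 k i c"
      using True assms(5,6) False by (auto simp: fun_eq_iff move_def transpose_def)
    with tie_transpose[OF assms(3,4,1,9) sqs_move[OF assms(2,3,5,7)]] show ?thesis by simp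
  next
    case ne: False
    have "move 1 k j (move 1 j i c) = move 1 k i c" using assms(5,6) False by (auto simp: fun_eq_iff move_def)
    moreover have "move 1 j i c k \<le> move 1 j i c j" using ne assms(5,6,8) False by (simp add: move_def)
    ultimately have "up (move 1 j i c) (move 1 k i c)" using up_move[OF assms(9,3,4)] assms(10) False by metis
    then show ?thesis using tie_up above_move[OF assms(1,2,3,5,7,9)] by blast
  qed
qed simp

lemma tie_source: assumes "c \<in> S" "i \<in> I" "j \<in> I" "k \<in> I" "i \<noteq> j" "i \<noteq> k" "c j \<le> c i" "c k \<le> c i"
    "move 1 j i c \<in> S" "move 1 k i c \<in> S"
  shows "(tie c)\<^sup>*\<^sup>* (move 1 j i c) (move 1 k i c)"
proof (cases "c k \<le> c j")
  case True
  show ?thesis by (rule tie_source_le[OF assms(1-7) True assms(9,10)])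
next
  case False
  show ?thesis by (rule tie_sym[OF tie_source_le[OF assms(1,2,4,3,6,5,8) _ assms(10,9)]]) (use False in simp)
qed

lemma tie_target_le: assumes "c \<in> S" "i \<in> I" "j \<in> I" "k \<in> I" "i \<noteq> k" "j \<noteq> k" "c k \<le> c j" "c j \<le> c i"
    "move 1 k i c \<in> S" "move 1 k j c \<in> S"
  shows "(tie c)\<^sup>*\<^sup>* (move 1 k j c) (move 1 k i c)"
proof (cases "i = j")
  case False
  show ?thesis
  proof (cases "c i = c j")
    case True
    have "move 1 k j c \<circ> transpose i j = move 1 k i c"
      using True assms(5,6) False by (auto simp: fun_eq_iff move_def transpose_def)
    with tie_transpose[OF assms(2,3,1,10) sqs_move[OF assms(3,4,6,7)]] show ?thesis by simp
  next
    case ne: False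
    have "move 1 j i (move 1 k j c) = move 1 k i c" using assms(5,6) False by (auto simp: fun_eq_iff move_def)
    moreover have "move 1 k j c j \<le> move 1 k j c i" using ne assms(5,6,8) False by (simp add: move_def)
    ultimately have "up (move 1 k j c) (move 1 k i c)" using up_move[OF assms(10,2,3)] assms(9) False by metis
    then show ?thesis using tie_up above_move[OF assms(1,3,4,6,7,10)] by blast
  qed
qed simp

lemma tie_target: assumes "c \<in> S" "i \<in> I" "j \<in> I" "k \<in> I" "i \<noteq> k" "j \<noteq> k" "c k \<le> c i" "c k \<le> c j"
    "move 1 k i c \<in> S" "move 1 k j c \<in> S"
  shows "(tie c)\<^sup>*\<^sup>* (move 1 k i c) (move 1 k j c)"
proof (cases "c j \<le> c i")
  case True
  show ?thesis by (rule tie_sym[OF tie_target_le[OF assms(1-6,8) True assms(9,10)]])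
next
  case False
  show ?thesis by (rule tie_target_le[OF assms(1,3,2,4,6,5,7) _ assms(10,9)]) (use False in simp)
qed

text \<open>The strict case is the chain property of the crystal; if two of the contents agree, a
  transposition already carries one of the given raisings to the required one.\<close>

lemma S_chain_le: assumes "c \<in> S" "i \<in> I" "j \<in> I" "k \<in> I" "distinct [i, j, k]" "c j \<le> c i" "c k \<le> c j"
    "move 1 j i c \<in> S" "move 1 k j c \<in> S"
  shows "move 1 k i c \<in> S"
proof -
  consider "c j = c i" | "c k = c j" | "c j < c i" "c k < c j" using assms(6,7) by linarith
  then show ?thesis
  proof cases
    case 1
    have "move 1 k j c \<circ> transpose i j = move 1 k i c"
      using 1 assms(5) by (auto simp: fun_eq_iff move_def transpose_def)
    with S_transpose[OF assms(2,3,9)] show ?thesis by simp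
  next
    case 2
    have "move 1 j i c \<circ> transpose j k = move 1 k i c"
      using 2 assms(5) by (auto simp: fun_eq_iff move_def transpose_def)
    with S_transpose[OF assms(3,4,8)] show ?thesis by simp
  next
    case 3
    with S_chain[OF assms(1-4) _ _ assms(8,9)] show ?thesis by simp
  qed
qed

lemma tie_chain: assumes "c \<in> S" "i \<in> I" "j \<in> I" "k \<in> I" "distinct [i, j, k]" "c j \<le> c i" "c k \<le> c j"
    "move 1 j i c \<in> S" "move 1 k j c \<in> S"
  shows "(tie c)\<^sup>*\<^sup>* (move 1 j i c) (move 1 k j c)"
proof -
  note u = S_chain_le[OF assms]
  have "(tie c)\<^sup>*\<^sup>* (move 1 j i c) (move 1 k i c)" by (rule tie_source[OF assms(1-4)]) (use assms u in auto)
  moreover have "(tie c)\<^sup>*\<^sup>* (move 1 k i c) (move 1 k j c)" by (rule tie_target[OF assms(1-4)]) (use assms u in auto)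
  ultimately show ?thesis by (rule rtranclp_trans)
qed

text \<open>If \<open>k\<close> lies strictly below \<open>j\<close>, no raising sharing a letter
  with both is at hand, and the peak is closed by performing both raisings. This is the place where
  the four-letter fact enters. In the remaining case the peak is joined through the raising from
  \<open>l\<close> to \<open>i\<close>.\<close>

lemma tie_disjoint: assumes "c \<in> S" "i \<in> I" "j \<in> I" "k \<in> I" "l \<in> I" "distinct [i, j, k, l]"
    "c j \<le> c i" "c l \<le> c k" "c k \<le> c i" "move 1 j i c \<in> S" "move 1 l k c \<in> S"
  shows "(tie c)\<^sup>*\<^sup>* (move 1 j i c) (move 1 l k c)"
proof (cases "c k < c j")
  case True
  let ?w = "move 1 l k (move 1 j i c)"
  have w: "?w \<in> S" by (rule S_square[OF assms(1-7) True assms(8,10,11)])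
  have w': "?w = move 1 j i (move 1 l k c)" using assms(6) by (auto simp: fun_eq_iff move_def)
  have "up (move 1 j i c) ?w" using assms w by (intro up_move) (auto simp: move_def)
  moreover have "up (move 1 l k c) ?w" unfolding w' using assms w[unfolded w'] by (intro up_move) (auto simp: move_def)
  moreover have "(move 1 j i c, c) \<in> above" "(move 1 l k c, c) \<in> above" using assms by (auto intro!: above_move)
  ultimately have "tie c (move 1 j i c) ?w" "tie c ?w (move 1 l k c)" using tie_up by blast+
  then show ?thesis by auto
next
  case False
  \<comment> \<open>Either \<open>l\<close> exceeds \<open>j\<close> and can hand a letter back to
    \<open>j\<close> after the first raising, or \<open>k\<close> hands one to \<open>j\<close>
    after the second raising and the chain property combines the two raisings at
    \<open>j\<close>.\<close>
  have u: "move 1 l i c \<in> S"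
  proof (cases "c j < c l")
    case True
    have "move 1 l j (move 1 j i c) = move 1 l i c" using assms(6) by (auto simp: fun_eq_iff move_def)
    moreover have "move 1 j i c j < move 1 j i c l" using True assms(6) by (auto simp: move_def)
    ultimately show ?thesis using S_lower[OF assms(10,5,3)] by metis
  next
    case lj: False
    have "move 1 k j (move 1 l k c) = move 1 l j c" using assms(6) by (auto simp: fun_eq_iff move_def)
    moreover have "move 1 l k c j < move 1 l k c k" using False assms(6) by (auto simp: move_def)
    ultimately have "move 1 l j c \<in> S" using S_lower[OF assms(11,4,3)] by metis
    then show ?thesis using S_chain_le[OF assms(1,2,3,5) _ assms(7) _ assms(10)] lj assms(6) by auto
  qed
  have "(tie c)\<^sup>*\<^sup>* (move 1 j i c) (move 1 l i c)" by (rule tie_source[OF assms(1,2,3,5)]) (use assms u in auto)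
  moreover have "(tie c)\<^sup>*\<^sup>* (move 1 l i c) (move 1 l k c)" by (rule tie_target[OF assms(1,2,4,5)]) (use assms u in auto)
  ultimately show ?thesis by (rule rtranclp_trans)
qed

lemma tie_moves: assumes "c \<in> S" "i \<in> I" "j \<in> I" "k \<in> I" "l \<in> I" "i \<noteq> j" "k \<noteq> l"
    "c j \<le> c i" "c l \<le> c k" "move 1 j i c \<in> S" "move 1 l k c \<in> S"
  shows "(tie c)\<^sup>*\<^sup>* (move 1 j i c) (move 1 l k c)"
proof -
  consider "i = k" | "j = l" | "j = k" "i = l" | "j = k" "i \<noteq> l" | "i = l" "j \<noteq> k" | "distinct [i, j, k, l]"
    using assms(6,7) by auto
  then show ?thesis
  proof cases
    case 1
    then show ?thesis using tie_source[OF assms(1,2,3,5)] assms by auto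
  next
    case 2
    then show ?thesis using tie_target[OF assms(1,2,4,5)] assms by auto
  next
    case 3
    then have eq: "c i = c j" using assms(8,9) by simp
    have "move 1 j i c \<circ> transpose i j = move 1 l k c"
      using 3 eq assms(6) by (auto simp: fun_eq_iff move_def transpose_def)
    with tie_transpose[OF assms(2,3,1,10) sqs_move[OF assms(2,3,6,8)]] show ?thesis by simp
  next
    case 4
    then show ?thesis using tie_chain[OF assms(1,2,3,5)] assms by auto
  next
    case 5
    then show ?thesis using tie_chain[OF assms(1,4,2,3)] assms by (auto intro: tie_sym)
  next
    case 6
    show ?thesis
    proof (cases "c k \<le> c i")
      case True
      show ?thesis by (rule tie_disjoint[OF assms(1-5) 6 assms(8,9) True assms(10,11)])
    next
      case False
      show ?thesis by (rule tie_sym[OF tie_disjoint[OF assms(1,4,5,2,3) _ assms(9,8) _ assms(11,10)]])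
        (use 6 False in auto)
    qed
  qed
qed

lemma move_swap: "move 1 j i c \<circ> swap k = move 1 (swap k j) (swap k i) (c \<circ> swap k)" if "i \<noteq> j"
  using that by (auto simp: fun_eq_iff move_def)

lemma tie_swap_move: assumes "c \<in> S" "k \<in> {1..n}" "c k < c (k + 1)" "i \<in> I" "j \<in> I" "i \<noteq> j" "c j \<le> c i" "move 1 j i c \<in> S"
  shows "(tie c)\<^sup>*\<^sup>* (c \<circ> swap k) (move 1 j i c)"
proof -
  have "up (c \<circ> swap k) (move 1 j i c \<circ> swap k)"
    unfolding move_swap[OF assms(6)]
  proof (rule up_move)
    show "move 1 (swap k j) (swap k i) (c \<circ> swap k) \<in> S"
      using S_swap[OF assms(8,2)] unfolding move_swap[OF assms(6)] .
    show "swap k i \<noteq> swap k j" using assms(6) by (metis transpose_involutory)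
  qed (use assms S_swap swap_in_I in auto)
  then have "tie c (c \<circ> swap k) (move 1 j i c \<circ> swap k)" using tie_up above_swap[OF assms(1-3)] by blast
  moreover have "(tie c)\<^sup>*\<^sup>* (move 1 j i c \<circ> swap k) (move 1 j i c)"
    by (rule tie_sym[OF tie_swap[OF assms(1,8,2) sqs_move[OF assms(4-7)]]])
  ultimately show ?thesis by (rule converse_rtranclp_into_rtranclp)
qed

lemma up_asc: "c \<in> S \<Longrightarrow> k \<in> {1..n} \<Longrightarrow> c k < c (k + 1) \<Longrightarrow> up c (c \<circ> swap k)"
  unfolding up_def using S_swap by blast

lemma tie_swap_swap: assumes "c \<in> S" "k \<in> {1..n}" "l \<in> {1..n}" "c k < c (k + 1)" "c l < c (l + 1)" "k < l"
  shows "(tie c)\<^sup>*\<^sup>* (c \<circ> swap k) (c \<circ> swap l)"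
proof -
  note d = up_asc[OF assms(1,2,4)] up_asc[OF assms(1,3,5)]
  note bx = up_above[OF d(1)] up_above[OF d(2)]
  note S = S_swap[OF assms(1,2)] S_swap[OF assms(1,3)]
  show ?thesis
  proof (cases "l = k + 1")
    case False
    then have kl: "k + 1 < l" using assms(6) by simp
    have "up (c \<circ> swap k) (c \<circ> swap k \<circ> swap l)" 
      by (rule up_asc[OF S(1) assms(3)]) (use assms kl in \<open>simp add: transpose_def\<close>)
    moreover have "up (c \<circ> swap l) (c \<circ> swap l \<circ> swap k)"
      by (rule up_asc[OF S(2) assms(2)]) (use assms kl in \<open>simp add: transpose_def\<close>)
    ultimately have "tie c (c \<circ> swap k) (c \<circ> swap k \<circ> swap l)" "tie c (c \<circ> swap l \<circ> swap k) (c \<circ> swap l)" using tie_up bx by blast+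
    moreover have "c \<circ> swap k \<circ> swap l = c \<circ> swap l \<circ> swap k" using kl by (auto simp: fun_eq_iff transpose_def)
    ultimately show ?thesis by (metis converse_rtranclp_into_rtranclp r_into_rtranclp)
  next
    case True
    have S2: "c \<circ> swap k \<circ> swap l \<in> S" "c \<circ> swap l \<circ> swap k \<in> S" using S S_swap assms by blast+
    have "up (c \<circ> swap k) (c \<circ> swap k \<circ> swap l)"
      by (rule up_asc[OF S(1) assms(3)]) (use assms True in \<open>simp add: transpose_def\<close>)
    moreover have "up (c \<circ> swap l) (c \<circ> swap l \<circ> swap k)"
      by (rule up_asc[OF S(2) assms(2)]) (use assms True in \<open>simp add: transpose_def\<close>)
    ultimately have 1: "up (c \<circ> swap k) (c \<circ> swap k \<circ> swap l)" "up (c \<circ> swap l) (c \<circ> swap l \<circ> swap k)" .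
    have "up (c \<circ> swap k \<circ> swap l) (c \<circ> swap k \<circ> swap l \<circ> swap k)"
      by (rule up_asc[OF S2(1) assms(2)]) (use assms True in \<open>simp add: transpose_def\<close>)
    moreover have "up (c \<circ> swap l \<circ> swap k) (c \<circ> swap l \<circ> swap k \<circ> swap l)"
      by (rule up_asc[OF S2(2) assms(3)]) (use assms True in \<open>simp add: transpose_def\<close>)
    ultimately have 2: "up (c \<circ> swap k \<circ> swap l) (c \<circ> swap k \<circ> swap l \<circ> swap k)" "up (c \<circ> swap l \<circ> swap k) (c \<circ> swap l \<circ> swap k \<circ> swap l)" .
    have b: "(c \<circ> swap k \<circ> swap l, c) \<in> above" "(c \<circ> swap l \<circ> swap k, c) \<in> above"
      using up_above[OF 1(1)] up_above[OF 1(2)] bx trans_above by (meson transD)+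
    have t: "tie c (c \<circ> swap k) (c \<circ> swap k \<circ> swap l)" "tie c (c \<circ> swap k \<circ> swap l) (c \<circ> swap k \<circ> swap l \<circ> swap k)"
      "tie c (c \<circ> swap l \<circ> swap k \<circ> swap l) (c \<circ> swap l \<circ> swap k)" "tie c (c \<circ> swap l \<circ> swap k) (c \<circ> swap l)"
      using tie_up 1 2 b bx by blast+
    have eq: "c \<circ> swap k \<circ> swap l \<circ> swap k = c \<circ> swap l \<circ> swap k \<circ> swap l"
    proof
      fix m
      consider "m = k" | "m = k + 1" | "m = k + 2" | "m \<notin> {k, k + 1, k + 2}" by blast
      then show "(c \<circ> swap k \<circ> swap l \<circ> swap k) m = (c \<circ> swap l \<circ> swap k \<circ> swap l) m"
        by cases (simp_all add: True transpose_def)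
    qed
    have "(tie c)\<^sup>*\<^sup>* (c \<circ> swap k) (c \<circ> swap k \<circ> swap l \<circ> swap k)"
      by (rule rtranclp_trans[of "tie c", OF r_into_rtranclp[of "tie c", OF t(1)] r_into_rtranclp[of "tie c", OF t(2)]])
    moreover have "(tie c)\<^sup>*\<^sup>* (c \<circ> swap k \<circ> swap l \<circ> swap k) (c \<circ> swap l)"
      unfolding eq by (rule rtranclp_trans[of "tie c", OF r_into_rtranclp[of "tie c", OF t(3)] r_into_rtranclp[of "tie c", OF t(4)]])
    ultimately show ?thesis by (rule rtranclp_trans)
  qed
qed

lemma up_peak: assumes "up c d" "up c e" shows "(tie c)\<^sup>*\<^sup>* d e"
proof -
  have c: "c \<in> S" "d \<in> S" "e \<in> S" using assms by (auto simp: up_def)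
  have ss: "(tie c)\<^sup>*\<^sup>* (c \<circ> swap k) (c \<circ> swap l)" if kl: "k \<in> {1..n}" "l \<in> {1..n}" "c k < c (k + 1)" "c l < c (l + 1)" for k l
    using tie_swap_swap[OF c(1) kl] tie_swap_swap[OF c(1) kl(2,1,4,3), THEN tie_sym] by (cases k l rule: linorder_cases) auto
  have d: "(\<exists>k\<in>{1..n}. c k < c (k + 1) \<and> d = c \<circ> swap k) \<or> (\<exists>i\<in>I. \<exists>j\<in>I. i \<noteq> j \<and> c j \<le> c i \<and> d = move 1 j i c)"
    using assms(1) unfolding up_def by blast
  have e: "(\<exists>k\<in>{1..n}. c k < c (k + 1) \<and> e = c \<circ> swap k) \<or> (\<exists>i\<in>I. \<exists>j\<in>I. i \<noteq> j \<and> c j \<le> c i \<and> e = move 1 j i c)"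
    using assms(2) unfolding up_def by blast
  from d e show ?thesis
    using c ss tie_moves[OF c(1)] tie_swap_move[OF c(1)] tie_swap_move[OF c(1), THEN tie_sym] by (elim disjE bexE conjE) blast+
qed

abbreviation upz :: "(nat \<Rightarrow> int) \<Rightarrow> (nat \<Rightarrow> int) \<Rightarrow> bool" where
  "upz u v \<equiv> up u v \<or> up v u"

lemma upz_sym: "upz\<^sup>*\<^sup>* a b \<Longrightarrow> upz\<^sup>*\<^sup>* b a"
  by (induction rule: rtranclp_induct) (auto intro: converse_rtranclp_into_rtranclp)

lemma upz_f: assumes "a \<in> C" "f a = Some b" shows "upz\<^sup>*\<^sup>* (cnt a) (cnt b)"
proof -
  have nI: "n \<in> I" "n + 1 \<in> I" using n by auto
  have e: "edge n (n + 1) a b" using assms edge_top by blast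
  have bC: "b \<in> C" using C_edge[OF nI _ e] assms by simp
  have S: "cnt a \<in> S" "cnt b \<in> S" using assms(1) bC by (auto simp: S_def)
  have mv: "cnt b = move 1 n (n + 1) (cnt a)" "cnt a = move 1 (n + 1) n (cnt b)"
    using edge_move[OF nI _ e] by simp_all
  have cb: "cnt b n = cnt a n - 1" "cnt b (n + 1) = cnt a (n + 1) + 1"
    using f_cnt[OF assms(2)] by simp_all
  have mS: "move 1 n (n + 1) (cnt a) \<in> S" "move 1 (n + 1) n (cnt b) \<in> S" using S mv by metis+
  have "n \<noteq> n + 1" "n + 1 \<noteq> n" by simp_all
  note u = up_move[OF S(2) nI this(1) _ mS(2)] up_move[OF S(1) nI(2,1) this(2) _ mS(1)]
  consider "cnt a (n + 1) + 2 \<le> cnt a n" | "cnt a n = cnt a (n + 1) + 1" | "cnt a n \<le> cnt a (n + 1)" by linarith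
  then show ?thesis
  proof cases
    case 1
    then have "up (cnt b) (cnt a)" using u(1) cb unfolding mv(2)[symmetric] by linarith
    then show ?thesis by blast
  next
    case 2
    from f_one[OF this] assms have "b = s n a" by simp
    then have "cnt b = cnt a \<circ> swap n" by (auto simp: s_cnt)
    then show ?thesis using up_swap[OF S(1), of n] n by auto
  next
    case 3
    then have "up (cnt a) (cnt b)" using u(2) unfolding mv(1)[symmetric] by blast
    then show ?thesis by blast
  qed
qed

lemma upz_step: assumes "a \<in> C" "component_step a b" shows "upz\<^sup>*\<^sup>* (cnt a) (cnt b)"
proof -
  have bC: "b \<in> C" by (rule C_step[OF assms])
  from assms(2) consider k where "k \<in> {1..n}" "b = s k a" | "f a = Some b" | "f b = Some a"
    unfolding component_step_def by blast
  then show ?thesis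
  proof cases
    case 1
    then have "cnt b = cnt a \<circ> swap k" by (auto simp: s_cnt)
    then show ?thesis using up_swap[of "cnt a" k] 1 assms(1) by (auto simp: S_def)
  qed (use upz_f[OF assms(1)] upz_f[OF bC, THEN upz_sym] in auto)
qed

lemma upz_b0: "b \<in> C \<Longrightarrow> upz\<^sup>*\<^sup>* (cnt b0) (cnt b)"
proof -
  assume "b \<in> C"
  then have "component_step\<^sup>*\<^sup>* b0 b" by (simp add: C_def)
  then show ?thesis
  proof (induction rule: rtranclp_induct)
    case (step a b)
    then show ?case using upz_step[of a b] by (simp add: C_def)
  qed simp
qed

text \<open>The set \<open>S\<close> is a single zigzag class, so uniqueness of normal forms gives
  one endpoint for all raising paths. It is dominant because an ascent would still allow a sorting
  step.\<close>

lemma maximum: "\<exists>\<mu>\<in>S. (\<forall>c\<in>S. up\<^sup>*\<^sup>* c \<mu>) \<and> (\<forall>k\<in>{1..n}. \<mu> (k + 1) \<le> \<mu> k)"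
proof -
  have ex: "\<exists>d. up\<^sup>*\<^sup>* c d \<and> (\<forall>z. \<not> up d z)" for c
    using wf_above
  proof (induction c rule: wf_induct_rule)
    case (less a)
    show ?case
    proof (cases "\<exists>b. up a b")
      case True
      then obtain b where b: "up a b" ..
      with less[OF up_above[OF b]] show ?thesis by (meson converse_rtranclp_into_rtranclp)
    qed blast
  qed
  have up: "up\<^sup>*\<^sup>* x y \<Longrightarrow> upz\<^sup>*\<^sup>* x y" for x y
    by (erule rtranclp_mono[THEN predicate2D, rotated]) auto
  obtain \<mu> where \<mu>: "up\<^sup>*\<^sup>* (cnt b0) \<mu>" "\<And>z. \<not> up \<mu> z" using ex by blast
  have b0: "cnt b0 \<in> S" by (auto simp: S_def C_def)
  have \<mu>S: "\<mu> \<in> S" using \<mu>(1) b0 by (cases rule: rtranclp.cases) (auto simp: up_def)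
  have "up\<^sup>*\<^sup>* c \<mu>" if cS: "c \<in> S" for c
  proof -
    obtain d where d: "up\<^sup>*\<^sup>* c d" "\<And>z. \<not> up d z" using ex by blast
    obtain b where b: "b \<in> C" "c = cnt b" using cS by (auto simp: S_def)
    have "upz\<^sup>*\<^sup>* d \<mu>"
      using upz_sym[OF up[OF d(1)]] upz_sym[OF upz_b0[OF b(1)]] up[OF \<mu>(1)] b(2) by simp
    then have "d = \<mu>"
      using zigzag_normal_forms_unique[OF wf_above, of up d \<mu>] up_above up_peak d(2) \<mu>(2)
      unfolding tie_def by blast
    with d(1) show ?thesis by simp
  qed
  moreover have "\<mu> (k + 1) \<le> \<mu> k" if "k \<in> {1..n}" for k
    using up_asc[OF \<mu>S that] \<mu>(2) by force
  ultimately show ?thesis using \<mu>S by blast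
qed

text \<open>Single lowerings reach just past the middle of the segment from \<open>c\<close> to its
  mirror image. The second half is the image of the first under the transposition of
  \<open>i\<close> and \<open>j\<close>, which turns \<open>k\<close> into
  \<open>c i - c j - k\<close>.\<close>

lemma S_move: assumes "c \<in> S" "i \<in> I" "j \<in> I" "0 \<le> k" "k \<le> c i - c j" shows "move k i j c \<in> S"
proof (cases "i = j")
  case True
  then have "move k i j c = c" using assms(4,5) by (auto simp: move_def)
  with assms(1) show ?thesis by simp
next
  case False
  \<comment> \<open>The bound says that the last of the \<open>m\<close> lowerings starts from a
    positive difference, \<open>c i - c j - 2 * (m - 1)\<close>.\<close>
  have half: "2 * int m - 2 < c i - c j \<Longrightarrow> move (int m) i j c \<in> S" for m
  proof (induction m)
    case 0
    have "move 0 i j c = c" by (auto simp: move_def)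
    with assms(1) show ?case by simp
  next
    case (Suc m)
    then have "move (int m) i j c \<in> S" by simp
    moreover have "move (int m) i j c j < move (int m) i j c i" using Suc.prems False by (simp add: move_def)
    ultimately have "move 1 i j (move (int m) i j c) \<in> S" using S_lower assms by blast
    moreover have "move 1 i j (move (int m) i j c) = move (int (Suc m)) i j c"
      using False by (auto simp: move_def fun_eq_iff)
    ultimately show ?case by simp
  qed
  show ?thesis
  proof (cases "2 * k - 2 < c i - c j")
    case True
    then show ?thesis using half[of "nat k"] assms(4) by simp
  next
    case f: False
    then have "move (c i - c j - k) i j c \<in> S" using half[of "nat (c i - c j - k)"] assms(5) by simp
    then have "move (c i - c j - k) i j c \<circ> transpose i j \<in> S" using S_transpose assms by blast
    moreover have "move (c i - c j - k) i j c \<circ> transpose i j = move k i j c"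
      using False by (auto simp: move_def fun_eq_iff transpose_def)
    ultimately show ?thesis by simp
  qed
qed

end

section \<open>From contents to weights and the Bruhat order\<close>

definition fundamental :: "nat \<Rightarrow> (nat \<Rightarrow> int) \<Rightarrow> weight" where
  "fundamental n c = (\<lambda>i. if i \<in> {1..n} then c i - c (i + 1) else 0)"

lemma fundamental_weights: "fundamental n c \<in> weights n"
  by (simp add: fundamental_def weights_def)

text \<open>The realization of the root as the difference of the unit vectors at i and j + 1; hence
  the shift by one between root indices and letters below.\<close>

lemma positive_root_eq: assumes "1 \<le> i" "i \<le> j"
  shows "positive_root n i j = fundamental n (\<lambda>k. (if k = i then 1 else 0) - (if k = j + 1 then 1 else 0))"
  using assms(2)
proof (induction j rule: dec_induct)
  case base
  show ?case using assms(1) by (auto simp: positive_root_def simple_root_def fundamental_def fun_eq_iff)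
next
  case (step j)
  have "positive_root n i (Suc j) k = positive_root n i j k + simple_root n (Suc j) k" for k
    using step.hyps by (simp add: positive_root_def)
  then show ?case unfolding step.IH
    by (auto simp: simple_root_def fundamental_def fun_eq_iff)
qed

lemma fundamental_move: assumes "1 \<le> i" "i \<le> j"
  shows "fundamental n (move k i (j + 1) c) l = fundamental n c l - k * positive_root n i j l"
  unfolding positive_root_eq[OF assms] using assms by (auto simp: fundamental_def move_def)

lemma coroot_pairing_fundamental: assumes "1 \<le> i" "i \<le> j" "j \<le> n"
  shows "coroot_pairing (fundamental n c) i j = c i - c (j + 1)"
  using assms(2,3)
proof (induction j rule: dec_induct)
  case base
  then show ?case using assms(1) by (simp add: coroot_pairing_def fundamental_def)
next
  case (step j)
  then show ?case using assms(1) by (simp add: coroot_pairing_def fundamental_def)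
qed

lemma bruhat_step_move: assumes "1 \<le> i" "i \<le> j" "j \<le> n"
   "c i - c (j + 1) \<ge> k \<and> k > 0 \<or> c i - c (j + 1) < k \<and> k < 0"
  shows "bruhat_step n (fundamental n (move k i (j + 1) c)) (fundamental n c)"
  unfolding bruhat_step_def
  using assms coroot_pairing_fundamental[OF assms(1-3)] fundamental_move[OF assms(1,2)]
  by (intro conjI fundamental_weights exI[of _ i] exI[of _ j] exI[of _ k]) auto

context atom_component
begin

lemma up_bruhat: assumes "up c d" shows "bruhat_step n (fundamental n c) (fundamental n d)"
proof -
  from assms consider k where "k \<in> {1..n}" "c k < c (k + 1)" "d = c \<circ> swap k"
    | i j where "i \<in> I" "j \<in> I" "i \<noteq> j" "c j \<le> c i" "d = move 1 j i c"
    unfolding up_def by blast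
  then show ?thesis
  proof cases
    case 1
    have "c = move (c (k + 1) - c k) k (k + 1) d" using 1(3) by (auto simp: move_def fun_eq_iff transpose_def)
    with bruhat_step_move[of k k n "c (k + 1) - c k" d] 1 show ?thesis by simp
  next
    case 2
    show ?thesis
    proof (cases "i < j")
      case True
      have "c = move 1 i (j - 1 + 1) d" using 2 True by (auto simp: move_def fun_eq_iff)
      moreover have "bruhat_step n (fundamental n (move 1 i (j - 1 + 1) d)) (fundamental n d)"
        using 2 True by (intro bruhat_step_move) (auto simp: move_def)
      ultimately show ?thesis by simp
    next
      case False
      then have ji: "j < i" using 2(3) by simp
      \<comment> \<open>Here the positive root runs from the smaller letter \<open>j\<close> to
        \<open>i\<close>, so lowering has coefficient -1 and falls under the negative clause of the
        order. Its strict inequality holds because the pairing with \<open>d\<close> is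
        \<open>c j - c i - 2\<close>.\<close>
      have "c = move (- 1) j (i - 1 + 1) d" using 2 ji by (auto simp: move_def fun_eq_iff)
      moreover have "bruhat_step n (fundamental n (move (- 1) j (i - 1 + 1) d)) (fundamental n d)"
        using 2 ji by (intro bruhat_step_move) (auto simp: move_def)
      ultimately show ?thesis by simp
    qed
  qed
qed

text \<open>A Bruhat step may move many letters at once and may go beyond the middle of a string, so
  closure rests on \<open>S_move\<close> rather than on single lowerings.\<close>

lemma bruhat_down: assumes "c \<in> S" "bruhat_step n \<nu> (fundamental n c)" shows "\<nu> \<in> fundamental n ` S"
proof -
  obtain i j k where ijk: "1 \<le> i" "i \<le> j" "j \<le> n" "\<And>l. fundamental n c l - \<nu> l = k * positive_root n i j l"
    "coroot_pairing (fundamental n c) i j \<ge> k \<and> k > 0 \<or> coroot_pairing (fundamental n c) i j < k \<and> k < 0"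
    using assms(2) unfolding bruhat_step_def by blast
  have "\<nu> = fundamental n (move k i (j + 1) c)"
    using fundamental_move[OF ijk(1,2), of n k c] ijk(4) by (auto simp: fun_eq_iff algebra_simps)
  moreover have "move k i (j + 1) c \<in> S"
  proof (cases "k > 0")
    case True
    then show ?thesis using S_move[OF assms(1), of i "j + 1" k] ijk coroot_pairing_fundamental[OF ijk(1-3)] by auto
  next
    case False
    then have "move (- k) (j + 1) i c \<in> S"
      using S_move[OF assms(1), of "j + 1" i "- k"] ijk coroot_pairing_fundamental[OF ijk(1-3)] by auto
    moreover have "move (- k) (j + 1) i c = move k i (j + 1) c" using ijk(2) by (auto simp: move_def fun_eq_iff)
    ultimately show ?thesis by simp
  qed
  ultimately show ?thesis by blast
qed

lemma component_weights: "\<exists>\<mu>\<in>dominant_weights n. (\<lambda>b. fundamental n (cnt b)) ` C = {\<nu> \<in> weights n. bruhat_le n \<nu> \<mu>}"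
proof -
  obtain c where c: "c \<in> S" "\<And>d. d \<in> S \<Longrightarrow> up\<^sup>*\<^sup>* d c" "\<And>k. k \<in> {1..n} \<Longrightarrow> c (k + 1) \<le> c k" using maximum by blast
  have "fundamental n c \<in> dominant_weights n"
    using c(3) fundamental_weights by (auto simp: dominant_weights_def fundamental_def)
  moreover have "(\<lambda>b. fundamental n (cnt b)) ` C = {\<nu> \<in> weights n. bruhat_le n \<nu> (fundamental n c)}"
  proof (intro equalityI subsetI)
    fix \<nu> assume "\<nu> \<in> (\<lambda>b. fundamental n (cnt b)) ` C"
    then obtain d where d: "d \<in> S" "\<nu> = fundamental n d" by (auto simp: S_def)
    have "up\<^sup>*\<^sup>* d c" by (rule c(2)[OF d(1)])
    then have "bruhat_le n \<nu> (fundamental n c)" unfolding bruhat_le_def d(2)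
      by (induction rule: rtranclp_induct) (auto dest: up_bruhat)
    then show "\<nu> \<in> {\<nu> \<in> weights n. bruhat_le n \<nu> (fundamental n c)}" using fundamental_weights d(2) by simp
  next
    fix \<nu> assume "\<nu> \<in> {\<nu> \<in> weights n. bruhat_le n \<nu> (fundamental n c)}"
    then have "(bruhat_step n)\<^sup>*\<^sup>* \<nu> (fundamental n c)" by (simp add: bruhat_le_def)
    then have "\<nu> \<in> fundamental n ` S"
    proof (induction rule: converse_rtranclp_induct)
      case (step \<nu> \<nu>')
      then show ?case using bruhat_down by blast
    qed (use c(1) in blast)
    then show "\<nu> \<in> (\<lambda>b. fundamental n (cnt b)) ` C" by (auto simp: S_def)
  qed
  ultimately show ?thesis by blast
qed

end

section \<open>The crystal of words\<close>

lemma content_nonneg: "0 \<le> content w i"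
  by (induction w) auto

lemma content_outside: "i \<notin> set w \<Longrightarrow> content w i = 0"
  by (induction w) auto

lemma words_atom_structure: assumes "1 \<le> n" shows "atom_structure n content sref (word_f n)"
proof
  show "1 \<le> n" by (rule assms)
  show "0 \<le> content w i" for w i by (rule content_nonneg)
  show "sref k (sref k w) = w" for k w by (rule sref_sref)
  show "content (sref k w) i = content w (swap k i)" for k w i
    by (simp add: sref_cnt transpose_def)
  show "content w k = content w (k + 1) \<Longrightarrow> sref k w = w" for w k by (rule sref_fixed)
  show "k + 1 < l \<Longrightarrow> sref k (sref l w) = sref l (sref k w)" for k l w
    by (rule sref_far) (simp add: far_def)
  show "sref k (sref (k + 1) (sref k w)) = sref (k + 1) (sref k (sref (k + 1) w))" for k w
    by (rule sref_braid)
  show "word_f n a = Some b \<Longrightarrow> word_f n a' = Some b \<Longrightarrow> a = a'" for a b a'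
    using word_e_iff by (metis option.inject)
  show "word_f n a = Some b \<Longrightarrow> content b = (content a)(n := content a n - 1, n + 1 := content a (n + 1) + 1)" for a b
    using word_f_step by blast
  show "content a (n + 1) < content a n \<Longrightarrow> \<exists>b. word_f n a = Some b" for a
    by (rule word_f_defined)
  show "k + 1 < n \<Longrightarrow> word_f n a = Some b \<Longrightarrow> word_f n (sref k a) = Some (sref k b)" for k a b
    by (rule word_f_sref_far) (simp_all add: far_def)
  show "word_f n a = Some b \<Longrightarrow> word_f n (sref n b) = Some (sref n a)" for a b
    by (rule word_f_sref_mirror)
  show "content a n = content a (n + 1) + 1 \<Longrightarrow> word_f n a = Some (sref n a)" for a
    by (rule word_f_sref_one)
  show "2 \<le> n \<Longrightarrow> word_f n (sref (n - 1) (sref n x)) = Some (sref (n - 1) (sref n y)) \<Longrightarrow>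
      word_f n (sref (n - 1) x) = Some (sref (n - 1) z) \<Longrightarrow> content y (n + 1) < content y n \<Longrightarrow> word_f n y = Some z" for x y z
    using triangle_a[of "n - 1" x y z] by simp
  show "2 \<le> n \<Longrightarrow> word_f n x = Some y \<Longrightarrow> word_f n (sref (n - 1) (sref n y)) = Some (sref (n - 1) (sref n u)) \<Longrightarrow>
      word_f n (sref (n - 1) x) = Some (sref (n - 1) z) \<Longrightarrow> u = z" for x y u z
    using triangle_b[of "n - 1" x y u z] by simp
  show "2 \<le> n \<Longrightarrow> word_f n y = Some x \<Longrightarrow> word_f n (sref (n - 1) (sref n z)) = Some (sref (n - 1) (sref n x)) \<Longrightarrow>
      \<exists>u. word_f n (sref (n - 1) u) = Some (sref (n - 1) x)" for x y z
    using chain_up[of "n - 1" y x z] by simp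
  show "\<exists>u. word_f n u = Some x" if n3: "3 \<le> n" and h:
      "word_f n (sref (n - 1) (sref (n - 2) (sref n (sref (n - 1) x)))) = Some (sref (n - 1) (sref (n - 2) (sref n (sref (n - 1) y))))"
      "content x (n - 1) < content x (n - 2)" "content x n \<le> content x (n - 1)" "content x (n + 1) \<le> content x (n - 1)"
      "word_f n u = Some y" for x y u
  proof -
    have "n - 2 + 1 = n - 1" "n - 2 + 2 = n" "n - 2 + 3 = n + 1" using n3 by auto
    from far_root_up[of "n - 2" x y u, unfolded this] h show ?thesis by blast
  qed
qed

lemma word_wt_content: "word_wt n w = fundamental n (content w)"
proof -
  have "(\<Sum>a\<leftarrow>w. letter_phi i a - letter_eps i a) = content w i - content w (i + 1)" for i
    by (induction w) (auto simp: letter_phi_def letter_eps_def)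
  then show ?thesis by (auto simp: word_wt_def fundamental_def)
qed

section \<open>Passing to the irreducible crystal\<close>

context
  fixes n :: nat and lam :: weight
  assumes n: "1 \<le> n"
begin

abbreviation E :: "nat list set" where "E \<equiv> elements (hw_crystal n lam)"

lemma E_f: assumes "i \<in> {1..n}" "word_f i a = Some b" shows "a \<in> E \<longleftrightarrow> b \<in> E"
proof
  assume "a \<in> E"
  then show "b \<in> E" using assms by (auto simp: hw_crystal_def elim!: rtranclp.rtrancl_into_rtrancl)
next
  assume "b \<in> E"
  moreover have "word_e i b = Some a" using assms(2) by (simp add: word_e_iff)
  ultimately show "a \<in> E" using assms by (auto simp: hw_crystal_def elim!: rtranclp.rtrancl_into_rtrancl)
qed

lemma E_op_power: "i \<in> {1..n} \<Longrightarrow> op_power (word_f i) k a = Some b \<Longrightarrow> a \<in> E \<longleftrightarrow> b \<in> E"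
proof (induction k arbitrary: b)
  case (Suc k)
  then obtain c where "op_power (word_f i) k a = Some c" "word_f i c = Some b"
    by (auto simp: op_power_Suc bind_eq_Some_conv)
  then show ?case using Suc.IH Suc.prems(1) E_f by blast
qed (simp add: op_power_0)

lemma E_sref: "i \<in> {1..n} \<Longrightarrow> a \<in> E \<Longrightarrow> sref i a \<in> E"
  by (cases rule: sref_cases[of a i]) (use E_op_power in blast)+

text \<open>A weight determines a content only up to a constant; the fixed total and the fixed range
  of letters supply the missing information.\<close>

lemma E_content: assumes "b \<in> E"
  shows "(\<Sum>i\<in>{1..n + 1}. content b i) = (\<Sum>i\<in>{1..n + 1}. content (highest_word n lam) i)"
    "i \<notin> {1..n + 1} \<Longrightarrow> content b i = 0"
proof -
  have f_step: "(\<Sum>i\<in>{1..n + 1}. content d i) = (\<Sum>i\<in>{1..n + 1}. content c i) \<and>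
      (\<forall>j. j \<notin> {1..n + 1} \<longrightarrow> content d j = content c j)" if "i \<in> {1..n}" "word_f i c = Some d" for i c d
  proof -
    have d: "content d = (content c)(i := content c i - 1, i + 1 := content c (i + 1) + 1)"
      using word_f_step[OF that(2)] by blast
    have "(\<Sum>j\<in>{1..n + 1}. content d j) - (\<Sum>j\<in>{1..n + 1}. content c j) =
        content d i - content c i + (content d (i + 1) - content c (i + 1))"
      using that(1) unfolding d by (intro sum_diff2) auto
    then show ?thesis using that(1) unfolding d by auto
  qed
  have "(\<lambda>c d. \<exists>i\<in>{1..n}. word_e i c = Some d \<or> word_f i c = Some d)\<^sup>*\<^sup>* (highest_word n lam) b"
    using assms by (simp add: hw_crystal_def)
  then have "(\<Sum>i\<in>{1..n + 1}. content b i) = (\<Sum>i\<in>{1..n + 1}. content (highest_word n lam) i) \<and>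
      (\<forall>j. j \<notin> {1..n + 1} \<longrightarrow> content b j = 0)"
  proof (induction rule: rtranclp_induct)
    case base
    have "set (highest_word n lam) \<subseteq> {1..n + 1}" by (auto simp: highest_word_def)
    then show ?case using content_outside by blast
  next
    case (step c d)
    then obtain i where i: "i \<in> {1..n}" "word_f i d = Some c \<or> word_f i c = Some d" using word_e_iff by blast
    from i(2) show ?case
    proof
      assume "word_f i d = Some c"
      from f_step[OF i(1) this] step.IH show ?thesis by simp
    next
      assume "word_f i c = Some d"
      from f_step[OF i(1) this] step.IH show ?thesis by simp
    qed
  qed
  then show "(\<Sum>i\<in>{1..n + 1}. content b i) = (\<Sum>i\<in>{1..n + 1}. content (highest_word n lam) i)"
    "i \<notin> {1..n + 1} \<Longrightarrow> content b i = 0" by blast+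
qed

text \<open>Equal weights make the difference of the contents constant on the n + 1 letters, and
  equal totals make that constant 0.\<close>

lemma E_content_eq: assumes "a \<in> E" "b \<in> E" "fundamental n (content a) = fundamental n (content b)"
  shows "content a = content b"
proof -
  define g where "g i = content a i - content b i" for i
  have d: "g i = g (i + 1)" if "i \<in> {1..n}" for i
    using fun_cong[OF assms(3), of i] that by (simp add: fundamental_def g_def)
  have const: "i \<le> n \<Longrightarrow> g (i + 1) = g 1" for i
    by (induction i) (use d in auto)
  have const': "g i = g 1" if "i \<in> {1..n + 1}" for i using const[of "i - 1"] that by auto
  have "(\<Sum>i\<in>{1..n + 1}. g i) = 0"
    unfolding g_def using E_content(1)[OF assms(1)] E_content(1)[OF assms(2)] by (simp only: sum_subtractf)
  moreover have "(\<Sum>i\<in>{1..n + 1}. g i) = (\<Sum>i\<in>{1..n + 1}. g 1)" by (intro sum.cong const' refl)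
  ultimately have g1: "g 1 = 0" by simp
  show ?thesis
  proof
    fix i
    have "g i = 0" using const'[of i] g1 E_content(2)[OF assms(1), of i] E_content(2)[OF assms(2), of i]
      by (cases "i \<in> {1..n + 1}") (auto simp: g_def)
    then show "content a i = content b i" by (simp add: g_def)
  qed
qed

lemma simple_reflection_sref: "i \<in> {1..n} \<Longrightarrow> simple_reflection (hw_crystal n lam) i = sref i"
  by (rule ext) (simp add: simple_reflection_def sref_def hw_crystal_def word_wt_content fundamental_def Let_def)

lemma weyl_related_iff: "weyl_related n (hw_crystal n lam) b b' \<longleftrightarrow> (\<exists>js. set js \<subseteq> {1..n} \<and> b = foldr sref js b')"
proof -
  have "set js \<subseteq> {1..n} \<Longrightarrow> foldr (simple_reflection (hw_crystal n lam)) js b' = foldr sref js b'" for js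
    by (induction js) (auto simp: simple_reflection_sref)
  then show ?thesis unfolding weyl_related_def by metis
qed

interpretation A: atom_structure n content sref "word_f n"
  by (rule words_atom_structure[OF n])

lemma component_step_edge: assumes "b \<in> E" "A.component_step b b'" shows "(b, b') \<in> B1_edges n (hw_crystal n lam)"
proof -
  have fop: "fop (hw_crystal n lam) = word_f" by (simp add: hw_crystal_def)
  from assms(2) consider k where "k \<in> {1..n}" "b' = sref k b" | "word_f n b = Some b' \<or> word_f n b' = Some b"
    unfolding A.component_step_def by blast
  then show ?thesis
  proof cases
    case 1
    then have "weyl_related n (hw_crystal n lam) b b'"
      unfolding weyl_related_iff by (intro exI[of _ "[k]"]) (simp add: sref_sref)
    then show ?thesis using assms(1) 1 E_sref by (simp add: B1_edges_def)
  next
    case 2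
    then have "b' \<in> E" using E_f[of n] assms(1) n by auto
    then show ?thesis using assms(1) 2 by (simp add: B1_edges_def fop)
  qed
qed

lemma component_steps_foldr: "set js \<subseteq> {1..n} \<Longrightarrow> A.component_step\<^sup>*\<^sup>* b (foldr sref js b)"
proof (induction js)
  case (Cons k js)
  then have "A.component_step (foldr sref js b) (sref k (foldr sref js b))" by (auto simp: A.component_step_def)
  then show ?case using Cons by auto
qed simp

text \<open>A graph edge may use a whole word of reflections, a component step only one. The set of
  crystal elements is closed under component steps, so the edges' restriction to it is respected in
  both directions.\<close>

lemma component_steps_iff: assumes "b \<in> E"
  shows "(b, b') \<in> (B1_edges n (hw_crystal n lam))\<^sup>* \<longleftrightarrow> A.component_step\<^sup>*\<^sup>* b b'"
proof
  interpret B: atom_component n content sref "word_f n" b by unfold_locales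
  assume "(b, b') \<in> (B1_edges n (hw_crystal n lam))\<^sup>*"
  then show "A.component_step\<^sup>*\<^sup>* b b'"
  proof (induction rule: rtrancl_induct)
    case (step c d)
    from step.hyps(2) consider js where "set js \<subseteq> {1..n}" "c = foldr sref js d"
      | "word_f n c = Some d \<or> word_f n d = Some c"
      by (auto simp: B1_edges_def weyl_related_iff) (auto simp: hw_crystal_def)
    then have "A.component_step\<^sup>*\<^sup>* c d"
    proof cases
      case 1
      then show ?thesis using B.step_sym component_steps_foldr by blast
    next
      case 2
      then show ?thesis by (auto simp: A.component_step_def)
    qed
    with step.IH show ?case by simp
  qed simp
next
  assume "A.component_step\<^sup>*\<^sup>* b b'"
  then have "(b, b') \<in> (B1_edges n (hw_crystal n lam))\<^sup>* \<and> b' \<in> E"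
  proof (induction rule: rtranclp_induct)
    case (step c d)
    then have "(c, d) \<in> B1_edges n (hw_crystal n lam)" using component_step_edge by blast
    with step.IH show ?case by (auto simp: B1_edges_def intro: rtrancl_into_rtrancl)
  qed (use assms in simp)
  then show "(b, b') \<in> (B1_edges n (hw_crystal n lam))\<^sup>*" by blast
qed

lemma component_steps_E: assumes "b \<in> E" "A.component_step\<^sup>*\<^sup>* b b'" shows "b' \<in> E"
  using assms(2,1) by (induction rule: rtranclp_induct) (use component_step_edge in \<open>auto simp: B1_edges_def\<close>)

lemma hw_crystal_atomic: "atomic_decomposition n (hw_crystal n lam) (B1_components n (hw_crystal n lam))"
  unfolding atomic_decomposition_def
proof (intro conjI ballI)
  let ?r = "(B1_edges n (hw_crystal n lam))\<^sup>* \<inter> E \<times> E"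
  have r: "(b, b') \<in> ?r \<longleftrightarrow> b \<in> E \<and> A.component_step\<^sup>*\<^sup>* b b'" for b b'
    using component_steps_iff component_steps_E by blast
  have eq: "equiv E ?r"
  proof (rule equivI)
    interpret B: atom_component n content sref "word_f n" b for b by unfold_locales
    show "?r \<subseteq> E \<times> E" by blast
    show "refl_on E ?r" by (auto simp: refl_on_def)
    show "sym ?r" unfolding sym_def r using B.step_sym component_steps_E by blast
    show "trans ?r" unfolding trans_def r by auto
  qed
  then show "partition_on E (B1_components n (hw_crystal n lam))"
    unfolding B1_components_def by (rule partition_on_quotient)
  fix A assume "A \<in> B1_components n (hw_crystal n lam)"
  then obtain b where b: "b \<in> E" "A = ?r `` {b}"
    unfolding B1_components_def by (auto elim!: quotientE)
  interpret B: atom_component n content sref "word_f n" b by unfold_locales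
  have A: "A = B.C" unfolding b(2) B.C_def using r b(1) by blast
  have wt: "wt (hw_crystal n lam) = (\<lambda>w. fundamental n (content w))"
    by (simp add: hw_crystal_def word_wt_content fun_eq_iff)
  show "inj_on (wt (hw_crystal n lam)) A"
  proof (rule inj_onI)
    fix x y assume xy: "x \<in> A" "y \<in> A" "wt (hw_crystal n lam) x = wt (hw_crystal n lam) y"
    then have "content x = content y" using b(2) unfolding wt by (intro E_content_eq) auto
    then show "x = y" using B.C_inj xy A by blast
  qed
  show "\<exists>\<mu>\<in>dominant_weights n. wt (hw_crystal n lam) ` A = {\<nu> \<in> weights n. bruhat_le n \<nu> \<mu>}"
    unfolding wt A by (rule B.component_weights)
qed

end

theorem theorem1:
  fixes n :: nat and lam :: weight
  assumes "n \<ge> 1" and "lam \<in> dominant_weights n"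
  shows "atomic_decomposition n (hw_crystal n lam) (B1_components n (hw_crystal n lam))"
  using hw_crystal_atomic[OF assms(1)] .

end
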